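(* Let $\alpha,\beta>-1$ and $\gamma=\max\{\alpha,\beta\}$. Let $r\ge 1$ be an integer and let $f:[-1,1]\to\mathbb{R}$ be a function whose derivative $f^{(r-1)}$ is absolutely continuous on $[-1,1]$ and satisfies $f^{(r-1)}(t)=f^{(r-1)}(-1)+\int_{-1}^t g(y)\,dy$ for all $t\in[-1,1]$, for some absolutely integrable $g$ of bounded variation on $[-1,1]$. For each $n$ let $E_n[f]=f-L_n[f]$, where $L_n[f]$ is the polynomial of degree at most $n-1$ interpolating $f$ at the $n$ roots of the Jacobi polynomial $P_n^{(\alpha,\beta)}$. Then for $n\ge r+1$, $$\|E_n[f]\|_\infty=O\left(n^{-r+\max\{0,\gamma-\frac12\}}\right).$$
   Context: $P_n^{(\alpha,\beta)}$ is the Jacobi polynomial of degree $n$ (orthogonal on $[-1,1]$ with respect to the weight $(1-t)^\alpha(1+t)^\beta$, normalized by $P_n^{(\alpha,\beta)}(1)=\binom{n+\alpha}{n}$); its $n$ roots are simple and lie in $(-1,1)$. $\|\cdot\|_\infty$ is the supremum norm on $[-1,1]$; $f^{(0)}=f$. The $O$-constant may depend on $f,r,\alpha,\beta$ but not on $n$. *)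

theory Defs
  imports "HOL-Analysis.Analysis"
begin

definition jacobi_weight :: "real \<Rightarrow> real \<Rightarrow> real \<Rightarrow> real" where
  "jacobi_weight \<alpha> \<beta> t = (1 - t) powr \<alpha> * (1 + t) powr \<beta>"

text \<open>
  The orthogonality condition is stated against all polynomials of lower degree. For
  \<open>\<alpha>, \<beta> > -1\<close> there is exactly one such polynomial; outside this range
  the description need not be meaningful. If an exponent is negative, the weight is unbounded near
  an end point of the interval, where \<open>powr\<close> assigns it the value 0; this does not affect
  the integral.
\<close>
definition jacobi_poly :: "real \<Rightarrow> real \<Rightarrow> nat \<Rightarrow> real poly" where
  "jacobi_poly \<alpha> \<beta> n = (THE p. degree p = n
     \<and> (\<forall>q. degree q < n \<longrightarrow>
          ((\<lambda>t. poly p t * poly q t * jacobi_weight \<alpha> \<beta> t) has_integral 0) {-1..1})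
     \<and> poly p 1 = (real n + \<alpha>) gchoose n)"

text \<open>
  Meaningful for \<open>n \<ge> 1\<close>, where \<open>degree p < n\<close> says that the degree is at
  most \<open>n - 1\<close>.
\<close>
definition jacobi_interp :: "real \<Rightarrow> real \<Rightarrow> nat \<Rightarrow> (real \<Rightarrow> real) \<Rightarrow> real poly" where
  "jacobi_interp \<alpha> \<beta> n f = (THE p. degree p < n
     \<and> (\<forall>x. poly (jacobi_poly \<alpha> \<beta> n) x = 0 \<longrightarrow> poly p x = f x))"

definition interp_error :: "real \<Rightarrow> real \<Rightarrow> nat \<Rightarrow> (real \<Rightarrow> real) \<Rightarrow> real \<Rightarrow> real" where
  "interp_error \<alpha> \<beta> n f t = f t - poly (jacobi_interp \<alpha> \<beta> n f) t"

text \<open>Only used for functions that are bounded on \<open>[-1,1]\<close>.\<close>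
definition sup_norm :: "(real \<Rightarrow> real) \<Rightarrow> real" where
  "sup_norm h = (SUP t\<in>{-1..1}. \<bar>h t\<bar>)"

text \<open>
  Derivatives relative to a set: at the end points of a closed interval they are one-sided, and
  values of the function outside the set play no role.
\<close>
fun nth_deriv_on :: "real set \<Rightarrow> nat \<Rightarrow> (real \<Rightarrow> real) \<Rightarrow> real \<Rightarrow> real" where
  "nth_deriv_on S 0 f = f"
| "nth_deriv_on S (Suc k) f = (\<lambda>t. vector_derivative (nth_deriv_on S k f) (at t within S))"

definition times_differentiable_on :: "nat \<Rightarrow> (real \<Rightarrow> real) \<Rightarrow> real set \<Rightarrow> bool" where
  "times_differentiable_on m f S \<longleftrightarrow> (\<forall>k<m. nth_deriv_on S k f differentiable_on S)"

definition abs_continuous_on :: "real set \<Rightarrow> (real \<Rightarrow> real) \<Rightarrow> bool" where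
  "abs_continuous_on S h \<longleftrightarrow> (\<forall>\<epsilon>>0. \<exists>\<delta>>0. \<forall>N. \<forall>a b :: nat \<Rightarrow> real.
     (\<forall>i<N. a i \<le> b i \<and> {a i..b i} \<subseteq> S)
     \<and> disjoint_family_on (\<lambda>i. {a i<..<b i}) {..<N}
     \<and> (\<Sum>i<N. b i - a i) < \<delta>
     \<longrightarrow> (\<Sum>i<N. \<bar>h (b i) - h (a i)\<bar>) < \<epsilon>)"

definition bounded_variation_on :: "real set \<Rightarrow> (real \<Rightarrow> real) \<Rightarrow> bool" where
  "bounded_variation_on S h \<longleftrightarrow> (\<exists>M. \<forall>N. \<forall>x :: nat \<Rightarrow> real.
     (\<forall>i\<le>N. x i \<in> S) \<and> (\<forall>i<N. x i \<le> x (Suc i))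
     \<longrightarrow> (\<Sum>i<N. \<bar>h (x (Suc i)) - h (x i)\<bar>) \<le> M)"

end

theory Submission
  imports Defs
begin

text \<open>
  For fixed \<open>x\<close> let \<open>K\<^sub>s(u)\<close> be the interpolation error at \<open>x\<close> of \<open>y \<mapsto> (y - u)\<^sub>+\<^sup>s / s!\<close> (the Peano kernel).
  Step functions are interpolated with error at most \<open>\<Lambda>\<close>, the maximum of the fundamental Lagrange
  polynomials, because the partial sums of these polynomials alternate in sign; so \<open>\<bar>K\<^sub>0\<bar> \<le> \<Lambda>\<close>. As \<open>K\<^sub>s\<close> is orthogonal to all polynomials of
  degree less than \<open>n - s - 1\<close>, the function \<open>K\<^sub>s\<^sub>+\<^sub>1(u) = \<integral> K\<^sub>s\<close> over \<open>[u, 1]\<close> is at most \<open>max \<bar>K\<^sub>s\<bar>\<close> times the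
  \<open>L\<^sup>1\<close> distance of a step function to these polynomials, which is \<open>O(1 / n)\<close> by interpolation at
  the Chebyshev nodes of the second kind. Hence \<open>K\<^sub>r = O(\<Lambda> n\<^sup>-\<^sup>r)\<close>, and for \<open>g\<close> of bounded variation
  the second mean value theorem bounds the error \<open>\<integral> K\<^sub>r\<^sub>-\<^sub>1 g\<close> by \<open>O(max \<bar>K\<^sub>r\<bar>)\<close>.

  That \<open>\<Lambda> = O(n powr max 0 (\<gamma> - 1/2))\<close> follows from the differential equation of the Jacobi
  polynomials: in Liouville form it has an energy which is constant up to bounded factors at
  distance at least \<open>c / n\<^sup>2\<close> from \<open>\<plusminus>1\<close>, and all roots lie there. Comparing the energies at \<open>x\<close> and
  at a root \<open>z\<close> bounds \<open>P(x) / ((x - z) P'(z))\<close>.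
\<close>

section \<open>Interpolation of step functions\<close>

text \<open>The usual estimate, Lebesgue constant times best approximation, misses the rate: the
  Lebesgue constant of these nodes grows like \<open>n powr (\<gamma> + 1/2)\<close> for \<gamma> >
  -1/2, and at least like log n in every case. Step functions cost less, because the sum of absolute
  values is replaced by a single fundamental polynomial; the Peano kernels carry this gain over to
  f. As g may jump, the last derivative enters only in integrated form, and g itself only through
  monotone functions. On the Jacobi side no asymptotic formula is used. The energy is quadratic in
  the polynomial, so normalisation is irrelevant and only ratios between two points matter. Its
  logarithmic derivative is O(1 / (N (1 - x^2)^(3/2))), whose integral is O(1 / (N sqrt (1 - x^2))):
  this stays bounded exactly up to distance of order 1 / n^2 from the end points, which is where
  that threshold comes from. In the remaining strips the differential equation is used
  directly.\<close>

definition lagrange_basis :: "real set \<Rightarrow> real \<Rightarrow> real poly" where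
  "lagrange_basis Z z = smult (inverse (\<Prod>w\<in>Z-{z}. z - w)) (\<Prod>w\<in>Z-{z}. [:- w, 1:])"

lemma poly_lagrange_basis:
  assumes "finite Z" "z \<in> Z" "w \<in> Z"
  shows "poly (lagrange_basis Z z) w = (if w = z then 1 else 0)"
proof (cases "w = z")
  case True
  have "(\<Prod>v\<in>Z-{z}. z - v) \<noteq> 0"
    using assms by auto
  then show ?thesis
    using True by (simp add: lagrange_basis_def poly_prod)
next
  case False
  have "poly (\<Prod>v\<in>Z-{z}. [:- v, 1:]) w = 0"
    using False assms by (simp add: poly_prod)
  then show ?thesis
    using False by (simp add: lagrange_basis_def)
qed

lemma degree_lagrange_basis:
  assumes "finite Z" "z \<in> Z"
  shows "degree (lagrange_basis Z z) < card Z"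
proof -
  have "degree (lagrange_basis Z z) \<le> degree (\<Prod>w\<in>Z-{z}. [:- w, 1:] :: real poly)"
    unfolding lagrange_basis_def by (rule degree_smult_le)
  also have "\<dots> \<le> (\<Sum>w\<in>Z-{z}. 1)"
    by (rule order_trans[OF degree_prod_sum_le]) (use assms in auto)
  also have "\<dots> < card Z"
    using card_Diff1_less[OF assms] by simp
  finally show ?thesis .
qed

text \<open>This is the classical formula P(x) / ((x - z) P'(z)) in a form free of division, hence
  valid at x = z too. It links bounds on the Jacobi polynomial to bounds on the fundamental
  polynomials.\<close>

lemma lagrange_basis_nonroot:
  assumes "P = smult c (\<Prod>w\<in>Z. [:- w, 1:])" "c \<noteq> 0" "finite Z" "z \<in> Z"
  shows "poly (pderiv P) z \<noteq> 0"
    and "poly (lagrange_basis Z z) x * (x - z) * poly (pderiv P) z = poly P x"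
proof -
  define Q where "Q = (\<Prod>w\<in>Z-{z}. [:- w, 1:] :: real poly)"
  have P: "P = smult c ([:- z, 1:] * Q)"
    unfolding assms(1) Q_def using assms by (subst prod.remove[of Z z]) auto
  have d: "poly (pderiv P) z = c * poly Q z"
    by (simp add: P pderiv_smult pderiv_mult pderiv_pCons del: mult_pCons_left)
  have Qz: "poly Q z = (\<Prod>w\<in>Z-{z}. z - w)"
    by (simp add: Q_def poly_prod)
  have nz: "(\<Prod>w\<in>Z-{z}. z - w) \<noteq> 0"
    using assms by auto
  then show "poly (pderiv P) z \<noteq> 0"
    using d Qz assms by simp
  show "poly (lagrange_basis Z z) x * (x - z) * poly (pderiv P) z = poly P x"
    unfolding d Qz using nz by (simp add: Qz P lagrange_basis_def algebra_simps flip: Q_def)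
qed

definition interpolant :: "real set \<Rightarrow> (real \<Rightarrow> real) \<Rightarrow> real poly" where
  "interpolant Z F = (\<Sum>z\<in>Z. smult (F z) (lagrange_basis Z z))"

lemma degree_interpolant:
  assumes "finite Z" "Z \<noteq> {}"
  shows "degree (interpolant Z F) < card Z"
proof -
  have "degree (interpolant Z F) \<le> card Z - 1"
    unfolding interpolant_def
  proof (rule degree_sum_le)
    fix z assume "z \<in> Z"
    then show "degree (smult (F z) (lagrange_basis Z z)) \<le> card Z - 1"
      using degree_lagrange_basis[OF assms(1)] degree_smult_le[of "F z" "lagrange_basis Z z"]
      by fastforce
  qed (use assms in auto)
  moreover have "card Z > 0"
    using assms by (simp add: card_gt_0_iff)
  ultimately show ?thesis
    by simp
qed

lemma poly_interpolant:
  assumes "finite Z" "w \<in> Z"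
  shows "poly (interpolant Z F) w = F w"
proof -
  have "poly (interpolant Z F) w = (\<Sum>z\<in>Z. F z * (if w = z then 1 else 0))"
    unfolding interpolant_def poly_sum
    by (rule sum.cong) (use assms poly_lagrange_basis in auto)
  also have "\<dots> = F w"
    using assms by (simp add: if_distrib sum.delta cong: if_cong)
  finally show ?thesis .
qed

lemma poly_interpolant_sum:
  "poly (interpolant Z F) x = (\<Sum>z\<in>Z. F z * poly (lagrange_basis Z z) x)"
  by (simp add: interpolant_def poly_sum)

lemma interpolant_unique:
  assumes "finite Z" "degree p < card Z" "\<And>z. z \<in> Z \<Longrightarrow> poly p z = F z"
  shows "p = interpolant Z F"
proof -
  have "Z \<noteq> {}"
    using assms by auto
  show ?thesis
    by (rule poly_eqI_degree[of Z])
       (use assms poly_interpolant degree_interpolant[OF assms(1) \<open>Z \<noteq> {}\<close>] in auto)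
qed

text \<open>Neville's recursion adds one node of each kind; both of its terms then carry the same sign.\<close>
lemma step_interpolant_sign:
  fixes s x :: real
  assumes "finite A" "finite B" "A \<inter> B = {}" "degree p < card (A \<union> B)"
    and "\<And>a. a \<in> A \<Longrightarrow> poly p a = 1" "\<And>b. b \<in> B \<Longrightarrow> poly p b = 0"
    and "\<And>a b. a \<in> A \<Longrightarrow> b \<in> B \<Longrightarrow> 0 < s * (a - b)"
    and "\<And>a. a \<in> A \<Longrightarrow> 0 \<le> s * (a - x)"
  shows "0 \<le> (\<Prod>b\<in>B. s * (x - b)) * poly p x"
  using assms
proof (induction "card (A \<union> B)" arbitrary: A B p)
  case 0
  then show ?case by simp
next
  case (Suc n)
  show ?case
  proof (cases "A = {} \<or> B = {}")
    case True
    then show ?thesis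
    proof
      assume "A = {}"
      then have "p = 0"
        using Suc.prems poly_eqI_degree[of B p 0] by auto
      then show ?thesis by simp
    next
      assume "B = {}"
      then have "p = 1"
        using Suc.prems poly_eqI_degree[of A p 1] by auto
      then show ?thesis using \<open>B = {}\<close> by simp
    qed
  next
    case False
    then obtain a b where a: "a \<in> A" and b: "b \<in> B"
      by auto
    define F where "F = (\<lambda>z. if z \<in> A then 1 else 0 :: real)"
    define p1 where "p1 = interpolant (A \<union> (B - {b})) F"
    define p2 where "p2 = interpolant ((A - {a}) \<union> B) F"
    have fin: "finite (A \<union> B)" using Suc.prems by simp
    have e1: "A \<union> (B - {b}) = (A \<union> B) - {b}" and e2: "(A - {a}) \<union> B = (A \<union> B) - {a}"
      using Suc.prems a b by auto
    have c1: "card (A \<union> (B - {b})) = n" and c2: "card ((A - {a}) \<union> B) = n"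
      unfolding e1 e2 using Suc.hyps(2) a b fin by (simp_all add: card_Diff_singleton)
    have ne1: "A \<union> (B - {b}) \<noteq> {}" and ne2: "(A - {a}) \<union> B \<noteq> {}"
      using a b by auto
    have d1: "degree p1 < n" and d2: "degree p2 < n"
      unfolding p1_def p2_def
      using degree_interpolant[OF _ ne1, of F] degree_interpolant[OF _ ne2, of F] c1 c2 Suc.prems
      by auto
    have v1: "poly p1 z = F z" if "z \<in> A \<union> (B - {b})" for z
      unfolding p1_def by (rule poly_interpolant) (use that Suc.prems in auto)
    have v2: "poly p2 z = F z" if "z \<in> (A - {a}) \<union> B" for z
      unfolding p2_def by (rule poly_interpolant) (use that Suc.prems in auto)
    have ab: "0 < s * (a - b)"
      using Suc.prems a b by blast
    \<comment> \<open>Neville's identity: each linear factor vanishes at the node that the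
      interpolant next to it lacks, so both sides agree at all nodes.\<close>
    have "smult (a - b) p = [:- b, 1:] * p1 - [:- a, 1:] * p2" (is "_ = ?R")
    proof (rule poly_eqI_degree[of "A \<union> B"])
      fix z assume z: "z \<in> A \<union> B"
      have pz: "poly p z = F z"
        using z Suc.prems by (auto simp: F_def)
      show "poly (smult (a - b) p) z = poly ?R z"
        using z v1[of z] v2[of z] pz Suc.prems a b
        by (cases "z = a"; cases "z = b") (auto simp: algebra_simps)
    next
      show "degree (smult (a - b) p) < card (A \<union> B)"
        using Suc.prems(4) degree_smult_le[of "a - b" p] by linarith
      have "degree ([:- b, 1:] * p1) \<le> n" "degree ([:- a, 1:] * p2) \<le> n"
        using degree_mult_le[of "[:- b, 1:]" p1] degree_mult_le[of "[:- a, 1:]" p2] d1 d2 by auto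
      then have "degree ?R \<le> n"
        by (rule degree_diff_le)
      then show "degree ?R < card (A \<union> B)"
        using Suc.hyps(2) by simp
    qed
    then have "poly (smult (a - b) p) x = poly ?R x"
      by simp
    then have eq: "(a - b) * poly p x = (x - b) * poly p1 x - (x - a) * poly p2 x"
      by (simp add: algebra_simps)
    define PB where "PB = (\<Prod>b'\<in>B-{b}. s * (x - b'))"
    have PB: "(\<Prod>b'\<in>B. s * (x - b')) = s * (x - b) * PB"
      unfolding PB_def using Suc.prems b prod.remove[of B b] by simp
    have i1: "0 \<le> PB * poly p1 x"
      unfolding PB_def by (rule Suc.hyps(1)[of A]) (use Suc.prems c1 d1 v1 in \<open>auto simp: F_def\<close>)
    have i2: "0 \<le> (\<Prod>b'\<in>B. s * (x - b')) * poly p2 x"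
    proof (rule Suc.hyps(1)[of "A - {a}"])
      show "poly p2 b' = 0" if "b' \<in> B" for b'
        using v2[of b'] that Suc.prems by (auto simp: F_def)
    qed (use Suc.prems c2 d2 v2 in \<open>auto simp: F_def\<close>)
    have ax: "0 \<le> s * (a - x)"
      using Suc.prems a by blast
    have "s * (a - b) * ((\<Prod>b'\<in>B. s * (x - b')) * poly p x)
        = s * (\<Prod>b'\<in>B. s * (x - b')) * ((a - b) * poly p x)"
      by (simp add: algebra_simps)
    \<comment> \<open>The first summand is a square times the hypothesis for \<open>p1\<close>; the
      second is \<open>s * (a - x)\<close> times the hypothesis for \<open>p2\<close>. Both are
      nonnegative.\<close>
    also have "\<dots> = (s * (x - b))\<^sup>2 * (PB * poly p1 x)
        + s * (a - x) * (s * (x - b) * PB * poly p2 x)"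
      unfolding eq PB power2_eq_square by algebra
    also have "\<dots> \<ge> 0"
      using mult_nonneg_nonneg[OF ax i2] i1 unfolding PB by simp
    finally show ?thesis
      using ab by (simp add: zero_le_mult_iff)
  qed
qed

text \<open>Here \<open>a\<close> is the node of \<open>A\<close> nearest to \<open>x\<close>.
  Moving it from \<open>A\<close> to \<open>B\<close> adds a negative factor to the product in
  \<open>step_interpolant_sign\<close>, so the sums over \<open>A\<close> and over
  \<open>A - {a}\<close> have opposite signs; as they differ by the fundamental polynomial of
  \<open>a\<close>, neither exceeds it in absolute value. Taking \<open>s\<close> as 1 or -1 covers
  both sides of \<open>x\<close>.\<close>

lemma lagrange_partial_sum_bound:
  fixes s x :: real
  assumes "finite A" "finite B" "A \<inter> B = {}" "a \<in> A"
    and sep: "\<And>a b. a \<in> A \<Longrightarrow> b \<in> B \<Longrightarrow> 0 < s * (a - b)"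
    and first: "\<And>a'. a' \<in> A - {a} \<Longrightarrow> 0 < s * (a' - a)"
    and ax: "0 < s * (a - x)"
  shows "\<bar>\<Sum>z\<in>A. poly (lagrange_basis (A \<union> B) z) x\<bar> \<le> \<bar>poly (lagrange_basis (A \<union> B) a) x\<bar>"
proof -
  define Z where "Z = A \<union> B"
  define p where "p A' = interpolant Z (\<lambda>z. if z \<in> A' then 1 else 0)" for A'
  have fin: "finite Z" and ne: "Z \<noteq> {}" and aZ: "a \<in> Z"
    using assms by (auto simp: Z_def)
  have psum: "poly (p A') y = (\<Sum>z\<in>A'. poly (lagrange_basis Z z) y)" if "A' \<subseteq> Z" for A' y
  proof -
    have "poly (p A') y = (\<Sum>z\<in>Z. if z \<in> A' then poly (lagrange_basis Z z) y else 0)"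
      unfolding p_def poly_interpolant_sum by (rule sum.cong) auto
    also have "\<dots> = (\<Sum>z\<in>A'. poly (lagrange_basis Z z) y)"
      using sum.inter_restrict[OF fin, of "\<lambda>z. poly (lagrange_basis Z z) y" A'] that
      by (simp add: Int_absorb1)
    finally show ?thesis .
  qed
  have deg: "degree (p A') < card Z" and val: "z \<in> Z \<Longrightarrow> poly (p A') z = (if z \<in> A' then 1 else 0)"
    for A' z
    unfolding p_def using degree_interpolant[OF fin ne] poly_interpolant[OF fin] by auto
  have split: "poly (p A) x = poly (lagrange_basis Z a) x + poly (p (A - {a})) x"
    using assms psum[of A] psum[of "A - {a}"] sum.remove[of A a "\<lambda>z. poly (lagrange_basis Z z) x"]
    by (metis Diff_subset Un_upper1 Z_def subset_trans)
  define PB where "PB = (\<Prod>b\<in>B. s * (x - b))"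
  have s1: "0 \<le> PB * poly (p A) x"
    unfolding PB_def
  proof (rule step_interpolant_sign[of A])
    show "0 \<le> s * (a' - x)" if "a' \<in> A" for a'
    proof -
      have "0 \<le> s * (a' - a)"
        using first[of a'] that by (cases "a' = a") auto
      then show ?thesis
        using ax by (simp add: algebra_simps)
    qed
  qed (use assms deg[of A] val[of _ A] in \<open>auto simp: Z_def\<close>)
  have "0 \<le> (\<Prod>b\<in>insert a B. s * (x - b)) * poly (p (A - {a})) x"
  proof (rule step_interpolant_sign[of "A - {a}"])
    show "0 \<le> s * (a' - x)" if "a' \<in> A - {a}" for a'
      using first[of a'] ax that by (simp add: algebra_simps)
    show "0 < s * (a' - b)" if "a' \<in> A - {a}" "b \<in> insert a B" for a' b
      using first[of a'] sep[of a' b] that by auto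
    have "A - {a} \<union> insert a B = Z"
      using assms by (auto simp: Z_def)
    then show "degree (p (A - {a})) < card (A - {a} \<union> insert a B)"
      using deg by simp
    show "poly (p (A - {a})) b = 0" if "b \<in> insert a B" for b
      using val[of b "A - {a}"] that assms by (auto simp: Z_def)
  qed (use assms val[of _ "A - {a}"] in \<open>auto simp: Z_def\<close>)
  also have "(\<Prod>b\<in>insert a B. s * (x - b)) * poly (p (A - {a})) x
      = - (s * (a - x)) * (PB * poly (p (A - {a})) x)"
    using assms by (subst prod.insert) (auto simp: PB_def algebra_simps)
  finally have s2: "PB * poly (p (A - {a})) x \<le> 0"
    using ax by (metis mult_minus_left neg_0_le_iff_le mult_le_0_iff not_le)
  have "\<bar>poly (p A) x\<bar> \<le> \<bar>poly (lagrange_basis Z a) x\<bar>"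
  \<comment> \<open>If the product vanishes, the sign argument says nothing; but then
    \<open>x\<close> is a node of \<open>B\<close>, where the sum is 0.\<close>
  proof (cases "PB = 0")
    case True
    then obtain b where "b \<in> B" "s * (x - b) = 0"
      using assms by (auto simp: PB_def)
    then have "b = x"
      using ax by auto
    then have "poly (p A) x = 0"
      using val[of x A] \<open>b \<in> B\<close> assms by (auto simp: Z_def)
    then show ?thesis by simp
  next
    case False
    then show ?thesis
      using s1 s2 split by (cases "PB > 0") (auto simp: zero_le_mult_iff mult_le_0_iff)
  qed
  then show ?thesis
    using psum[of A x] by (simp add: Z_def)
qed

text \<open>For x < u the error is, up to sign, the sum over the nodes from u on; for u \<le> x it
  is the sum over the nodes below u, because all fundamental polynomials add up to 1. In both cases
  the nodes summed over lie on one side of x.\<close>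

lemma step_interpolation_error:
  fixes u x \<Lambda> :: real
  assumes "finite Z" "Z \<noteq> {}" "0 \<le> \<Lambda>" "\<And>z. z \<in> Z \<Longrightarrow> \<bar>poly (lagrange_basis Z z) x\<bar> \<le> \<Lambda>"
  shows "\<bar>of_bool (u \<le> x) - (\<Sum>z\<in>Z. of_bool (u \<le> z) * poly (lagrange_basis Z z) x)\<bar> \<le> \<Lambda>"
proof -
  define A where "A = {z\<in>Z. u \<le> z}"
  define B where "B = {z\<in>Z. z < u}"
  have AB: "finite A" "finite B" "A \<inter> B = {}" "Z = A \<union> B"
    using assms by (auto simp: A_def B_def)
  have S: "(\<Sum>z\<in>Z. of_bool (u \<le> z) * poly (lagrange_basis Z z) x) = (\<Sum>z\<in>A. poly (lagrange_basis Z z) x)"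
    using assms by (intro sum.mono_neutral_cong_right) (auto simp: A_def)
  have one: "(\<Sum>z\<in>Z. poly (lagrange_basis Z z) x) = 1"
  proof -
    have "1 = interpolant Z (\<lambda>_. 1)"
      by (rule interpolant_unique) (use assms in \<open>auto simp: card_gt_0_iff\<close>)
    then have "poly (interpolant Z (\<lambda>_. 1)) x = poly 1 x"
      by simp
    then show ?thesis
      by (simp add: poly_interpolant_sum)
  qed
  show ?thesis
  proof (cases "u \<le> x")
    case False
    show ?thesis
    proof (cases "A = {}")
      case False
      have "\<bar>\<Sum>z\<in>A. poly (lagrange_basis (A \<union> B) z) x\<bar> \<le> \<bar>poly (lagrange_basis (A \<union> B) (Min A)) x\<bar>"
      proof (rule lagrange_partial_sum_bound[of _ _ _ 1])
        show "Min A \<in> A" by (rule Min_in[OF AB(1) False])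
        show "0 < 1 * (a' - Min A)" if "a' \<in> A - {Min A}" for a'
          using that Min_le[of A a'] AB(1) by (auto simp: less_le)
        show "0 < 1 * (Min A - x)"
          using Min_in[OF AB(1) False] \<open>\<not> u \<le> x\<close> by (simp add: A_def)
      qed (use AB(1-3) False in \<open>auto simp: A_def B_def\<close>)
      also have "\<dots> \<le> \<Lambda>"
        using assms(4)[of "Min A"] Min_in[OF AB(1) False] AB(4) by (metis UnI1)
      finally show ?thesis
        using \<open>\<not> u \<le> x\<close> S AB(4) by simp
    qed (use \<open>\<not> u \<le> x\<close> S assms in auto)
  next
    case True
    have e: "1 - (\<Sum>z\<in>A. poly (lagrange_basis Z z) x) = (\<Sum>z\<in>B. poly (lagrange_basis Z z) x)"
      using one sum.union_disjoint[OF AB(1-3), of "\<lambda>z. poly (lagrange_basis Z z) x"] AB(4) by simp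
    show ?thesis
    proof (cases "B = {}")
      case False
      have "\<bar>\<Sum>z\<in>B. poly (lagrange_basis (B \<union> A) z) x\<bar> \<le> \<bar>poly (lagrange_basis (B \<union> A) (Max B)) x\<bar>"
      proof (rule lagrange_partial_sum_bound[of _ _ _ "-1"])
        show "Max B \<in> B" by (rule Max_in[OF AB(2) False])
        show "0 < - 1 * (a' - Max B)" if "a' \<in> B - {Max B}" for a'
          using that Max_ge[of B a'] AB(2) by (auto simp: less_le)
        show "0 < - 1 * (Max B - x)"
          using Max_in[OF AB(2) False] \<open>u \<le> x\<close> by (simp add: B_def)
      qed (use AB(1-3) False in \<open>auto simp: A_def B_def\<close>)
      also have "\<dots> \<le> \<Lambda>"
        using assms(4)[of "Max B"] Max_in[OF AB(2) False] AB(4) by (metis UnI2 Un_commute)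
      finally show ?thesis
        using True S e AB(4) by (simp add: Un_commute)
    qed (use True S e assms in auto)
  qed
qed

section \<open>Approximation of step functions in the mean\<close>

text \<open>Each difference is 2 sin(\<phi>/2) sin((k + 1/2) \<phi>), and 2 cos(\<phi>/2) sin((k +
  1/2) \<phi>) = sin(k \<phi>) + sin((k + 1) \<phi>); with alternating signs this
  telescopes.\<close>

lemma alternating_cos_sum:
  fixes \<phi> :: real
  shows "cos (\<phi> / 2) * (\<Sum>k<m. (-1) ^ k * (cos (real k * \<phi>) - cos (real (Suc k) * \<phi>)))
    = - ((-1) ^ m * sin (\<phi> / 2) * sin (real m * \<phi>))"
proof (induction m)
  case 0
  then show ?case by simp
next
  case (Suc m)
  define c s where "c = cos (\<phi> / 2)" and "s = sin (\<phi> / 2)"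
  define C S where "C = cos (real m * \<phi>)" and "S = sin (real m * \<phi>)"
  have cs: "c\<^sup>2 + s\<^sup>2 = 1"
    by (simp add: c_def s_def)
  have e: "cos \<phi> = c\<^sup>2 - s\<^sup>2" "sin \<phi> = 2 * s * c"
    using cos_double[of "\<phi> / 2"] sin_double[of "\<phi> / 2"] by (simp_all add: c_def s_def)
  have Sm: "real (Suc m) * \<phi> = real m * \<phi> + \<phi>"
    by (simp add: algebra_simps)
  have e1: "cos (real (Suc m) * \<phi>) = C * (c\<^sup>2 - s\<^sup>2) - S * (2 * s * c)"
    and e2: "sin (real (Suc m) * \<phi>) = S * (c\<^sup>2 - s\<^sup>2) + C * (2 * s * c)"
    unfolding Sm cos_add sin_add e C_def S_def by simp_all
  have "c * (C - (C * (c\<^sup>2 - s\<^sup>2) - S * (2 * s * c))) = s * S + s * (S * (c\<^sup>2 - s\<^sup>2) + C * (2 * s * c))"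
    using cs by algebra
  then have "c * (C - cos (real (Suc m) * \<phi>)) = s * S + s * sin (real (Suc m) * \<phi>)"
    unfolding e1 e2 .
  then have "(-1) ^ m * (c * (C - cos (real (Suc m) * \<phi>)))
      = (-1) ^ m * (s * S + s * sin (real (Suc m) * \<phi>))"
    by simp
  then show ?case
    using Suc.IH by (simp add: c_def s_def C_def S_def algebra_simps)
qed

lemma prod_sign:
  fixes f :: "'a \<Rightarrow> real"
  assumes "finite I" "\<And>i. i \<in> I \<Longrightarrow> P i \<Longrightarrow> f i < 0" "\<And>i. i \<in> I \<Longrightarrow> \<not> P i \<Longrightarrow> 0 < f i"
  shows "0 < (-1) ^ card {i\<in>I. P i} * prod f I"
  using assms
proof (induction I rule: finite_induct)
  case (insert i I)
  have IH: "0 < (-1) ^ card {i\<in>I. P i} * prod f I"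
    using insert by simp
  show ?case
  proof (cases "P i")
    case True
    have "{j\<in>insert i I. P j} = insert i {j\<in>I. P j}"
      using True by auto
    then have "(-1) ^ card {j\<in>insert i I. P j} * prod f (insert i I)
        = - f i * ((-1) ^ card {j\<in>I. P j} * prod f I)"
      using insert by simp
    then show ?thesis
      using mult_pos_pos[OF _ IH, of "- f i"] insert.prems(1)[of i] True by simp
  next
    case False
    have "{j\<in>insert i I. P j} = {j\<in>I. P j}"
      using False by auto
    then have "(-1) ^ card {j\<in>insert i I. P j} * prod f (insert i I)
        = f i * ((-1) ^ card {j\<in>I. P j} * prod f I)"
      using insert by simp
    then show ?thesis
      using mult_pos_pos[OF _ IH, of "f i"] insert.prems(2)[of i] False by simp
  qed
qed simp

lemma ex_pderiv_eq:
  fixes p :: "real poly"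
  obtains Q where "pderiv Q = p" "degree Q \<le> Suc (degree p)"
proof -
  define Q where "Q = (\<Sum>i\<le>degree p. monom (coeff p i / real (Suc i)) (Suc i))"
  have "pderiv Q = (\<Sum>i\<le>degree p. monom (coeff p i) i)"
    unfolding Q_def higher_pderiv_sum[of 1, simplified]
    by (simp add: pderiv_monom del: of_nat_Suc)
  then have "pderiv Q = p"
    by (simp add: poly_as_sum_of_monoms)
  moreover from this have "degree Q \<le> Suc (degree p)"
    using degree_pderiv[of Q] by simp
  ultimately show thesis
    using that by blast
qed

lemma has_integral_of_bool_mult_iff:
  fixes u a b :: real and f :: "real \<Rightarrow> real"
  assumes "a \<le> u"
  shows "((\<lambda>t. of_bool (u \<le> t) * f t) has_integral i) {a..b} \<longleftrightarrow> (f has_integral i) {u..b}"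
proof -
  have "((\<lambda>t. of_bool (u \<le> t) * f t) has_integral i) {a..b}
      \<longleftrightarrow> ((\<lambda>t. if t \<in> {u..b} then f t else 0) has_integral i) {a..b}"
    by (rule has_integral_cong) auto
  also have "\<dots> \<longleftrightarrow> (f has_integral i) {u..b}"
    by (rule has_integral_restrict) (use assms in auto)
  finally show ?thesis .
qed

lemma has_integral_of_bool:
  fixes u :: real
  assumes "a \<le> u" "u \<le> b"
  shows "((\<lambda>t. of_bool (u \<le> t)) has_integral b - u) {a..b}"
  using has_integral_of_bool_mult_iff[of a u "\<lambda>_. 1" "b - u" b] has_integral_const_real[of "1 :: real" u b] assms
  by simp

section \<open>Alternating sums over the extrema of Chebyshev polynomials\<close>

definition cheb_node :: "nat \<Rightarrow> nat \<Rightarrow> real" where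
  "cheb_node N k = cos (real k * (pi / real N))"

lemma cheb_node_strict_anti:
  assumes "i < j" "j \<le> N"
  shows "cheb_node N j < cheb_node N i"
  unfolding cheb_node_def
  by (rule cos_monotone_0_pi) (use assms in \<open>auto simp: field_simps\<close>)

lemma cheb_node_ends [simp]: "cheb_node N 0 = 1" "0 < N \<Longrightarrow> cheb_node N N = -1"
  by (auto simp: cheb_node_def)

lemma cheb_node_bounds: "\<bar>cheb_node N k\<bar> \<le> 1"
  by (simp add: cheb_node_def)

text \<open>Powers are traded for frequencies: x cos(i \<theta>) with x = cos \<theta> is the mean
  of two cosines of neighbouring frequencies. The condition j + i < N keeps every frequency below N,
  and for these the alternating sum vanishes because sin(N \<phi>) = 0.\<close>

lemma alternating_cheb_sum_eq_0:
  assumes "j + i < N"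
  shows "(\<Sum>k<N. (-1) ^ k * (cheb_node N k ^ j * cos (real i * (real k * (pi / N)))
    - cheb_node N (Suc k) ^ j * cos (real i * (real (Suc k) * (pi / N))))) = 0"
  using assms
proof (induction j arbitrary: i)
  case 0
  define \<phi> where "\<phi> = real i * (pi / N)"
  have "\<phi> / 2 < pi / 2" "0 \<le> \<phi>"
    using 0 by (auto simp: \<phi>_def field_simps)
  then have "cos (\<phi> / 2) > 0"
    by (intro cos_gt_zero_pi) auto
  moreover have "sin (real N * \<phi>) = 0"
    using 0 by (simp add: \<phi>_def mult.commute)
  ultimately have "(\<Sum>k<N. (-1) ^ k * (cos (real k * \<phi>) - cos (real (Suc k) * \<phi>))) = 0"
    using alternating_cos_sum[of \<phi> N] by simp
  then show ?case
    by (simp add: \<phi>_def algebra_simps)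
next
  case (Suc j)
  define \<theta> where "\<theta> k = real k * (pi / real N)" for k
  have prod: "cheb_node N k * cos (real i * \<theta> k)
      = cos (real (Suc i) * \<theta> k) / 2 + cos (real (if i = 0 then 1 else i - 1) * \<theta> k) / 2" for k
  proof (cases i)
    case 0
    then show ?thesis by (simp add: cheb_node_def \<theta>_def)
  next
    case (Suc l)
    have "cos (\<theta> k) * cos (real i * \<theta> k) = (cos (real i * \<theta> k - \<theta> k) + cos (real i * \<theta> k + \<theta> k)) / 2"
      by (simp add: cos_diff cos_add)
    then show ?thesis
      using Suc by (simp add: cheb_node_def \<theta>_def algebra_simps add_divide_distrib)
  qed
  have IH1: "(\<Sum>k<N. (-1) ^ k * (cheb_node N k ^ j * cos (real (Suc i) * \<theta> k)
    - cheb_node N (Suc k) ^ j * cos (real (Suc i) * \<theta> (Suc k)))) = 0"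
    unfolding \<theta>_def by (rule Suc.IH) (use Suc.prems in simp)
  have IH2: "(\<Sum>k<N. (-1) ^ k * (cheb_node N k ^ j * cos (real (if i = 0 then 1 else i - 1) * \<theta> k)
    - cheb_node N (Suc k) ^ j * cos (real (if i = 0 then 1 else i - 1) * \<theta> (Suc k)))) = 0"
    unfolding \<theta>_def by (rule Suc.IH) (use Suc.prems in auto)
  have "(\<Sum>k<N. (-1) ^ k * (cheb_node N k ^ Suc j * cos (real i * \<theta> k)
      - cheb_node N (Suc k) ^ Suc j * cos (real i * \<theta> (Suc k))))
    = (\<Sum>k<N. (-1) ^ k * (cheb_node N k ^ j * (cheb_node N k * cos (real i * \<theta> k))
      - cheb_node N (Suc k) ^ j * (cheb_node N (Suc k) * cos (real i * \<theta> (Suc k)))))"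
    by (simp add: mult_ac)
  also have "\<dots> = (\<Sum>k<N. (-1) ^ k * (cheb_node N k ^ j * cos (real (Suc i) * \<theta> k)
    - cheb_node N (Suc k) ^ j * cos (real (Suc i) * \<theta> (Suc k)))) / 2 +
    (\<Sum>k<N. (-1) ^ k * (cheb_node N k ^ j * cos (real (if i = 0 then 1 else i - 1) * \<theta> k)
    - cheb_node N (Suc k) ^ j * cos (real (if i = 0 then 1 else i - 1) * \<theta> (Suc k)))) / 2"
    unfolding prod sum_divide_distrib sum.distrib[symmetric]
    by (rule sum.cong) (simp_all add: field_simps)
  finally show ?case
    unfolding IH1 IH2 by (simp add: \<theta>_def)
qed

lemma alternating_cheb_poly_sum_eq_0:
  assumes "degree Q < N"
  shows "(\<Sum>k<N. (-1) ^ k * (poly Q (cheb_node N k) - poly Q (cheb_node N (Suc k)))) = 0"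
proof -
  have z: "(\<Sum>k<N. (-1) ^ k * (cheb_node N k ^ j - cheb_node N (Suc k) ^ j)) = 0" if "j \<le> degree Q" for j
    using alternating_cheb_sum_eq_0[of j 0 N] that assms by simp
  have "(\<Sum>k<N. (-1) ^ k * (poly Q (cheb_node N k) - poly Q (cheb_node N (Suc k))))
    = (\<Sum>k<N. \<Sum>j\<le>degree Q. coeff Q j * ((-1) ^ k * (cheb_node N k ^ j - cheb_node N (Suc k) ^ j)))"
    by (simp add: poly_altdef sum_subtractf sum_distrib_left algebra_simps)
  also have "\<dots> = (\<Sum>j\<le>degree Q. coeff Q j * (\<Sum>k<N. (-1) ^ k * (cheb_node N k ^ j - cheb_node N (Suc k) ^ j)))"
    by (subst sum.swap) (simp add: sum_distrib_left)
  also have "\<dots> = 0"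
    by (rule sum.neutral) (simp add: z)
  finally show ?thesis .
qed

text \<open>Neighbouring gaps have nearly equal length, so their alternating sum is of the size of a
  single gap. For N \<ge> 2 the factor cos(\<phi>/2) is at least 1/2 and can be divided out.\<close>

lemma alternating_cheb_gap_bound:
  assumes "2 \<le> N"
  shows "\<bar>\<Sum>k<m. (-1) ^ k * (cheb_node N k - cheb_node N (Suc k))\<bar> \<le> pi / N"
proof -
  define \<phi> where "\<phi> = pi / real N"
  define S where "S = (\<Sum>k<m. (-1) ^ k * (cheb_node N k - cheb_node N (Suc k)))"
  have \<phi>: "0 < \<phi>" "\<phi> / 2 \<le> pi / 4"
    using assms by (auto simp: \<phi>_def field_simps)
  have "cos (pi / 4) \<le> cos (\<phi> / 2)"
    by (rule cos_monotone_0_pi_le) (use \<phi> pi_gt_zero in auto)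
  moreover have "1 / 2 \<le> cos (pi / 4)"
    by (simp add: cos_45)
  ultimately have c: "1 / 2 \<le> cos (\<phi> / 2)"
    by linarith
  have "\<bar>cos (\<phi> / 2) * S\<bar> = \<bar>sin (\<phi> / 2)\<bar> * \<bar>sin (real m * \<phi>)\<bar>"
    using alternating_cos_sum[of \<phi> m]
    by (simp add: S_def cheb_node_def \<phi>_def abs_mult power_abs)
  also have "\<dots> \<le> (\<phi> / 2) * 1"
    by (intro mult_mono) (use abs_sin_x_le_abs_x[of "\<phi> / 2"] \<phi> in auto)
  finally have "cos (\<phi> / 2) * \<bar>S\<bar> \<le> \<phi> / 2"
    using c by (simp add: abs_mult)
  moreover have "1 / 2 * \<bar>S\<bar> \<le> cos (\<phi> / 2) * \<bar>S\<bar>"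
    using c by (intro mult_right_mono) auto
  ultimately show ?thesis
    by (simp add: S_def \<phi>_def)
qed

text \<open>Between consecutive nodes the error has constant, alternating sign, and the alternating sum of
  its integrals is unaffected by the polynomial part (\<open>L\<^sup>1\<close> duality).\<close>
lemma step_L1_approx_at_node:
  assumes N: "3 \<le> N" and m: "0 < m" "m < N"
  defines "u \<equiv> cheb_node N m"
  obtains p where "degree p < N - 2"
    "(\<lambda>t. of_bool (u \<le> t) - poly p t) absolutely_integrable_on {-1..1}"
    "integral {-1..1} (\<lambda>t. \<bar>of_bool (u \<le> t) - poly p t\<bar>) \<le> pi / N"
proof -
  define x where "x = cheb_node N"
  \<comment> \<open>The two end points and \<open>u\<close> itself are no interpolation points, so N
    - 2 of the N + 1 nodes remain.\<close>
  define A where "A = x ` {1..<m}"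
  define B where "B = x ` {m<..<N}"
  have anti: "x j < x i" if "i < j" "j \<le> N" for i j
    unfolding x_def by (rule cheb_node_strict_anti[OF that])
  have inj: "inj_on x {..N}"
    by (rule linorder_inj_onI) (use anti in force)+
  have fin: "finite A" "finite B" by (auto simp: A_def B_def)
  have AB: "A \<inter> B = {}" "a \<in> A \<Longrightarrow> u < a" "b \<in> B \<Longrightarrow> b < u" for a b
    using m by (auto simp: A_def B_def u_def x_def intro!: cheb_node_strict_anti dest!: inj_onD[OF inj[unfolded x_def]])
  have "card (A \<union> B) = card A + card B"
    using fin AB by (simp add: card_Un_disjoint)
  moreover have "card A = m - 1" "card B = N - m - 1"
    unfolding A_def B_def using m by (subst card_image; auto intro!: inj_on_subset[OF inj])+
  ultimately have card: "card (A \<union> B) = N - 2"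
    using m by simp
  define p where "p = interpolant (A \<union> B) (\<lambda>z. of_bool (z \<in> A))"
  have ne: "A \<union> B \<noteq> {}"
    using card N by auto
  have deg: "degree p < N - 2"
    using degree_interpolant[OF _ ne] card fin unfolding p_def by (metis finite_UnI)
  have pA: "poly p a = 1" if "a \<in> A" for a
    unfolding p_def using that fin by (subst poly_interpolant) auto
  have pB: "poly p b = 0" if "b \<in> B" for b
    unfolding p_def using that fin AB(1) by (subst poly_interpolant) auto
  define e where "e t = of_bool (u \<le> t) - poly p t" for t
  have sgnl: "0 \<le> (\<Prod>b\<in>B. t - b) * poly p t" if "t \<le> u" for t
    using step_interpolant_sign[of A B p 1 t] fin AB deg card pA pB that by force
  have sgnr: "0 \<le> (\<Prod>a\<in>A. a - t) * (1 - poly p t)" if "u \<le> t" for t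
  proof -
    have "degree (1 - p) < card (B \<union> A)"
      using deg card by (metis Un_commute degree_1 degree_diff_less gr_implies_not0 linorder_neqE_nat)
    then show ?thesis
      using step_interpolant_sign[of B A "1 - p" "-1" t] fin AB pA pB that by force
  qed
  \<comment> \<open>The error changes sign at each interior node: at \<open>u\<close> through the
    jump, elsewhere through a factor of the product, whose negative factors are counted by
    \<open>prod_sign\<close>. The exponent makes the error nonnegative just to the right of
    \<open>u\<close> (k = m - 1) and nonpositive just to the left (k = m).\<close>
  have sgn: "\<bar>e t\<bar> = (-1) ^ (m + k + 1) * e t" if k: "k < N" and t: "x (Suc k) < t" "t < x k" for k t
  proof -
    have xt: "x i - t < 0" if "Suc k \<le> i" "i \<le> N" for i
      using anti[of "Suc k" i] that t by (cases "i = Suc k") auto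
    have tx: "0 < x i - t" if "i \<le> k" for i
      using anti[of i k] that t k by (cases "i = k") auto
    have sg: "0 \<le> c * v" if "0 < c * P" "0 \<le> P * v" "c = 1 \<or> c = -1" for c P v :: real
      using that by (auto simp: zero_le_mult_iff zero_less_mult_iff)
    have pm: "(-1) ^ i = (1 :: real) \<or> (-1) ^ i = (-1 :: real)" for i :: nat
      by (cases "even i") auto
    have nonneg: "0 \<le> (-1) ^ (m + k + 1) * e t"
    proof (cases "k < m")
      case True
      have ut: "u \<le> t"
        using anti[of "Suc k" m] t True m by (cases "Suc k = m") (auto simp: u_def x_def)
      have "(\<Prod>a\<in>A. a - t) = (\<Prod>i\<in>{1..<m}. x i - t)"
        unfolding A_def by (subst prod.reindex) (use m in \<open>auto intro!: inj_on_subset[OF inj]\<close>)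
      moreover have "0 < (-1) ^ card {i\<in>{1..<m}. Suc k \<le> i} * (\<Prod>i\<in>{1..<m}. x i - t)"
        by (rule prod_sign) (use xt tx m in auto)
      moreover have "{i\<in>{1..<m}. Suc k \<le> i} = {Suc k..<m}"
        by auto
      ultimately have "0 < (-1) ^ (m - Suc k) * (\<Prod>a\<in>A. a - t)"
        by simp
      from sg[OF this sgnr[OF ut] pm] have "0 \<le> (-1) ^ (m - Suc k) * (1 - poly p t)" .
      moreover have "(-1 :: real) ^ (m - Suc k) = (-1) ^ (m + k + 1)"
        using True by (simp add: minus_one_power_iff)
      ultimately show ?thesis
        using ut by (simp add: e_def)
    next
      case False
      have ut: "t < u"
        using anti[of m k] t False k by (cases "k = m") (auto simp: u_def x_def)
      have "(\<Prod>b\<in>B. t - b) = (\<Prod>i\<in>{m<..<N}. t - x i)"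
        unfolding B_def by (subst prod.reindex) (use m in \<open>auto intro!: inj_on_subset[OF inj]\<close>)
      moreover have "0 < (-1) ^ card {i\<in>{m<..<N}. i \<le> k} * (\<Prod>i\<in>{m<..<N}. t - x i)"
        by (rule prod_sign) (use xt tx in \<open>auto simp: not_le Suc_le_eq\<close>)
      moreover have "{i\<in>{m<..<N}. i \<le> k} = {m<..k}"
        using k by auto
      ultimately have "0 < (-1) ^ (k - m) * (\<Prod>b\<in>B. t - b)"
        by simp
      from sg[OF this sgnl pm] have "0 \<le> (-1) ^ (k - m) * poly p t"
        using ut by simp
      moreover have "(-1 :: real) ^ (k - m) = - ((-1) ^ (m + k + 1))"
        using False by (simp add: minus_one_power_iff)
      ultimately show ?thesis
        using ut by (simp add: e_def)
    qed
    then have "\<bar>(-1) ^ (m + k + 1) * e t\<bar> = (-1) ^ (m + k + 1) * e t"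
      by (rule abs_of_nonneg)
    then show ?thesis
      by (simp add: abs_mult power_abs)
  qed
  \<comment> \<open>With a primitive of \<open>p\<close>, the integral over each gap is a difference
    of node values, to which the vanishing alternating sum applies.\<close>
  obtain Q where Q: "pderiv Q = p" "degree Q \<le> Suc (degree p)"
    using ex_pderiv_eq by blast
  define I where "I k = (-1) ^ (m + k + 1) *
    (of_bool (k < m) * (x k - x (Suc k)) - (poly Q (x k) - poly Q (x (Suc k))))" for k
  have gap: "((\<lambda>t. \<bar>e t\<bar>) has_integral I k) {x (Suc k)..x k}" if k: "k < N" for k
  proof -
    define G where "G t = (-1) ^ (m + k + 1) * (of_bool (k < m) * t - poly Q t)" for t
    have le: "x (Suc k) < x k"
      using anti[of k "Suc k"] k by simp
    have "((\<lambda>t. (-1) ^ (m + k + 1) * (of_bool (k < m) - poly p t)) has_integral G (x k) - G (x (Suc k)))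
      {x (Suc k)..x k}"
    proof (rule fundamental_theorem_of_calculus)
      fix t
      have "(G has_real_derivative (-1) ^ (m + k + 1) * (of_bool (k < m) - poly p t)) (at t within {x (Suc k)..x k})"
        unfolding G_def by (auto intro!: derivative_eq_intros simp: Q(1))
      then show "(G has_vector_derivative (-1) ^ (m + k + 1) * (of_bool (k < m) - poly p t))
          (at t within {x (Suc k)..x k})"
        by (simp add: has_real_derivative_iff_has_vector_derivative)
    qed (use le in simp)
    moreover have "G (x k) - G (x (Suc k)) = I k"
      by (simp add: G_def I_def algebra_simps)
    ultimately have "((\<lambda>t. (-1) ^ (m + k + 1) * (of_bool (k < m) - poly p t)) has_integral I k)
        (cbox (x (Suc k)) (x k))"
      by simp
    then have "((\<lambda>t. \<bar>e t\<bar>) has_integral I k) (cbox (x (Suc k)) (x k))"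
    proof (rule has_integral_spike_interior)
      fix t assume "t \<in> box (x (Suc k)) (x k)"
      then have t: "x (Suc k) < t" "t < x k"
        by auto
      have "u \<le> t \<longleftrightarrow> k < m"
      proof (cases "k < m")
        case True
        then show ?thesis
          using anti[of "Suc k" m] t m by (cases "Suc k = m") (auto simp: u_def x_def)
      next
        case False
        then show ?thesis
          using anti[of m k] t k by (cases "k = m") (auto simp: u_def x_def)
      qed
      then show "\<bar>e t\<bar> = (-1) ^ (m + k + 1) * (of_bool (k < m) - poly p t)"
        unfolding sgn[OF k t] by (simp add: e_def)
    qed
    then show ?thesis by simp
  qed
  have tot: "((\<lambda>t. \<bar>e t\<bar>) has_integral (\<Sum>k<M. I k)) {x M..1}" if "M \<le> N" for M
    using that
  proof (induction M)
    case 0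
    then show ?case by (simp add: x_def has_integral_refl)
  next
    case (Suc M)
    have "x M \<le> 1" "x (Suc M) \<le> x M"
      using cheb_node_bounds[of N M] anti[of M "Suc M"] Suc.prems by (auto simp: x_def)
    then show ?case
      using has_integral_combine[of "x (Suc M)" "x M" 1 "\<lambda>t. \<bar>e t\<bar>" "I M" "\<Sum>k<M. I k"]
        gap[of M] Suc by (simp add: add.commute)
  qed
  have "(\<Sum>k<N. I k) = (-1) ^ (m + 1) * ((\<Sum>k<N. (-1) ^ k * (of_bool (k < m) * (x k - x (Suc k))))
      - (\<Sum>k<N. (-1) ^ k * (poly Q (x k) - poly Q (x (Suc k)))))"
    unfolding I_def sum_subtractf[symmetric] sum_distrib_left
    by (rule sum.cong) (simp_all add: power_add algebra_simps)
  \<comment> \<open>The polynomial drops out; what remains depends only on the gaps to the right of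
    \<open>u\<close>.\<close>
  also have "(\<Sum>k<N. (-1) ^ k * (poly Q (x k) - poly Q (x (Suc k)))) = 0"
    unfolding x_def by (rule alternating_cheb_poly_sum_eq_0) (use Q(2) deg in linarith)
  also have "(\<Sum>k<N. (-1) ^ k * (of_bool (k < m) * (x k - x (Suc k)))) = (\<Sum>k<m. (-1) ^ k * (x k - x (Suc k)))"
    by (rule sum.mono_neutral_cong_right) (use m in auto)
  finally have "\<bar>\<Sum>k<N. I k\<bar> = \<bar>\<Sum>k<m. (-1) ^ k * (x k - x (Suc k))\<bar>"
    by (simp add: abs_mult power_abs)
  also have "\<dots> \<le> pi / N"
    unfolding x_def by (rule alternating_cheb_gap_bound) (use N in simp)
  finally have bound: "(\<Sum>k<N. I k) \<le> pi / N"
    by linarith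
  have I: "((\<lambda>t. \<bar>e t\<bar>) has_integral (\<Sum>k<N. I k)) {-1..1}"
    using tot[of N] N by (simp add: x_def)
  have "(\<lambda>t. of_bool (u \<le> t) :: real) integrable_on {-1..1}"
    using has_integral_of_bool[of "-1" u 1] cheb_node_bounds[of N m]
    by (auto simp: u_def abs_le_iff integrable_on_def)
  moreover have "(\<lambda>t. poly p t) integrable_on {-1..1}"
    by (intro integrable_continuous_real continuous_intros)
  ultimately have "e integrable_on {-1..1}"
    unfolding e_def by (rule integrable_diff)
  then have "e absolutely_integrable_on {-1..1}"
    using I by (intro absolutely_integrable_onI) auto
  moreover have "integral {-1..1} (\<lambda>t. \<bar>e t\<bar>) \<le> pi / N"
    using integral_unique[OF I] bound by simp
  ultimately show thesis
    using that[OF deg] by (simp add: e_def[abs_def])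
qed

text \<open>An arbitrary jump is moved to an interior node at distance at most \<pi> / N, N = M + 2.
  The move costs that distance in the mean, and the approximation at the node costs \<pi> / N once
  more.\<close>

lemma step_L1_approx:
  fixes u :: real
  assumes M: "0 < M" and u: "-1 \<le> u" "u \<le> 1"
  obtains p where "degree p < M"
    "(\<lambda>t. of_bool (u \<le> t) - poly p t) absolutely_integrable_on {-1..1}"
    "integral {-1..1} (\<lambda>t. \<bar>of_bool (u \<le> t) - poly p t\<bar>) \<le> 2 * pi / (M + 2)"
proof -
  define N where "N = M + 2"
  define h where "h = pi / real N"
  define \<tau> where "\<tau> = arccos u"
  have N: "3 \<le> N" and h: "0 < h" "real N * h = pi"
    using M by (auto simp: N_def h_def)
  have \<tau>: "0 \<le> \<tau>" "\<tau> \<le> pi" "cos \<tau> = u"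
    using arccos[OF u] by (auto simp: \<tau>_def)
  define j where "j = nat \<lfloor>\<tau> / h\<rfloor>"
  have j: "real j * h \<le> \<tau>" "\<tau> < (real j + 1) * h"
  proof -
    have "real j = of_int \<lfloor>\<tau> / h\<rfloor>"
      using \<tau> h by (simp add: j_def)
    then have "real j \<le> \<tau> / h" "\<tau> / h < real j + 1"
      by linarith+
    then show "real j * h \<le> \<tau>" "\<tau> < (real j + 1) * h"
      using h by (simp_all add: field_simps)
  qed
  have "real j * h \<le> real N * h"
    using j \<tau> h by linarith
  then have "j \<le> N"
    using h(1) mult_le_cancel_right_pos[of h "real j" "real N"] by linarith
  \<comment> \<open>The end nodes are excluded, so they are replaced by their neighbours; the angle
    stays within \<open>h\<close>.\<close>
  define m where "m = (if j = 0 then 1 else if j = N then N - 1 else j)"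
  have m: "0 < m" "m < N"
    using \<open>j \<le> N\<close> N by (auto simp: m_def)
  have near: "\<bar>\<tau> - real m * h\<bar> \<le> h"
    using j \<tau> h N by (auto simp: m_def algebra_simps of_nat_diff)
  define v where "v = cheb_node N m"
  have "\<bar>u - v\<bar> = \<bar>cos \<tau> - cos (real m * h)\<bar>"
    by (simp add: v_def cheb_node_def h_def \<tau>)
  also have "\<dots> = \<bar>2 * sin ((\<tau> + real m * h) / 2) * sin ((real m * h - \<tau>) / 2)\<bar>"
    by (simp add: cos_diff_cos)
  also have "\<dots> \<le> 2 * 1 * \<bar>(real m * h - \<tau>) / 2\<bar>"
    unfolding abs_mult by (intro mult_mono abs_sin_x_le_abs_x) auto
  also have "\<dots> \<le> h"
    using near by simp
  finally have uv: "\<bar>u - v\<bar> \<le> h" .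
  have v: "-1 \<le> v" "v \<le> 1"
    using cheb_node_bounds[of N m] by (auto simp: v_def abs_le_iff)
  obtain p where p: "degree p < N - 2"
    "(\<lambda>t. of_bool (v \<le> t) - poly p t) absolutely_integrable_on {-1..1}"
    "integral {-1..1} (\<lambda>t. \<bar>of_bool (v \<le> t) - poly p t\<bar>) \<le> h"
    using step_L1_approx_at_node[OF N m] unfolding v_def h_def by blast
  define d where "d t = of_bool (min u v \<le> t) - (of_bool (max u v \<le> t) :: real)" for t
  have "(d has_integral (1 - min u v) - (1 - max u v)) {-1..1}"
    unfolding d_def by (intro has_integral_diff has_integral_of_bool) (use u v in auto)
  then have d: "(d has_integral \<bar>u - v\<bar>) {-1..1}"
    by (cases "u \<le> v") (auto simp: min_def max_def)
  have dd: "\<bar>of_bool (u \<le> t) - of_bool (v \<le> t)\<bar> = d t" for t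
    by (auto simp: d_def)
  have le: "\<bar>of_bool (u \<le> t) - poly p t\<bar> \<le> \<bar>of_bool (v \<le> t) - poly p t\<bar> + d t" for t
    using dd[of t] by linarith
  have int: "(\<lambda>t. \<bar>of_bool (v \<le> t) - poly p t\<bar> + d t) integrable_on {-1..1}"
    using p(2) d by (intro integrable_add) (auto simp: absolutely_integrable_on_def)
  have "(\<lambda>t. of_bool (u \<le> t) - poly p t) integrable_on {-1..1}"
    by (intro integrable_diff has_integral_integrable[OF has_integral_of_bool] integrable_continuous_real
        continuous_intros u)
  then have ai: "(\<lambda>t. of_bool (u \<le> t) - poly p t) absolutely_integrable_on {-1..1}"
    by (rule absolutely_integrable_integrable_bound[rotated 1, OF _ int]) (use le in simp)
  have "integral {-1..1} (\<lambda>t. \<bar>of_bool (u \<le> t) - poly p t\<bar>)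
      \<le> integral {-1..1} (\<lambda>t. \<bar>of_bool (v \<le> t) - poly p t\<bar> + d t)"
    using ai by (intro integral_le int le) (auto simp: absolutely_integrable_on_def)
  also have "\<dots> = integral {-1..1} (\<lambda>t. \<bar>of_bool (v \<le> t) - poly p t\<bar>) + \<bar>u - v\<bar>"
    using p(2) d by (subst Henstock_Kurzweil_Integration.integral_add) (auto simp: absolutely_integrable_on_def integral_unique)
  also have "\<dots> \<le> 2 * pi / (M + 2)"
    using p(3) uv by (simp add: h_def N_def)
  finally show thesis
    using that[OF _ ai] p(1) by (simp add: N_def)
qed

section \<open>Peano kernels\<close>

text \<open>The product of an absolutely continuous and a smooth function: both sides have the same
  increments up to \<open>O((y - x)\<^sup>2)\<close>, so no differentiability of \<open>h\<close> is needed.\<close>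
lemma has_integral_by_parts_indefinite:
  fixes K K' g h :: "real \<Rightarrow> real"
  assumes ab: "a \<le> b"
    and K: "\<And>t. t \<in> {a..b} \<Longrightarrow> (K has_real_derivative K' t) (at t within {a..b})"
    and K': "continuous_on {a..b} K'"
    and g: "g absolutely_integrable_on {a..b}" "\<And>t. t \<in> {a..b} \<Longrightarrow> \<bar>g t\<bar> \<le> G"
    and h: "\<And>t. t \<in> {a..b} \<Longrightarrow> h t = h a + integral {a..t} g"
  shows "((\<lambda>t. K t * g t) has_integral K b * h b - K a * h a - integral {a..b} (\<lambda>t. K' t * h t)) {a..b}"
proof -
  have contK: "continuous_on {a..b} K"
    using K by (meson DERIV_continuous_on)
  have gi: "g integrable_on {a..b}"
    using g(1) set_lebesgue_integral_eq_integral(1) by blast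
  have "continuous_on {a..b} (\<lambda>t. h a + integral {a..t} g)"
    by (intro continuous_intros indefinite_integral_continuous_1 gi)
  then have conth: "continuous_on {a..b} h"
    by (rule continuous_on_eq) (rule h[symmetric])
  obtain L where L: "0 < L" "\<And>t. t \<in> {a..b} \<Longrightarrow> \<bar>K' t\<bar> \<le> L"
    using compact_imp_bounded[OF compact_continuous_image[OF K' compact_Icc]]
    by (auto simp: bounded_pos)
  have G: "0 \<le> G"
    using g(2)[of a] ab by force
  have "bounded (K ` {a..b})"
    by (intro compact_imp_bounded compact_continuous_image contK compact_Icc)
  moreover have "K \<in> borel_measurable (lebesgue_on {a..b})"
    by (intro continuous_imp_measurable_on_sets_lebesgue contK) auto
  ultimately have "(\<lambda>t. K t * g t) absolutely_integrable_on {a..b}"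
    using g(1) by (intro absolutely_integrable_bounded_measurable_product_real) auto
  then have Kg: "(\<lambda>t. K t * g t) integrable_on {a..b}"
    using set_lebesgue_integral_eq_integral(1) by blast
  have K'h: "(\<lambda>t. K' t * h t) integrable_on {a..b}"
    by (intro integrable_continuous_real continuous_intros K' conth)
  define \<Phi> where "\<Phi> y = integral {a..y} (\<lambda>t. K t * g t) - K y * h y + integral {a..y} (\<lambda>t. K' t * h t)" for y
  have sub: "f integrable_on {x..y}" if "f integrable_on {a..b}" "a \<le> x" "y \<le> b" for f :: "real \<Rightarrow> real" and x y
    by (rule integrable_on_subinterval[OF that(1)]) (use that in auto)
  have incr: "\<bar>\<Phi> y - \<Phi> x\<bar> \<le> 2 * L * G * (y - x)\<^sup>2" if xy: "a \<le> x" "x \<le> y" "y \<le> b" for x y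
  proof -
    have hd: "integral {x..t} g = h t - h x" if "x \<le> t" "t \<le> y" for t
      using Henstock_Kurzweil_Integration.integral_combine[of a x t g] h[of x] h[of t] xy that sub[OF gi, of a t]
      by auto
    have lip: "\<bar>h t - h x\<bar> \<le> G * (y - x)" if t: "x \<le> t" "t \<le> y" for t
    proof -
      have "norm (integral {x..t} g) \<le> integral {x..t} (\<lambda>_. G)"
        by (rule integral_norm_bound_integral) (use sub[OF gi, of x t] g(2) xy t in auto)
      also have "\<dots> \<le> G * (y - x)"
        using G t by (simp add: mult.commute mult_left_mono)
      finally show ?thesis
        using hd[OF t] by simp
    qed
    have lipK: "\<bar>K t - K y\<bar> \<le> L * (y - x)" if t: "x \<le> t" "t \<le> y" for t
    proof -
      have "norm (K y - K t) \<le> L * norm (y - t)"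
        by (rule field_differentiable_bound[of "{a..b}" K K'])
           (use K L xy t in auto)
      also have "\<dots> \<le> L * (y - x)"
        using L t by (intro mult_left_mono) auto
      finally show ?thesis by (simp add: abs_minus_commute)
    qed
    \<comment> \<open>The increment of K h is split as K(y) (h(y) - h(x)) + (K(y) - K(x)) h(x), and
      both parts are written as integrals. What is left of the integrands contains K(t) - K(y) or
      h(t) - h(x), each of order y - x.\<close>
    have "(K' has_integral K y - K x) {x..y}"
    proof (rule fundamental_theorem_of_calculus[OF xy(2)])
      fix t assume "t \<in> {x..y}"
      then show "(K has_vector_derivative K' t) (at t within {x..y})"
        using DERIV_subset[OF K[of t], of "{x..y}"] xy
        by (auto simp: has_real_derivative_iff_has_vector_derivative)
    qed
    then have i1: "((\<lambda>t. K' t * h x) has_integral (K y - K x) * h x) {x..y}"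
      by (rule has_integral_mult_left)
    have "(g has_integral h y - h x) {x..y}"
      using sub[OF gi xy(1,3)] hd[of y] xy by (simp add: has_integral_integrable_integral)
    then have i2: "((\<lambda>t. K y * g t) has_integral K y * (h y - h x)) {x..y}"
      by (rule has_integral_mult_right)
    have i3: "((\<lambda>t. K t * g t) has_integral integral {x..y} (\<lambda>t. K t * g t)) {x..y}"
      and i4: "((\<lambda>t. K' t * h t) has_integral integral {x..y} (\<lambda>t. K' t * h t)) {x..y}"
      using sub[OF Kg xy(1,3)] sub[OF K'h xy(1,3)] by (auto simp: integrable_integral)
    have c1: "integral {a..y} (\<lambda>t. K t * g t) = integral {a..x} (\<lambda>t. K t * g t) + integral {x..y} (\<lambda>t. K t * g t)"
      and c2: "integral {a..y} (\<lambda>t. K' t * h t) = integral {a..x} (\<lambda>t. K' t * h t) + integral {x..y} (\<lambda>t. K' t * h t)"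
      using Henstock_Kurzweil_Integration.integral_combine[OF xy(1,2), symmetric] sub[OF Kg, of a y] sub[OF K'h, of a y] xy
      by blast+
    have "((\<lambda>t. (K t * g t - K y * g t) + (K' t * h t - K' t * h x)) has_integral \<Phi> y - \<Phi> x) {x..y}"
      using has_integral_add[OF has_integral_diff[OF i3 i2] has_integral_diff[OF i4 i1]]
      by (simp add: \<Phi>_def c1 c2 algebra_simps)
    then have i: "((\<lambda>t. (K t - K y) * g t + K' t * (h t - h x)) has_integral \<Phi> y - \<Phi> x) {x..y}"
      by (rule has_integral_eq[rotated]) (simp add: algebra_simps)
    have "norm (\<Phi> y - \<Phi> x) \<le> (2 * L * G * (y - x)) * measure lborel (cbox x y)"
    proof (rule has_integral_bound)
      show "((\<lambda>t. (K t - K y) * g t + K' t * (h t - h x)) has_integral \<Phi> y - \<Phi> x) (cbox x y)"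
        using i by simp
      fix t assume "t \<in> cbox x y"
      then have t: "x \<le> t" "t \<le> y" by auto
      have "\<bar>(K t - K y) * g t\<bar> \<le> (L * (y - x)) * G"
        unfolding abs_mult by (intro mult_mono lipK g(2) t) (use t xy L in auto)
      moreover have "\<bar>K' t * (h t - h x)\<bar> \<le> L * (G * (y - x))"
        unfolding abs_mult by (intro mult_mono lip L(2) t) (use t xy L in auto)
      ultimately show "norm ((K t - K y) * g t + K' t * (h t - h x)) \<le> 2 * L * G * (y - x)"
        by (simp add: algebra_simps)
    qed (use L G xy in auto)
    then show ?thesis
      using xy by (simp add: power2_eq_square algebra_simps)
  qed
  have incr': "\<bar>\<Phi> y - \<Phi> x\<bar> \<le> 2 * L * G * \<bar>y - x\<bar> * \<bar>y - x\<bar>" if "x \<in> {a..b}" "y \<in> {a..b}" for x y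
    using incr[of x y] incr[of y x] that
    by (cases "x \<le> y") (auto simp: power2_eq_square abs_minus_commute mult.assoc)
  have "(\<Phi> has_real_derivative 0) (at x within {a..b})" if x: "x \<in> {a..b}" for x
    unfolding has_field_derivative_iff
  proof (rule Lim_null_comparison)
    show "\<forall>\<^sub>F y in at x within {a..b}. norm ((\<Phi> y - \<Phi> x) / (y - x)) \<le> 2 * L * G * \<bar>y - x\<bar>"
      unfolding eventually_at_filter
    proof (intro always_eventually allI impI)
      fix y assume "y \<noteq> x" "y \<in> {a..b}"
      then show "norm ((\<Phi> y - \<Phi> x) / (y - x)) \<le> 2 * L * G * \<bar>y - x\<bar>"
        using incr'[OF x, of y] by (simp add: divide_le_eq)
    qed
    have "((\<lambda>y. 2 * L * G * \<bar>y - x\<bar>) \<longlongrightarrow> 2 * L * G * \<bar>x - x\<bar>) (at x within {a..b})"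
      by (intro tendsto_intros)
    then show "((\<lambda>y. 2 * L * G * \<bar>y - x\<bar>) \<longlongrightarrow> 0) (at x within {a..b})"
      by simp
  qed
  then obtain c where "\<And>x. x \<in> {a..b} \<Longrightarrow> \<Phi> x = c"
    using has_field_derivative_zero_constant[of "{a..b}" \<Phi>] by auto
  then have "\<Phi> b = \<Phi> a"
    using ab by auto
  then show ?thesis
    using Kg by (simp add: \<Phi>_def has_integral_integrable_integral)
qed

lemma power_fact_has_derivative:
  "((\<lambda>y. y ^ Suc j / fact (Suc j)) has_real_derivative y ^ j / fact j) (at (y :: real) within S)"
proof -
  have "((\<lambda>y. y ^ Suc j / fact (Suc j)) has_real_derivative
      (real (Suc j) * y ^ (Suc j - Suc 0)) / fact (Suc j)) (at y within S)"
    by (intro DERIV_cdivide DERIV_pow)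
  then show ?thesis
    by (simp add: fact_Suc del: of_nat_Suc)
qed

text \<open>For \<open>s = 0\<close> this is the step function with value 1 at 0, since
  \<open>0 ^ 0 = 1\<close>; it thus agrees with \<open>of_bool (u \<le> x)\<close> at the jump as
  well.\<close>

definition trunc_pow :: "nat \<Rightarrow> real \<Rightarrow> real" where
  "trunc_pow s y = of_bool (0 \<le> y) * (y ^ s / fact s)"

text \<open>Only the point 0 needs care: there the difference quotient is at most |h|^j, which tends
  to 0 because \<open>j\<close> is positive.\<close>

lemma trunc_pow_has_derivative:
  assumes "0 < j"
  shows "(trunc_pow (Suc j) has_real_derivative trunc_pow j y) (at y within S)"
proof -
  have "(trunc_pow (Suc j) has_real_derivative trunc_pow j y) (at y)"
  proof (cases "y = 0")
    case True
    have "((\<lambda>h. (trunc_pow (Suc j) (0 + h) - trunc_pow (Suc j) 0) / h) \<longlongrightarrow> 0) (at 0)"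
    proof (rule Lim_null_comparison)
      show "\<forall>\<^sub>F h in at 0. norm ((trunc_pow (Suc j) (0 + h) - trunc_pow (Suc j) 0) / h) \<le> \<bar>h\<bar> ^ j"
        by (rule always_eventually)
           (auto simp: trunc_pow_def abs_mult power_abs divide_le_eq fact_ge_1 mult_le_cancel_left1
             simp del: fact_Suc)
      have "((\<lambda>h :: real. \<bar>h\<bar> ^ j) \<longlongrightarrow> \<bar>0\<bar> ^ j) (at 0)"
        by (intro tendsto_intros)
      then show "((\<lambda>h :: real. \<bar>h\<bar> ^ j) \<longlongrightarrow> 0) (at 0)"
        using assms by (simp add: zero_power)
    qed
    then show ?thesis
      using True assms by (simp add: DERIV_def trunc_pow_def zero_power)
  next
    case False
    show ?thesis
    proof (cases "y > 0")
      case True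
      have "((\<lambda>y. y ^ Suc j / fact (Suc j)) has_real_derivative trunc_pow j y) (at y)"
        using power_fact_has_derivative[of j y UNIV] True by (simp add: trunc_pow_def del: fact_Suc power_Suc)
      then show ?thesis
        by (rule has_field_derivative_transform_within_open[of _ _ _ "{0<..}"])
           (use True in \<open>auto simp: trunc_pow_def\<close>)
    next
      case False
      have "((\<lambda>y. 0) has_real_derivative trunc_pow j y) (at y)"
        using False \<open>y \<noteq> 0\<close> by (simp add: trunc_pow_def)
      then show ?thesis
        by (rule has_field_derivative_transform_within_open[of _ _ _ "{..<0}"])
           (use False \<open>y \<noteq> 0\<close> in \<open>auto simp: trunc_pow_def\<close>)
    qed
  qed
  then show ?thesis
    by (rule has_field_derivative_at_within)
qed

text \<open>\<open>D k\<close> stands for the k-th derivative, and \<open>D s\<close> is known only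
  as an indefinite integral of \<open>g\<close>. The integral remainder of order s contains
  \<open>D s\<close>; integrating by parts once more brings in \<open>g\<close>, and the boundary
  term at -1 is the Taylor term of degree s.\<close>

lemma taylor_remainder_has_integral:
  fixes D :: "nat \<Rightarrow> real \<Rightarrow> real"
  assumes D: "\<And>k t. k < s \<Longrightarrow> t \<in> {-1..1} \<Longrightarrow> (D k has_real_derivative D (Suc k) t) (at t within {-1..1})"
    and g: "g absolutely_integrable_on {-1..1}" "\<And>t. t \<in> {-1..1} \<Longrightarrow> \<bar>g t\<bar> \<le> G"
    and h: "\<And>t. t \<in> {-1..1} \<Longrightarrow> D s t = D s (-1) + integral {-1..t} g"
    and y: "y \<in> {-1..1}"
  shows "((\<lambda>t. trunc_pow s (y - t) * g t) has_integral
    D 0 y - (\<Sum>k\<le>s. D k (-1) * ((y + 1) ^ k / fact k))) {-1..1}"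
proof -
  have gy: "g absolutely_integrable_on {-1..y}"
    by (rule absolutely_integrable_on_subinterval[OF g(1)]) (use y in auto)
  have "((\<lambda>t. (y - t) ^ s / fact s * g t) has_integral
    D 0 y - (\<Sum>k\<le>s. D k (-1) * ((y + 1) ^ k / fact k))) {-1..y}"
  proof (cases s)
    case 0
    have "g integrable_on {-1..y}"
      using gy set_lebesgue_integral_eq_integral(1) by blast
    then show ?thesis
      using h[OF y] 0 by (simp add: has_integral_integrable_integral)
  next
    case (Suc j)
    have Dsub: "(D k has_real_derivative D (Suc k) t) (at t within {-1..y})" if "k < s" "t \<in> {-1..y}" for k t
      by (rule DERIV_subset[OF D[OF that(1)]]) (use that y in auto)
    define K where "K t = (y - t) ^ s / fact s" for t :: real
    define K' where "K' t = - ((y - t) ^ j / fact j)" for t :: real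
    have "((\<lambda>t. K t * g t) has_integral K y * D s y - K (-1) * D s (-1) - integral {-1..y} (\<lambda>t. K' t * D s t)) {-1..y}"
    proof (rule has_integral_by_parts_indefinite)
      show "(K has_real_derivative K' t) (at t within {-1..y})" for t
      proof -
        have "((\<lambda>t. (y - t) ^ Suc j / fact (Suc j)) has_real_derivative (y - t) ^ j / fact j * (0 - 1))
            (at t within {-1..y})"
          by (intro DERIV_chain2[OF power_fact_has_derivative] derivative_intros)
        then show ?thesis
          by (simp add: K_def[abs_def] K'_def Suc del: fact_Suc power_Suc)
      qed
      show "continuous_on {-1..y} K'"
        unfolding K'_def by (intro continuous_intros) auto
      show "g absolutely_integrable_on {-1..y}" by (rule gy)
      show "\<bar>g t\<bar> \<le> G" if "t \<in> {-1..y}" for t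
        using g(2) that y by auto
      show "D s t = D s (-1) + integral {-1..t} g" if "t \<in> {-1..y}" for t
        by (rule h) (use that y in auto)
    qed (use y in auto)
    moreover have "D 0 y = (\<Sum>i<s. ((y - (-1)) ^ i / fact i) *\<^sub>R D i (-1))
        + integral {-1..y} (\<lambda>t. ((y - t) ^ (s - 1) / fact (s - 1)) *\<^sub>R D s t)"
      by (rule Taylor_integral[of _ D])
         (use Suc y Dsub in \<open>auto simp: has_real_derivative_iff_has_vector_derivative\<close>)
    ultimately show ?thesis
      using Suc by (simp add: K_def K'_def lessThan_Suc_atMost mult_ac del: fact_Suc power_Suc)
  qed
  then have "((\<lambda>t. if t \<in> {-1..y} then (y - t) ^ s / fact s * g t else 0) has_integral
    D 0 y - (\<Sum>k\<le>s. D k (-1) * ((y + 1) ^ k / fact k))) {-1..1}"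
    by (subst has_integral_restrict) (use y in auto)
  then show ?thesis
    by (rule has_integral_eq[rotated]) (auto simp: trunc_pow_def)
qed

section \<open>The Peano kernel: error representation, orthogonality, size\<close>

definition peano_kernel :: "real set \<Rightarrow> nat \<Rightarrow> real \<Rightarrow> real \<Rightarrow> real" where
  "peano_kernel Z s x t = trunc_pow s (x - t) - poly (interpolant Z (\<lambda>z. trunc_pow s (z - t))) x"

text \<open>The Taylor remainder is used at \<open>x\<close> and at every node. The Taylor
  polynomial at -1 has degree at most s < \<open>card Z\<close>, so interpolation reproduces it and
  it cancels.\<close>

lemma peano_kernel_has_integral:
  fixes D :: "nat \<Rightarrow> real \<Rightarrow> real"
  assumes Z: "finite Z" "Z \<subseteq> {-1..1}" "s < card Z" and x: "x \<in> {-1..1}"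
    and D: "\<And>k t. k < s \<Longrightarrow> t \<in> {-1..1} \<Longrightarrow> (D k has_real_derivative D (Suc k) t) (at t within {-1..1})"
    and g: "g absolutely_integrable_on {-1..1}" "\<And>t. t \<in> {-1..1} \<Longrightarrow> \<bar>g t\<bar> \<le> G"
    and h: "\<And>t. t \<in> {-1..1} \<Longrightarrow> D s t = D s (-1) + integral {-1..t} g"
  shows "((\<lambda>t. peano_kernel Z s x t * g t) has_integral D 0 x - poly (interpolant Z (D 0)) x) {-1..1}"
proof -
  define T where "T = (\<Sum>k\<le>s. smult (D k (-1) / fact k) ([:1, 1:] ^ k))"
  have T: "poly T y = (\<Sum>k\<le>s. D k (-1) * ((y + 1) ^ k / fact k))" for y
    by (simp add: T_def poly_sum algebra_simps)
  have "degree T \<le> s"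
    unfolding T_def
  proof (rule degree_sum_le)
    fix k assume "k \<in> {..s}"
    then show "degree (smult (D k (-1) / fact k) ([:1, 1:] ^ k)) \<le> s"
      using degree_smult_le[of "D k (-1) / fact k" "[:1, 1:] ^ k"] degree_power_le[of "[:1, 1 :: real:]" k]
      by simp
  qed simp
  then have TI: "poly (interpolant Z (poly T)) x = poly T x"
    using interpolant_unique[of Z T "poly T"] Z by simp
  note rem = taylor_remainder_has_integral[OF D g h, folded T]
  have "((\<lambda>t. trunc_pow s (x - t) * g t - (\<Sum>z\<in>Z. trunc_pow s (z - t) * g t * poly (lagrange_basis Z z) x))
    has_integral (D 0 x - poly T x) - (\<Sum>z\<in>Z. (D 0 z - poly T z) * poly (lagrange_basis Z z) x)) {-1..1}"
    by (intro has_integral_diff has_integral_sum has_integral_mult_left rem) (use Z x in auto)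
  moreover have "(D 0 x - poly T x) - (\<Sum>z\<in>Z. (D 0 z - poly T z) * poly (lagrange_basis Z z) x)
      = D 0 x - poly (interpolant Z (D 0)) x"
    using TI by (simp add: poly_interpolant_sum algebra_simps sum_subtractf)
  moreover have "(\<lambda>t. trunc_pow s (x - t) * g t - (\<Sum>z\<in>Z. trunc_pow s (z - t) * g t * poly (lagrange_basis Z z) x))
      = (\<lambda>t. peano_kernel Z s x t * g t)"
    by (simp add: peano_kernel_def poly_interpolant_sum algebra_simps sum_distrib_left)
  ultimately show ?thesis
    by simp
qed

text \<open>The polynomial q is the derivative of order s + 1 of a polynomial F of degree less than
  \<open>card Z\<close>. The integral is the interpolation error of F, which is 0.\<close>

lemma peano_kernel_orthogonal:
  assumes Z: "finite Z" "Z \<subseteq> {-1..1}" and deg: "degree q + Suc s < card Z" and x: "x \<in> {-1..1}"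
  shows "((\<lambda>t. peano_kernel Z s x t * poly q t) has_integral 0) {-1..1}"
proof -
  have "\<exists>F. (pderiv ^^ m) F = q \<and> degree F \<le> degree q + m" for m
  proof (induction m)
    case (Suc m)
    then obtain F where F: "(pderiv ^^ m) F = q" "degree F \<le> degree q + m" by blast
    obtain Q where "pderiv Q = F" "degree Q \<le> Suc (degree F)"
      by (rule ex_pderiv_eq)
    then show ?case
      using F by (intro exI[of _ Q]) (simp add: funpow_Suc_right del: funpow.simps)
  qed (auto intro: exI[of _ q])
  then obtain F where F: "(pderiv ^^ Suc s) F = q" "degree F \<le> degree q + Suc s" by blast
  have cont: "continuous_on {-1..1} (poly q)"
    by (intro continuous_intros)
  obtain G where G: "\<And>t. t \<in> {-1..1} \<Longrightarrow> \<bar>poly q t\<bar> \<le> G"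
    using compact_imp_bounded[OF compact_continuous_image[OF cont compact_Icc]]
    unfolding bounded_iff by (metis imageI real_norm_def)
  have "((\<lambda>t. peano_kernel Z s x t * poly q t) has_integral
      poly ((pderiv ^^ 0) F) x - poly (interpolant Z (poly ((pderiv ^^ 0) F))) x) {-1..1}"
  proof (rule peano_kernel_has_integral[where D = "\<lambda>k. poly ((pderiv ^^ k) F)" and G = G])
    show "poly ((pderiv ^^ s) F) t = poly ((pderiv ^^ s) F) (-1) + integral {-1..t} (poly q)"
      if "t \<in> {-1..1}" for t
    proof -
      have "(poly q has_integral poly ((pderiv ^^ s) F) t - poly ((pderiv ^^ s) F) (-1)) {-1..t}"
      proof (rule fundamental_theorem_of_calculus)
        fix y
        have "(poly ((pderiv ^^ s) F) has_real_derivative poly q y) (at y within {-1..t})"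
          unfolding F(1)[symmetric] funpow.simps o_apply
          by (rule has_field_derivative_at_within[OF poly_DERIV])
        then show "(poly ((pderiv ^^ s) F) has_vector_derivative poly q y) (at y within {-1..t})"
          by (simp add: has_real_derivative_iff_has_vector_derivative)
      qed (use that in auto)
      then show ?thesis
        by (simp add: integral_unique)
    qed
    show "poly q absolutely_integrable_on {-1..1}"
      by (rule absolutely_integrable_continuous_real[OF cont])
  qed (use Z deg x G in \<open>auto intro!: has_field_derivative_at_within poly_DERIV\<close>)
  moreover have "interpolant Z (poly F) = F"
    using interpolant_unique[of Z F "poly F"] Z F(2) deg by simp
  ultimately show ?thesis
    by simp
qed

text \<open>The error representation is applied to the truncated power of degree s + 1. Its
  derivative of order s is \<open>trunc_pow 1\<close>, which has a corner at \<open>u\<close> but is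
  the indefinite integral of the step function.\<close>

lemma peano_kernel_Suc:
  assumes Z: "finite Z" "Z \<subseteq> {-1..1}" "s < card Z" and x: "x \<in> {-1..1}" and u: "u \<in> {-1..1}"
  shows "((\<lambda>t. peano_kernel Z s x t * of_bool (u \<le> t)) has_integral peano_kernel Z (Suc s) x u) {-1..1}"
proof -
  define D where "D k y = trunc_pow (Suc s - k) (y - u)" for k y
  have "((\<lambda>t. peano_kernel Z s x t * of_bool (u \<le> t)) has_integral
      D 0 x - poly (interpolant Z (D 0)) x) {-1..1}"
  proof (rule peano_kernel_has_integral[where G = 1, OF Z x])
    show "(D k has_real_derivative D (Suc k) t) (at t within {-1..1})" if "k < s" for k t
    proof -
      have "Suc s - k = Suc (s - k)" "0 < s - k"
        using that by auto
      then have "((\<lambda>y. trunc_pow (Suc s - k) (y - u)) has_real_derivative trunc_pow (s - k) (t - u) * 1)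
          (at t within {-1..1})"
        by (intro DERIV_chain2[of "trunc_pow (Suc s - k)"]) (auto intro!: trunc_pow_has_derivative derivative_eq_intros)
      then show ?thesis
        by (simp add: D_def[abs_def])
    qed
    have int: "((\<lambda>t. of_bool (u \<le> t)) has_integral D s t) {-1..t}" if "t \<in> {-1..1}" for t
    proof (cases "u \<le> t")
      case True
      then show ?thesis
        using has_integral_of_bool[of "-1" u t] u by (simp add: D_def trunc_pow_def)
    next
      case False
      then show ?thesis
        by (intro has_integral_is_0[THEN has_integral_eq_rhs]) (auto simp: D_def trunc_pow_def)
    qed
    show "D s t = D s (-1) + integral {-1..t} (\<lambda>t. of_bool (u \<le> t))" if "t \<in> {-1..1}" for t
      using integral_unique[OF int[OF that]] u by (simp add: D_def trunc_pow_def)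
    have "(\<lambda>t. of_bool (u \<le> t) :: real) integrable_on {-1..1}"
      using int[of 1] by (auto simp: integrable_on_def)
    then show "(\<lambda>t. of_bool (u \<le> t) :: real) absolutely_integrable_on {-1..1}"
      by (intro nonnegative_absolutely_integrable_1) auto
  qed auto
  then show ?thesis
    by (simp add: D_def[abs_def] peano_kernel_def)
qed

lemma peano_kernel_bound:
  assumes Z: "finite Z" "Z \<subseteq> {-1..1}" and rn: "r < card Z" and x: "x \<in> {-1..1}"
    and \<Lambda>: "0 \<le> \<Lambda>" "\<And>z. z \<in> Z \<Longrightarrow> \<bar>poly (lagrange_basis Z z) x\<bar> \<le> \<Lambda>"
    and "s \<le> r" "u \<in> {-1..1}"
  shows "\<bar>peano_kernel Z s x u\<bar> \<le> \<Lambda> * (2 * pi * (r + 1) / card Z) ^ s"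
proof -
  have ne: "Z \<noteq> {}"
    using rn by auto
  show ?thesis
    using assms(7,8)
  proof (induction s arbitrary: u)
    case 0
    then show ?case
      using step_interpolation_error[OF Z(1) ne \<Lambda>, of u]
      by (auto simp: peano_kernel_def trunc_pow_def poly_interpolant_sum)
  next
    case (Suc s)
    define A where "A = \<Lambda> * (2 * pi * (r + 1) / card Z) ^ s"
    \<comment> \<open>Polynomials of degree less than \<open>M\<close> are exactly those to which
      \<open>peano_kernel_orthogonal\<close> applies, so one of them may be subtracted from the
      step.\<close>
    define M where "M = card Z - s - 1"
    have M: "0 < M" "s < card Z"
      using Suc.prems rn by (auto simp: M_def)
    have IH: "\<bar>peano_kernel Z s x t\<bar> \<le> A" if "t \<in> {-1..1}" for t
      unfolding A_def using Suc that by simp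
    have A: "0 \<le> A"
      using \<Lambda>(1) by (simp add: A_def)
    obtain p where p: "degree p < M"
      "(\<lambda>t. of_bool (u \<le> t) - poly p t) absolutely_integrable_on {-1..1}"
      "integral {-1..1} (\<lambda>t. \<bar>of_bool (u \<le> t) - poly p t\<bar>) \<le> 2 * pi / (M + 2)"
      using step_L1_approx[OF M(1), of u] Suc.prems by auto
    have abs_int: "(\<lambda>t. \<bar>of_bool (u \<le> t) - poly p t\<bar>) integrable_on {-1..1}"
      using p(2) by (auto simp: absolutely_integrable_on_def)
    have "((\<lambda>t. peano_kernel Z s x t * of_bool (u \<le> t) - peano_kernel Z s x t * poly p t)
        has_integral peano_kernel Z (Suc s) x u - 0) {-1..1}"
      by (intro has_integral_diff peano_kernel_Suc peano_kernel_orthogonal Z x M(2))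
         (use Suc.prems p(1) in \<open>auto simp: M_def\<close>)
    then have int: "((\<lambda>t. peano_kernel Z s x t * (of_bool (u \<le> t) - poly p t))
        has_integral peano_kernel Z (Suc s) x u) {-1..1}"
      by (simp add: right_diff_distrib)
    have "norm (integral {-1..1} (\<lambda>t. peano_kernel Z s x t * (of_bool (u \<le> t) - poly p t)))
        \<le> integral {-1..1} (\<lambda>t. A * \<bar>of_bool (u \<le> t) - poly p t\<bar>)"
    proof (rule integral_norm_bound_integral)
      show "norm (peano_kernel Z s x t * (of_bool (u \<le> t) - poly p t)) \<le> A * \<bar>of_bool (u \<le> t) - poly p t\<bar>"
        if "t \<in> {-1..1}" for t
        using IH[OF that] by (simp add: abs_mult mult_right_mono)
      show "(\<lambda>t. A * \<bar>of_bool (u \<le> t) - poly p t\<bar>) integrable_on {-1..1}"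
        using integrable_on_cmult_left[OF abs_int, of A] by simp
    qed (use int in auto)
    then have "\<bar>peano_kernel Z (Suc s) x u\<bar> \<le> A * integral {-1..1} (\<lambda>t. \<bar>of_bool (u \<le> t) - poly p t\<bar>)"
      using integral_unique[OF int] by simp
    also have "\<dots> \<le> A * (2 * pi / (M + 2))"
      by (intro mult_left_mono p A)
    also have "\<dots> \<le> A * (2 * pi * (r + 1) / card Z)"
    proof (intro mult_left_mono A)
      define n where "n = card Z"
      \<comment> \<open>As s < r, the degrees available number at least n - r, which is at least n /
        (r + 1) because n > r. This gives one factor for all steps of the induction.\<close>
      have "n \<le> (r + 1) * (M + 2)"
      proof -
        obtain k where "n = r + Suc k"
          using rn unfolding n_def by (auto simp: less_iff_Suc_add)
        then have "n \<le> (r + 1) * (n - r)"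
          by simp
        also have "(r + 1) * (n - r) \<le> (r + 1) * (M + 2)"
          by (intro mult_left_mono) (use Suc.prems rn in \<open>auto simp: M_def n_def\<close>)
        finally show ?thesis .
      qed
      then have "real n \<le> real ((r + 1) * (M + 2))"
        by (simp only: of_nat_le_iff)
      moreover have "0 < n"
        using rn by (simp add: n_def)
      ultimately have "1 / (real M + 2) \<le> (real r + 1) / real n"
        by (simp add: divide_simps algebra_simps)
      then have "2 * pi * (1 / (real M + 2)) \<le> 2 * pi * ((real r + 1) / real n)"
        by (intro mult_left_mono) auto
      then show "2 * pi / (M + 2) \<le> 2 * pi * (r + 1) / card Z"
        by (simp add: n_def algebra_simps)
    qed
    finally show ?case
      by (simp add: A_def algebra_simps)
  qed
qed

section \<open>Functions of bounded variation\<close>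

text \<open>Jordan's decomposition: with \<open>V t\<close> the total variation on [a, t], both
  \<open>V\<close> and \<open>V - h\<close> are monotone, since V grows by at least |h(t) - h(s)|
  between s and t.\<close>

lemma bounded_variation_monotone_diff:
  fixes h :: "real \<Rightarrow> real"
  assumes bv: "bounded_variation_on {a..b} h"
  obtains p q where "mono_on {a..b} p" "mono_on {a..b} q" "\<And>t. t \<in> {a..b} \<Longrightarrow> h t = p t - q t"
proof -
  define S where "S t = {v. \<exists>N x. (\<forall>i\<le>N. x i \<in> {a..t}) \<and> (\<forall>i<N. x i \<le> x (Suc i))
      \<and> v = (\<Sum>i<N. \<bar>h (x (Suc i)) - h (x i)\<bar>)}" for t
  define V where "V t = Sup (S t)" for t
  obtain M where M: "\<And>N x. (\<forall>i\<le>N. x i \<in> {a..b}) \<Longrightarrow> (\<forall>i<N. x i \<le> x (Suc i)) \<Longrightarrow>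
      (\<Sum>i<N. \<bar>h (x (Suc i)) - h (x i)\<bar>) \<le> M"
    using bv unfolding bounded_variation_on_def by blast
  have bdd: "bdd_above (S t)" if "t \<le> b" for t
  proof (rule bdd_aboveI)
    fix v assume "v \<in> S t"
    then obtain N x where x: "\<forall>i\<le>N. x i \<in> {a..t}" "\<forall>i<N. x i \<le> x (Suc i)"
      "v = (\<Sum>i<N. \<bar>h (x (Suc i)) - h (x i)\<bar>)"
      by (auto simp: S_def)
    then show "v \<le> M"
      using M[of N x] that by force
  qed
  have ne: "S t \<noteq> {}" if "a \<le> t" for t
  proof -
    have "0 \<in> S t"
      unfolding S_def using that by (intro CollectI exI[of _ 0] exI[of _ "\<lambda>_. a"]) auto
    then show ?thesis by blast
  qed
  have incr: "V s + \<bar>h t - h s\<bar> \<le> V t" if st: "a \<le> s" "s \<le> t" "t \<le> b" for s t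
  proof -
    have "v \<le> V t - \<bar>h t - h s\<bar>" if v: "v \<in> S s" for v
    proof -
      obtain N x where x: "\<And>i. i \<le> N \<Longrightarrow> x i \<in> {a..s}" "\<And>i. i < N \<Longrightarrow> x i \<le> x (Suc i)"
        "v = (\<Sum>i<N. \<bar>h (x (Suc i)) - h (x i)\<bar>)"
        using v by (auto simp: S_def)
      \<comment> \<open>A chain in [a, s] is prolonged by the points \<open>s\<close> and
        \<open>t\<close>, which adds at least |h(t) - h(s)| to its variation.\<close>
      define y where "y i = (if i \<le> N then x i else if i = Suc N then s else t)" for i
      define w where "w = (\<Sum>i<Suc (Suc N). \<bar>h (y (Suc i)) - h (y i)\<bar>)"
      have "w \<in> S t"
        unfolding S_def w_def
      proof (intro CollectI exI conjI allI impI)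
        show "y i \<in> {a..t}" for i
          using x(1)[of i] st by (auto simp: y_def)
        show "y i \<le> y (Suc i)" if "i < Suc (Suc N)" for i
          using x(1)[of i] x(2)[of i] st that by (auto simp: y_def not_le less_Suc_eq)
      qed simp
      then have "w \<le> V t"
        unfolding V_def by (intro cSup_upper bdd st)
      moreover have "(\<Sum>i<N. \<bar>h (y (Suc i)) - h (y i)\<bar>) = v"
        unfolding x(3) by (rule sum.cong) (auto simp: y_def)
      then have "w = v + \<bar>h s - h (x N)\<bar> + \<bar>h t - h s\<bar>"
        by (simp add: w_def y_def)
      ultimately show ?thesis
        by linarith
    qed
    then have "V s \<le> V t - \<bar>h t - h s\<bar>"
      unfolding V_def by (intro cSup_least ne st)
    then show ?thesis by linarith
  qed
  show thesis
  proof
    show "mono_on {a..b} V"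
    proof (rule mono_onI)
      fix s t assume "s \<in> {a..b}" "t \<in> {a..b}" "s \<le> t"
      then show "V s \<le> V t"
        using incr[of s t] by auto
    qed
    show "mono_on {a..b} (\<lambda>t. V t - h t)"
    proof (rule mono_onI)
      fix s t assume "s \<in> {a..b}" "t \<in> {a..b}" "s \<le> t"
      then show "V s - h s \<le> V t - h t"
        using incr[of s t] by auto
    qed
  qed simp
qed

text \<open>The right tail is the recursion \<open>peano_kernel_Suc\<close>; the left tail is its
  negative because the kernel is orthogonal to constants. Both are thus bounded uniformly in
  \<open>c\<close>, the unknown intermediate point of the second mean value theorem.\<close>

lemma peano_kernel_integral_tail:
  assumes Z: "finite Z" "Z \<subseteq> {-1..1}" "Suc s < card Z" and x: "x \<in> {-1..1}" and c: "c \<in> {-1..1}"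
  shows "integral {c..1} (peano_kernel Z s x) = peano_kernel Z (Suc s) x c"
    and "integral {-1..c} (peano_kernel Z s x) = - peano_kernel Z (Suc s) x c"
    and "peano_kernel Z s x integrable_on {-1..1}"
proof -
  have "((\<lambda>t. of_bool (c \<le> t) * peano_kernel Z s x t) has_integral peano_kernel Z (Suc s) x c) {-1..1}"
    using peano_kernel_Suc[OF Z(1,2) _ x c, of s] Z(3) by (simp add: mult.commute)
  then have "(peano_kernel Z s x has_integral peano_kernel Z (Suc s) x c) {c..1}"
    using has_integral_of_bool_mult_iff[of "-1" c "peano_kernel Z s x"] c by simp
  then show tail: "integral {c..1} (peano_kernel Z s x) = peano_kernel Z (Suc s) x c"
    by (rule integral_unique)
  have tot: "(peano_kernel Z s x has_integral 0) {-1..1}"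
    using peano_kernel_orthogonal[OF Z(1,2) _ x, of 1 s] Z(3) by simp
  then show int: "peano_kernel Z s x integrable_on {-1..1}"
    by blast
  show "integral {-1..c} (peano_kernel Z s x) = - peano_kernel Z (Suc s) x c"
    using Henstock_Kurzweil_Integration.integral_combine[of "-1" c 1 "peano_kernel Z s x"] c int
      integral_unique[OF tot] tail by auto
qed

lemma peano_kernel_mono_integral:
  assumes Z: "finite Z" "Z \<subseteq> {-1..1}" "Suc s < card Z" and x: "x \<in> {-1..1}"
    and A: "\<And>u. u \<in> {-1..1} \<Longrightarrow> \<bar>peano_kernel Z (Suc s) x u\<bar> \<le> A"
    and m: "mono_on {-1..1} m"
  obtains I where "((\<lambda>t. m t * peano_kernel Z s x t) has_integral I) {-1..1}"
    "\<bar>I\<bar> \<le> A * (\<bar>m (-1)\<bar> + \<bar>m 1\<bar>)"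
proof -
  note tail = peano_kernel_integral_tail[OF Z x]
  obtain c where c: "c \<in> {-1..1}"
    and I: "((\<lambda>t. m t * peano_kernel Z s x t) has_integral
      (m (-1) * integral {-1..c} (peano_kernel Z s x) + m 1 * integral {c..1} (peano_kernel Z s x))) {-1..1}"
    by (rule second_mean_value_theorem_full[of "peano_kernel Z s x" "-1" 1 m])
       (use tail(3)[of 0] m in \<open>auto simp: mono_on_def\<close>)
  let ?K = "peano_kernel Z (Suc s) x c"
  have "\<bar>m (-1) * - ?K + m 1 * ?K\<bar> \<le> \<bar>m (-1) * - ?K\<bar> + \<bar>m 1 * ?K\<bar>"
    by (rule abs_triangle_ineq)
  also have "\<dots> = \<bar>?K\<bar> * (\<bar>m (-1)\<bar> + \<bar>m 1\<bar>)"
    by (simp add: abs_mult algebra_simps)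
  also have "\<dots> \<le> A * (\<bar>m (-1)\<bar> + \<bar>m 1\<bar>)"
    by (intro mult_right_mono A c) auto
  finally show thesis
    using that[OF I] tail(1,2)[OF c] by simp
qed

text \<open>The constant is fixed before the nodes, so it depends on f and s alone; everything about
  the nodes is contained in \<Lambda> and their number.\<close>

lemma interpolation_error_bounded_variation:
  fixes D :: "nat \<Rightarrow> real \<Rightarrow> real"
  assumes D: "\<And>k t. k < s \<Longrightarrow> t \<in> {-1..1} \<Longrightarrow> (D k has_real_derivative D (Suc k) t) (at t within {-1..1})"
    and g: "g absolutely_integrable_on {-1..1}" "bounded_variation_on {-1..1} g"
    and h: "\<And>t. t \<in> {-1..1} \<Longrightarrow> D s t = D s (-1) + integral {-1..t} g"
  obtains C where "0 \<le> C"
    "\<And>Z x \<Lambda>. finite Z \<Longrightarrow> Z \<subseteq> {-1..1} \<Longrightarrow> Suc s < card Z \<Longrightarrow> x \<in> {-1..1} \<Longrightarrow> 0 \<le> \<Lambda>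
      \<Longrightarrow> (\<And>z. z \<in> Z \<Longrightarrow> \<bar>poly (lagrange_basis Z z) x\<bar> \<le> \<Lambda>)
      \<Longrightarrow> \<bar>D 0 x - poly (interpolant Z (D 0)) x\<bar> \<le> C * \<Lambda> / card Z ^ Suc s"
proof -
  obtain p q where pq: "mono_on {-1..1} p" "mono_on {-1..1} q" "\<And>t. t \<in> {-1..1} \<Longrightarrow> g t = p t - q t"
    using bounded_variation_monotone_diff[OF g(2)] by blast
  define B where "B = \<bar>p (-1)\<bar> + \<bar>p 1\<bar> + (\<bar>q (-1)\<bar> + \<bar>q 1\<bar>)"
  have G: "\<bar>g t\<bar> \<le> B" if "t \<in> {-1..1}" for t
  proof -
    have "p (-1) \<le> p t" "p t \<le> p 1" "q (-1) \<le> q t" "q t \<le> q 1"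
      using pq that by (auto intro: mono_onD)
    then show ?thesis
      using pq(3)[OF that] by (simp add: B_def)
  qed
  define C where "C = (2 * pi * (Suc s + 1)) ^ Suc s * B"
  show thesis
  proof
    show "0 \<le> C"
      by (simp add: C_def B_def)
    fix Z :: "real set" and x \<Lambda> :: real
    assume Z: "finite Z" "Z \<subseteq> {-1..1}" "Suc s < card Z" and x: "x \<in> {-1..1}" and \<Lambda>: "0 \<le> \<Lambda>"
      "\<And>z. z \<in> Z \<Longrightarrow> \<bar>poly (lagrange_basis Z z) x\<bar> \<le> \<Lambda>"
    define A where "A = \<Lambda> * (2 * pi * (Suc s + 1) / card Z) ^ Suc s"
    have A: "\<bar>peano_kernel Z (Suc s) x u\<bar> \<le> A" if "u \<in> {-1..1}" for u
      unfolding A_def by (rule peano_kernel_bound[OF Z x \<Lambda> _ that]) auto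
    obtain I where I: "((\<lambda>t. p t * peano_kernel Z s x t) has_integral I) {-1..1}"
      "\<bar>I\<bar> \<le> A * (\<bar>p (-1)\<bar> + \<bar>p 1\<bar>)"
      using peano_kernel_mono_integral[OF Z x A pq(1)] by blast
    obtain J where J: "((\<lambda>t. q t * peano_kernel Z s x t) has_integral J) {-1..1}"
      "\<bar>J\<bar> \<le> A * (\<bar>q (-1)\<bar> + \<bar>q 1\<bar>)"
      using peano_kernel_mono_integral[OF Z x A pq(2)] by blast
    have "((\<lambda>t. p t * peano_kernel Z s x t - q t * peano_kernel Z s x t) has_integral I - J) {-1..1}"
      by (intro has_integral_diff I J)
    then have "((\<lambda>t. peano_kernel Z s x t * g t) has_integral I - J) {-1..1}"
      by (rule has_integral_eq[rotated]) (simp add: pq(3) algebra_simps)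
    moreover have "((\<lambda>t. peano_kernel Z s x t * g t) has_integral
        D 0 x - poly (interpolant Z (D 0)) x) {-1..1}"
      using peano_kernel_has_integral[OF Z(1,2) _ x D g(1) G h] Z(3) by simp
    ultimately have "D 0 x - poly (interpolant Z (D 0)) x = I - J"
      by (rule has_integral_unique[rotated])
    then have "\<bar>D 0 x - poly (interpolant Z (D 0)) x\<bar> \<le> A * B"
      using I(2) J(2) unfolding B_def distrib_left by linarith
    also have "\<dots> = C * \<Lambda> / card Z ^ Suc s"
      unfolding A_def C_def power_divide by (simp only: mult_ac times_divide_eq_left times_divide_eq_right of_nat_power)
    finally show "\<bar>D 0 x - poly (interpolant Z (D 0)) x\<bar> \<le> C * \<Lambda> / card Z ^ Suc s" .
  qed
qed

section \<open>Jacobi polynomials\<close>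

definition jacobi_eigenvalue :: "real \<Rightarrow> real \<Rightarrow> nat \<Rightarrow> real" where
  "jacobi_eigenvalue \<alpha> \<beta> n = real n * (real n + \<alpha> + \<beta> + 1)"

text \<open>The left-hand side of Jacobi's differential equation, with a free eigenvalue parameter
  \<mu>.\<close>

definition jacobi_op :: "real \<Rightarrow> real \<Rightarrow> real \<Rightarrow> real poly \<Rightarrow> real poly" where
  "jacobi_op \<alpha> \<beta> \<mu> p = [:1, 0, -1:] * pderiv (pderiv p) + [:\<beta> - \<alpha>, - (\<alpha> + \<beta> + 2):] * pderiv p + smult \<mu> p"

lemma jacobi_eigenvalue_less:
  assumes "\<alpha> > -1" "\<beta> > -1" "m < n"
  shows "jacobi_eigenvalue \<alpha> \<beta> m < jacobi_eigenvalue \<alpha> \<beta> n"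
proof -
  have "jacobi_eigenvalue \<alpha> \<beta> n - jacobi_eigenvalue \<alpha> \<beta> m
      = (real n - real m) * (real n + real m + \<alpha> + \<beta> + 1)"
    by (simp add: jacobi_eigenvalue_def algebra_simps)
  moreover have "\<dots> > 0"
    using assms by (intro mult_pos_pos) auto
  ultimately show ?thesis by linarith
qed

text \<open>In the monomial basis the operator is triangular, with diagonal entries \<mu> -
  \<lambda>(k), where \<lambda>(k) is \<open>jacobi_eigenvalue \<alpha> \<beta> k\<close>.
  Solvability is read off from this.\<close>

lemma coeff_jacobi_op:
  "coeff (jacobi_op \<alpha> \<beta> \<mu> p) k = (\<mu> - jacobi_eigenvalue \<alpha> \<beta> k) * coeff p k
    + (\<beta> - \<alpha>) * (real k + 1) * coeff p (k + 1) + (real k + 2) * (real k + 1) * coeff p (k + 2)"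
proof -
  have X1: "coeff ([:b, c:] * pderiv q) k = b * (real k + 1) * coeff q (k + 1) + c * real k * coeff q k"
    for b c and q :: "real poly" and k
    by (cases k) (simp_all add: coeff_pCons coeff_pderiv algebra_simps)
  have X2: "coeff (pCons 0 (pCons 0 (pderiv (pderiv p)))) k = real k * (real k - 1) * coeff p k"
    by (cases k; cases "k - 1") (auto simp: coeff_pCons coeff_pderiv algebra_simps)
  have X3: "[:1, 0, -1:] * pderiv (pderiv p) = pderiv (pderiv p) - pCons 0 (pCons 0 (pderiv (pderiv p)))"
    by simp
  show ?thesis
    unfolding jacobi_op_def X3 coeff_add coeff_diff coeff_smult X1 X2
    by (simp add: coeff_pderiv jacobi_eigenvalue_def algebra_simps del: mult_pCons_left)
qed

lemma jacobi_op_add: "jacobi_op \<alpha> \<beta> \<mu> (p + q) = jacobi_op \<alpha> \<beta> \<mu> p + jacobi_op \<alpha> \<beta> \<mu> q"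
  by (simp add: poly_eq_iff coeff_jacobi_op algebra_simps)

lemma jacobi_op_diff: "jacobi_op \<alpha> \<beta> \<mu> (p - q) = jacobi_op \<alpha> \<beta> \<mu> p - jacobi_op \<alpha> \<beta> \<mu> q"
  by (simp add: poly_eq_iff coeff_jacobi_op algebra_simps)

text \<open>Back substitution from the top coefficient: the diagonal entries below n are nonzero
  because the eigenvalues increase strictly. Vanishing of the coefficients from \<open>k\<close> on,
  unlike a bound on \<open>degree\<close>, describes the zero polynomial at
  \<open>k = 0\<close>.\<close>

lemma jacobi_op_surj:
  assumes "\<alpha> > -1" "\<beta> > -1" "k \<le> n" "\<And>i. i \<ge> k \<Longrightarrow> coeff q i = 0"
  obtains s where "\<And>i. i \<ge> k \<Longrightarrow> coeff s i = 0" "jacobi_op \<alpha> \<beta> (jacobi_eigenvalue \<alpha> \<beta> n) s = q"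
proof -
  define L where "L = jacobi_op \<alpha> \<beta> (jacobi_eigenvalue \<alpha> \<beta> n)"
  have "\<exists>s. (\<forall>i\<ge>k. coeff s i = 0) \<and> L s = q"
    using assms(3,4)
  proof (induction k arbitrary: q)
    case 0
    then have "q = 0"
      by (simp add: poly_eq_iff)
    then show ?case
      by (intro exI[of _ 0]) (simp add: L_def jacobi_op_def)
  next
    case (Suc k)
    define d where "d = jacobi_eigenvalue \<alpha> \<beta> n - jacobi_eigenvalue \<alpha> \<beta> k"
    have d: "d \<noteq> 0"
      using jacobi_eigenvalue_less[of \<alpha> \<beta> k n] assms Suc.prems by (simp add: d_def)
    define t where "t = monom (coeff q k / d) k"
    have "coeff (q - L t) i = 0" if "i \<ge> k" for i
      using that d Suc.prems(2)[of i] by (cases "i = k") (auto simp: L_def coeff_jacobi_op t_def d_def)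
    then obtain s where "\<forall>i\<ge>k. coeff s i = 0" "L s = q - L t"
      using Suc.IH[of "q - L t"] Suc.prems by auto
    then show ?case
      by (intro exI[of _ "s + t"]) (auto simp: L_def jacobi_op_add t_def)
  qed
  then show thesis
    using that by (auto simp: L_def)
qed

text \<open>The diagonal entry at n is 0, so the operator maps x^n to lower degree, where it can be
  inverted; subtracting the preimage leaves a monic solution.\<close>

lemma jacobi_eigenpoly_exists:
  assumes "\<alpha> > -1" "\<beta> > -1"
  obtains P where "degree P = n" "coeff P n = 1" "jacobi_op \<alpha> \<beta> (jacobi_eigenvalue \<alpha> \<beta> n) P = 0"
proof -
  let ?L = "jacobi_op \<alpha> \<beta> (jacobi_eigenvalue \<alpha> \<beta> n)"
  have "coeff (?L (monom 1 n)) i = 0" if "i \<ge> n" for i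
    using that by (cases "i = n") (auto simp: coeff_jacobi_op)
  then obtain s where s: "\<And>i. i \<ge> n \<Longrightarrow> coeff s i = 0" "?L s = ?L (monom 1 n)"
    using jacobi_op_surj[OF assms order_refl] by blast
  define P where "P = monom 1 n - s"
  have c: "coeff P i = (if i = n then 1 else 0)" if "i \<ge> n" for i
    using s(1)[OF that] that by (auto simp: P_def)
  have "degree P \<le> n"
    by (rule degree_le) (use c in auto)
  moreover have "n \<le> degree P"
    by (rule le_degree) (use c[of n] in simp)
  ultimately have "degree P = n"
    by simp
  then show thesis
    using that[of P] c[of n] s(2) by (simp add: P_def jacobi_op_diff)
qed

section \<open>Orthogonality, roots and uniqueness\<close>

definition jacobi_orthogonal :: "real \<Rightarrow> real \<Rightarrow> nat \<Rightarrow> real poly \<Rightarrow> bool" where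
  "jacobi_orthogonal \<alpha> \<beta> n p \<longleftrightarrow> (\<forall>q. degree q < n \<longrightarrow>
    ((\<lambda>t. poly p t * poly q t * jacobi_weight \<alpha> \<beta> t) has_integral 0) {-1..1})"

text \<open>If \<open>q = (L + \<mu>) s\<close> and \<open>(L + \<mu>) P = 0\<close>, then \<open>w P q\<close> is the derivative of
  \<open>(1 - t\<^sup>2) w (P s' - s P')\<close>, which vanishes at both end points.\<close>
lemma jacobi_eigenpoly_orthogonal:
  assumes ab: "\<alpha> > -1" "\<beta> > -1"
    and P: "jacobi_op \<alpha> \<beta> (jacobi_eigenvalue \<alpha> \<beta> n) P = 0"
  shows "jacobi_orthogonal \<alpha> \<beta> n P"
  unfolding jacobi_orthogonal_def
proof (intro allI impI)
  fix q :: "real poly" assume q: "degree q < n"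
  define \<mu> where "\<mu> = jacobi_eigenvalue \<alpha> \<beta> n"
  obtain s where s: "jacobi_op \<alpha> \<beta> \<mu> s = q"
    using jacobi_op_surj[OF ab order_refl, of n q] q unfolding \<mu>_def by (metis coeff_eq_0 less_le_trans)
  define F where "F t = (1 - t) powr (\<alpha> + 1) * (1 + t) powr (\<beta> + 1)
    * (poly P t * poly (pderiv s) t - poly s t * poly (pderiv P) t)" for t
  have "((\<lambda>t. poly P t * poly q t * jacobi_weight \<alpha> \<beta> t) has_integral F 1 - F (-1)) {-1..1}"
  \<comment> \<open>The integrand may be unbounded at the end points, but \<open>F\<close> is
    continuous on the closed interval since the exponents \<alpha> + 1 and \<beta> + 1 are
    positive.\<close>
  proof (rule fundamental_theorem_of_calculus_interior)
    show "continuous_on {-1..1} F"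
      unfolding F_def by (intro continuous_intros continuous_on_powr') (use ab in auto)
  next
    fix t :: real assume "t \<in> {-1<..<1}"
    then have t: "0 < 1 - t" "0 < 1 + t" by auto
    have eP: "poly (jacobi_op \<alpha> \<beta> \<mu> P) t = 0" and es: "poly (jacobi_op \<alpha> \<beta> \<mu> s) t = poly q t"
      using P s by (simp_all add: \<mu>_def)
    define P0 P1 P2 s0 s1 s2 where "P0 = poly P t" "P1 = poly (pderiv P) t" "P2 = poly (pderiv (pderiv P)) t"
      "s0 = poly s t" "s1 = poly (pderiv s) t" "s2 = poly (pderiv (pderiv s)) t"
    note abbr = this
    have eP: "(1 - t) * (1 + t) * P2 + (\<beta> - \<alpha> - (\<alpha> + \<beta> + 2) * t) * P1 + \<mu> * P0 = 0"
      and es: "(1 - t) * (1 + t) * s2 + (\<beta> - \<alpha> - (\<alpha> + \<beta> + 2) * t) * s1 + \<mu> * s0 = poly q t"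
      using eP es by (simp_all add: jacobi_op_def abbr algebra_simps)
    define u v where "u = (1 - t) powr \<alpha>" "v = (1 + t) powr \<beta>"
    have p1: "(1 - t) powr (\<alpha> + 1) = (1 - t) * u" "(1 + t) powr (\<beta> + 1) = (1 + t) * v"
      using t by (simp_all add: u_v_def powr_add)
    have d1: "((\<lambda>t. (1 - t) powr (\<alpha> + 1)) has_real_derivative - (\<alpha> + 1) * u) (at t)"
      using t by (auto intro!: derivative_eq_intros simp: u_v_def algebra_simps)
    have d2: "((\<lambda>t. (1 + t) powr (\<beta> + 1)) has_real_derivative (\<beta> + 1) * v) (at t)"
      using t by (auto intro!: derivative_eq_intros simp: u_v_def)
    have "(F has_real_derivative
      (- (\<alpha> + 1) * u * ((1 + t) * v) + (1 - t) * u * ((\<beta> + 1) * v)) * (P0 * s1 - s0 * P1)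
        + (1 - t) * u * ((1 + t) * v) * (P0 * s2 - s0 * P2)) (at t)"
      unfolding F_def
      by (rule DERIV_cong[OF DERIV_mult[OF DERIV_mult[OF d1 d2]
            DERIV_diff[OF DERIV_mult[OF poly_DERIV poly_DERIV] DERIV_mult[OF poly_DERIV poly_DERIV]]]])
         (unfold p1 abbr, simp add: algebra_simps)
    moreover have "(- (\<alpha> + 1) * u * ((1 + t) * v) + (1 - t) * u * ((\<beta> + 1) * v)) * (P0 * s1 - s0 * P1)
        + (1 - t) * u * ((1 + t) * v) * (P0 * s2 - s0 * P2) = P0 * poly q t * (u * v)"
      using eP es[symmetric] by algebra
    ultimately show "(F has_vector_derivative poly P t * poly q t * jacobi_weight \<alpha> \<beta> t) (at t)"
      by (simp add: has_real_derivative_iff_has_vector_derivative jacobi_weight_def abbr u_v_def)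
  qed simp
  then show "((\<lambda>t. poly P t * poly q t * jacobi_weight \<alpha> \<beta> t) has_integral 0) {-1..1}"
    by (simp add: F_def)
qed

text \<open>The integral is restricted to [-1/2, 1/2], where the weight is continuous and positive;
  a polynomial vanishing there is 0.\<close>

lemma jacobi_weight_integral_eq_0:
  assumes int: "((\<lambda>t. poly f t * jacobi_weight \<alpha> \<beta> t) has_integral 0) {-1..1}"
    and nonneg: "\<And>t. t \<in> {-1<..<1} \<Longrightarrow> 0 \<le> poly f t"
  shows "f = 0"
proof -
  define F where "F t = poly f t * jacobi_weight \<alpha> \<beta> t" for t
  have F: "0 \<le> F t" if "t \<in> {-1..1}" for t
    using nonneg[of t] that by (cases "t = 1 \<or> t = -1") (auto simp: F_def jacobi_weight_def)
  have int': "F integrable_on {-1..1}" "integral {-1..1} F = 0"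
    using int by (auto simp: F_def[abs_def] integral_unique)
  have sub: "F integrable_on {-1/2..1/2}"
    by (rule integrable_on_subinterval[OF int'(1)]) auto
  have "integral {-1/2..1/2} F \<le> integral {-1..1} F"
    by (rule integral_subset_le) (use int'(1) sub F in auto)
  moreover have "0 \<le> integral {-1/2..1/2} F"
    by (rule integral_nonneg[OF sub]) (use F in auto)
  ultimately have "(F has_integral 0) (cbox (-1/2) (1/2))"
    using sub int'(2) by (simp add: has_integral_integrable_integral)
  moreover have "continuous_on (cbox (-1/2) (1/2)) F"
    unfolding F_def[abs_def] jacobi_weight_def by (intro continuous_intros) auto
  ultimately have "F t = 0" if "t \<in> {-1/2..1/2}" for t
    using has_integral_0_cbox_imp_0[of "-1/2" "1/2" F t] F that by auto
  then have "poly f t = 0" if "t \<in> {-1/2..1/2}" for t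
    using that by (fastforce simp: F_def jacobi_weight_def)
  then have "{-1/2..1/2} \<subseteq> {t. poly f t = 0}"
    by auto
  moreover have "infinite {-1/2..1/2 :: real}"
    by (rule infinite_Icc) simp
  ultimately have "infinite {t. poly f t = 0}"
    using finite_subset by blast
  then show ?thesis
    using poly_roots_finite by blast
qed

text \<open>\<open>S\<close> collects the roots of odd multiplicity in the interval: splitting off
  the roots one by one, each factor toggles whether its root belongs to \<open>S\<close>, and the
  product only changes by a square.\<close>

lemma poly_sign_change_set:
  fixes p :: "real poly"
  assumes "p \<noteq> 0"
  obtains S where "finite S" "S \<subseteq> {x \<in> {a<..<b}. poly p x = 0}"
    "(\<forall>x\<in>{a<..<b}. 0 \<le> poly (p * (\<Prod>z\<in>S. [:- z, 1:])) x)
      \<or> (\<forall>x\<in>{a<..<b}. poly (p * (\<Prod>z\<in>S. [:- z, 1:])) x \<le> 0)"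
proof -
  have "\<exists>S. finite S \<and> S \<subseteq> {x \<in> {a<..<b}. poly p x = 0} \<and>
    ((\<forall>x\<in>{a<..<b}. 0 \<le> poly (p * (\<Prod>z\<in>S. [:- z, 1:])) x)
      \<or> (\<forall>x\<in>{a<..<b}. poly (p * (\<Prod>z\<in>S. [:- z, 1:])) x \<le> 0))"
    using assms
  proof (induction "degree p" arbitrary: p rule: less_induct)
    case (less p)
    show ?case
    proof (cases "\<exists>x\<in>{a<..<b}. poly p x = 0")
      case False
      have "(\<forall>x\<in>{a<..<b}. 0 \<le> poly p x) \<or> (\<forall>x\<in>{a<..<b}. poly p x \<le> 0)"
      proof (rule ccontr)
        assume "\<not> ?thesis"
        then obtain x y where xy: "x \<in> {a<..<b}" "poly p x < 0" "y \<in> {a<..<b}" "0 < poly p y"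
          by (auto simp: not_le)
        then have "x \<noteq> y" by auto
        then have "\<exists>z\<in>{a<..<b}. poly p z = 0"
          using poly_IVT_pos[of x y p] poly_IVT_neg[of y x p] xy by (cases "x < y") force+
        then show False using False by blast
      qed
      then show ?thesis
        by (intro exI[of _ "{}"]) auto
    next
      case True
      then obtain x where x: "x \<in> {a<..<b}" "poly p x = 0" by blast
      obtain g where g: "p = [:- x, 1:] * g"
        using x(2) by (auto simp: poly_eq_0_iff_dvd elim: dvdE)
      have g0: "g \<noteq> 0"
        using less.prems g by auto
      have "degree p = Suc (degree g)"
        unfolding g using g0 by (subst degree_mult_eq) auto
      then obtain S where S: "finite S" "S \<subseteq> {x \<in> {a<..<b}. poly g x = 0}"
        "(\<forall>x\<in>{a<..<b}. 0 \<le> poly (g * (\<Prod>z\<in>S. [:- z, 1:])) x)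
          \<or> (\<forall>x\<in>{a<..<b}. poly (g * (\<Prod>z\<in>S. [:- z, 1:])) x \<le> 0)"
        using less.hyps[of g] g0 by auto
      show ?thesis
      proof (cases "x \<in> S")
        case True
        have "p * (\<Prod>z\<in>S - {x}. [:- z, 1:]) = g * (\<Prod>z\<in>S. [:- z, 1:])"
          unfolding g prod.remove[OF S(1) True] by (simp only: mult_ac)
        then show ?thesis
          using S g by (intro exI[of _ "S - {x}"]) auto
      next
        case False
        have "p * (\<Prod>z\<in>insert x S. [:- z, 1:]) = [:- x, 1:] * [:- x, 1:] * (g * (\<Prod>z\<in>S. [:- z, 1:]))"
          unfolding g prod.insert[OF S(1) False] by (simp only: mult_ac)
        then have e: "poly (p * (\<Prod>z\<in>insert x S. [:- z, 1:])) y
            = (y - x)\<^sup>2 * poly (g * (\<Prod>z\<in>S. [:- z, 1:])) y" for y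
          by (simp add: power2_eq_square algebra_simps)
        have "(\<forall>y\<in>{a<..<b}. 0 \<le> poly (p * (\<Prod>z\<in>insert x S. [:- z, 1:])) y)
            \<or> (\<forall>y\<in>{a<..<b}. poly (p * (\<Prod>z\<in>insert x S. [:- z, 1:])) y \<le> 0)"
          using S(3) unfolding e by (auto simp: mult_nonneg_nonpos)
        then show ?thesis
          using S(1,2) x g by (intro exI[of _ "insert x S"]) auto
      qed
    qed
  qed
  then show thesis
    using that by blast
qed

text \<open>If p changed sign at fewer than n points of the interval, its product with the linear
  factors of these points would have constant sign and integral 0, hence be 0. So there are n roots
  inside, and the degree leaves no room for others.\<close>

lemma jacobi_orthogonal_roots:
  assumes n: "0 < n" "degree p = n" and orth: "jacobi_orthogonal \<alpha> \<beta> n p"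
  shows "finite {x. poly p x = 0}" "{x. poly p x = 0} \<subseteq> {-1<..<1}" "card {x. poly p x = 0} = n"
    "p = smult (lead_coeff p) (\<Prod>z\<in>{x. poly p x = 0}. [:- z, 1:])"
proof -
  define R where "R = {x. poly p x = 0}"
  have p0: "p \<noteq> 0"
    using n by auto
  then show fin: "finite {x. poly p x = 0}"
    by (rule poly_roots_finite)
  have deg: "card R \<le> n"
    unfolding R_def using card_poly_roots_bound[OF p0] n by simp
  obtain S where S: "finite S" "S \<subseteq> {x \<in> {-1<..<1}. poly p x = 0}"
    "(\<forall>x\<in>{-1<..<1}. 0 \<le> poly (p * (\<Prod>z\<in>S. [:- z, 1:])) x)
      \<or> (\<forall>x\<in>{-1<..<1}. poly (p * (\<Prod>z\<in>S. [:- z, 1:])) x \<le> 0)"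
    using poly_sign_change_set[OF p0] by blast
  define q where "q = (\<Prod>z\<in>S. [:- z, 1:] :: real poly)"
  have q0: "q \<noteq> 0"
    by (simp add: q_def S(1))
  have "degree q = card S"
    unfolding q_def by (subst degree_prod_eq_sum_degree) auto
  have "n \<le> card S"
  proof (rule ccontr)
    assume "\<not> n \<le> card S"
    then have int: "((\<lambda>t. poly (p * q) t * jacobi_weight \<alpha> \<beta> t) has_integral 0) {-1..1}"
      using orth \<open>degree q = card S\<close> by (simp add: jacobi_orthogonal_def)
    then have int': "((\<lambda>t. poly (- (p * q)) t * jacobi_weight \<alpha> \<beta> t) has_integral 0) {-1..1}"
      using has_integral_neg[OF int] by simp
    have "p * q = 0 \<or> - (p * q) = 0"
      using S(3) jacobi_weight_integral_eq_0[OF int] jacobi_weight_integral_eq_0[OF int']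
      unfolding q_def[symmetric] by fastforce
    then show False
      using p0 q0 by simp
  qed
  moreover have "S \<subseteq> R" "finite R"
    using S fin by (auto simp: R_def)
  ultimately have "S = R"
    using deg by (meson card_seteq order_trans)
  then have sub: "R \<subseteq> {-1<..<1}" and card: "card R = n"
    using S(2) deg \<open>n \<le> card S\<close> by auto
  then show "{x. poly p x = 0} \<subseteq> {-1<..<1}" "card {x. poly p x = 0} = n"
    by (simp_all add: R_def)
  show "p = smult (lead_coeff p) (\<Prod>z\<in>{x. poly p x = 0}. [:- z, 1:])"
  proof (rule poly_eqI_degree_lead_coeff)
    have dq: "degree q = n"
      using \<open>degree q = card S\<close> \<open>S = R\<close> card by simp
    have lq: "lead_coeff q = 1"
      by (simp add: q_def lead_coeff_prod)
    show "coeff p n = coeff (smult (lead_coeff p) (\<Prod>z\<in>{x. poly p x = 0}. [:- z, 1:])) n"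
      using n(2) dq lq \<open>S = R\<close> by (simp add: q_def R_def)
    show "degree (smult (lead_coeff p) (\<Prod>z\<in>{x. poly p x = 0}. [:- z, 1:])) \<le> n"
      using dq \<open>S = R\<close> by (simp add: q_def R_def)
    show "poly p z = poly (smult (lead_coeff p) (\<Prod>z\<in>{x. poly p x = 0}. [:- z, 1:])) z" if "z \<in> R" for z
      using that fin by (auto simp: R_def poly_prod)
  qed (use card n in auto)
qed

text \<open>Cancelling the leading terms leaves a polynomial d of degree less than n, orthogonal to
  itself, so d = 0. The value at 1 determines the factor, since all roots are interior.\<close>

lemma jacobi_orthogonal_unique:
  assumes n: "0 < n" and p: "degree p = n" "jacobi_orthogonal \<alpha> \<beta> n p"
    and q: "degree q = n" "jacobi_orthogonal \<alpha> \<beta> n q" and eq: "poly p 1 = poly q 1"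
  shows "p = q"
proof -
  define c where "c = lead_coeff p / lead_coeff q"
  define d where "d = p - smult c q"
  have q0: "lead_coeff q \<noteq> 0"
    using q n by auto
  have "degree d \<le> n"
    unfolding d_def using p q degree_smult_le[of c q] by (intro degree_diff_le) auto
  moreover have "coeff d n = 0"
    using p q q0 by (simp add: d_def c_def)
  ultimately have dd: "degree d < n"
    using n by (metis degree_0 leading_coeff_0_iff le_neq_implies_less)
  have "((\<lambda>t. poly p t * poly d t * jacobi_weight \<alpha> \<beta> t - c * (poly q t * poly d t * jacobi_weight \<alpha> \<beta> t))
      has_integral 0 - c * 0) {-1..1}"
    using p(2) q(2) dd unfolding jacobi_orthogonal_def
    by (intro has_integral_diff has_integral_mult_right) auto
  then have "((\<lambda>t. poly (d * d) t * jacobi_weight \<alpha> \<beta> t) has_integral 0) {-1..1}"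
    by (simp add: d_def algebra_simps)
  then have "d * d = 0"
    by (rule jacobi_weight_integral_eq_0) auto
  then have pcq: "p = smult c q"
    by (simp add: d_def)
  have "poly q 1 \<noteq> 0"
    using jacobi_orthogonal_roots(2)[OF n q] by auto
  then have "c = 1"
    using eq pcq by simp
  then show ?thesis
    using pcq by simp
qed

lemma gbinomial_jacobi_pos:
  assumes "\<alpha> > -1"
  shows "0 < (real n + \<alpha>) gchoose n"
  using assms by (simp add: gbinomial_pochhammer' pochhammer_pos)

text \<open>The monic eigenpolynomial, rescaled by its nonzero value at 1, meets the description of
  \<open>jacobi_poly\<close>; by uniqueness the \<open>THE\<close> denotes it, and it inherits the
  differential equation.\<close>

lemma jacobi_poly_props:
  assumes ab: "\<alpha> > -1" "\<beta> > -1" and n: "0 < n"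
  shows "degree (jacobi_poly \<alpha> \<beta> n) = n" "jacobi_orthogonal \<alpha> \<beta> n (jacobi_poly \<alpha> \<beta> n)"
    "jacobi_op \<alpha> \<beta> (jacobi_eigenvalue \<alpha> \<beta> n) (jacobi_poly \<alpha> \<beta> n) = 0"
proof -
  obtain P where P: "degree P = n" "coeff P n = 1" "jacobi_op \<alpha> \<beta> (jacobi_eigenvalue \<alpha> \<beta> n) P = 0"
    using jacobi_eigenpoly_exists[OF ab] by blast
  have orth: "jacobi_orthogonal \<alpha> \<beta> n P"
    by (rule jacobi_eigenpoly_orthogonal[OF ab P(3)])
  have P1: "poly P 1 \<noteq> 0"
    using jacobi_orthogonal_roots(2)[OF n P(1) orth] by auto
  define c where "c = ((real n + \<alpha>) gchoose n) / poly P 1"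
  have c: "c \<noteq> 0"
    using gbinomial_jacobi_pos[OF ab(1), of n] P1 by (simp add: c_def)
  define Q where "Q = smult c P"
  have Q: "degree Q = n" "jacobi_orthogonal \<alpha> \<beta> n Q" "poly Q 1 = (real n + \<alpha>) gchoose n"
  proof -
    show "degree Q = n"
      using c P by (simp add: Q_def)
    show "jacobi_orthogonal \<alpha> \<beta> n Q"
      unfolding jacobi_orthogonal_def
    proof (intro allI impI)
      fix q :: "real poly" assume "degree q < n"
      then have "((\<lambda>t. c * (poly P t * poly q t * jacobi_weight \<alpha> \<beta> t)) has_integral c * 0) {-1..1}"
        using orth by (intro has_integral_mult_right) (simp add: jacobi_orthogonal_def)
      then show "((\<lambda>t. poly Q t * poly q t * jacobi_weight \<alpha> \<beta> t) has_integral 0) {-1..1}"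
        by (simp add: Q_def mult_ac)
    qed
    show "poly Q 1 = (real n + \<alpha>) gchoose n"
      using P1 by (simp add: Q_def c_def)
  qed
  have "jacobi_poly \<alpha> \<beta> n = Q"
    unfolding jacobi_poly_def jacobi_orthogonal_def[symmetric]
    by (rule the_equality) (use Q jacobi_orthogonal_unique[OF n] in auto)
  moreover have "jacobi_op \<alpha> \<beta> (jacobi_eigenvalue \<alpha> \<beta> n) Q = smult c (jacobi_op \<alpha> \<beta> (jacobi_eigenvalue \<alpha> \<beta> n) P)"
    by (simp add: poly_eq_iff coeff_jacobi_op Q_def algebra_simps)
  ultimately show "degree (jacobi_poly \<alpha> \<beta> n) = n" "jacobi_orthogonal \<alpha> \<beta> n (jacobi_poly \<alpha> \<beta> n)"
    "jacobi_op \<alpha> \<beta> (jacobi_eigenvalue \<alpha> \<beta> n) (jacobi_poly \<alpha> \<beta> n) = 0"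
    using Q P(3) by simp_all
qed

section \<open>The energy of the Jacobi equation\<close>

text \<open>Solved for the leading term and free of normalisation, so that it passes to the
  reflected polynomial with \<alpha> and \<beta> exchanged.\<close>

definition jacobi_ode :: "real \<Rightarrow> real \<Rightarrow> nat \<Rightarrow> real poly \<Rightarrow> bool" where
  "jacobi_ode \<alpha> \<beta> n y \<longleftrightarrow> y \<noteq> 0 \<and> (\<forall>x. (1 - x\<^sup>2) * poly (pderiv (pderiv y)) x
    = (\<alpha> - \<beta> + (\<alpha> + \<beta> + 2) * x) * poly (pderiv y) x - real n * (real n + \<alpha> + \<beta> + 1) * poly y x)"

lemma jacobi_ode_if_op_eq_0:
  assumes "jacobi_op \<alpha> \<beta> (jacobi_eigenvalue \<alpha> \<beta> n) y = 0" "y \<noteq> 0"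
  shows "jacobi_ode \<alpha> \<beta> n y"
  unfolding jacobi_ode_def
proof (intro conjI allI)
  fix x
  have "poly (jacobi_op \<alpha> \<beta> (jacobi_eigenvalue \<alpha> \<beta> n) y) x = 0"
    using assms by simp
  then show "(1 - x\<^sup>2) * poly (pderiv (pderiv y)) x
    = (\<alpha> - \<beta> + (\<alpha> + \<beta> + 2) * x) * poly (pderiv y) x - real n * (real n + \<alpha> + \<beta> + 1) * poly y x"
    unfolding jacobi_op_def jacobi_eigenvalue_def
    by (simp add: algebra_simps power2_eq_square)
qed (rule assms)

lemma jacobi_ode_reflect:
  assumes "jacobi_ode \<alpha> \<beta> n y"
  shows "jacobi_ode \<beta> \<alpha> n (pcompose y [:0, -1:])"
  unfolding jacobi_ode_def
proof (intro conjI allI)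
  show "pcompose y [:0, -1:] \<noteq> 0"
    using assms by (auto simp: jacobi_ode_def pcompose_eq_0_iff)
  fix x :: real
  have "(1 - (- x)\<^sup>2) * poly (pderiv (pderiv y)) (- x)
    = (\<alpha> - \<beta> + (\<alpha> + \<beta> + 2) * (- x)) * poly (pderiv y) (- x) - real n * (real n + \<alpha> + \<beta> + 1) * poly y (- x)"
    using assms unfolding jacobi_ode_def by blast
  then show "(1 - x\<^sup>2) * poly (pderiv (pderiv (pcompose y [:0, -1:]))) x
    = (\<beta> - \<alpha> + (\<beta> + \<alpha> + 2) * x) * poly (pderiv (pcompose y [:0, -1:])) x
      - real n * (real n + \<beta> + \<alpha> + 1) * poly (pcompose y [:0, -1:]) x"
    by (simp add: pderiv_pcompose pderiv_mult pderiv_pCons poly_pcompose pderiv_minus algebra_simps)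
qed

text \<open>The density of the Jacobi weight in \<theta>: the factor sin \<theta> of dx raises both
  exponents by 1/2.\<close>

definition liouville_weight :: "real \<Rightarrow> real \<Rightarrow> real \<Rightarrow> real" where
  "liouville_weight \<alpha> \<beta> x = (1 - x) powr (\<alpha> + 1/2) * (1 + x) powr (\<beta> + 1/2)"

text \<open>In the variable \<open>x = cos \<theta>\<close> the function \<open>u = w y\<close> with \<open>w\<^sup>2 = liouville_weight\<close> satisfies
  \<open>u'' + \<phi> u = 0\<close> with \<open>\<phi> = N\<^sup>2 + O(1 / (sin \<theta>)\<^sup>2)\<close>; the energy below is \<open>u\<^sup>2 + (u' / N)\<^sup>2\<close>.\<close>
definition jacobi_energy :: "real \<Rightarrow> real \<Rightarrow> nat \<Rightarrow> real poly \<Rightarrow> real \<Rightarrow> real" where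
  "jacobi_energy \<alpha> \<beta> n y x = liouville_weight \<alpha> \<beta> x * ((poly y x)\<^sup>2 +
    ((1 - x\<^sup>2) * poly (pderiv y) x - (\<alpha> - \<beta> + (\<alpha> + \<beta> + 1) * x) * poly y x / 2)\<^sup>2
      / ((real n + (\<alpha> + \<beta> + 1) / 2)\<^sup>2 * (1 - x\<^sup>2)))"

text \<open>The squares of y and of h cancel and only the mixed term survives, with a factor
  independent of n. This rests on the choice N = n + (\<alpha> + \<beta> + 1) / 2, for which the
  eigenvalue is N^2 - b^2 / 4, and on -q / D being the logarithmic derivative of the Liouville
  weight.\<close>

lemma jacobi_energy_has_derivative:
  fixes \<alpha> \<beta> x :: real and n :: nat
  defines "a \<equiv> \<alpha> - \<beta>" and "b \<equiv> \<alpha> + \<beta> + 1"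
  defines "N \<equiv> real n + b / 2" and "D \<equiv> 1 - x\<^sup>2" and "q \<equiv> a + b * x"
  assumes ode: "jacobi_ode \<alpha> \<beta> n y" and N: "N \<noteq> 0" and x: "-1 < x" "x < 1"
  shows "(jacobi_energy \<alpha> \<beta> n y has_real_derivative
    liouville_weight \<alpha> \<beta> x * (2 * (D * poly (pderiv y) x - q * poly y x / 2) * poly y x
      * (D * (b\<^sup>2 / 4 - b / 2) + q\<^sup>2 / 4 - x * q / 2)) / (N\<^sup>2 * D\<^sup>2)) (at x)"
proof -
  have D0: "D \<noteq> 0" "0 < 1 - x" "0 < 1 + x"
    using x by (auto simp: D_def power2_eq_1_iff)
  define W where "W = liouville_weight \<alpha> \<beta> x"
  define y0 y1 y2 where "y0 = poly y x" "y1 = poly (pderiv y) x" "y2 = poly (pderiv (pderiv y)) x"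
  note abbr = this
  \<comment> \<open>With u = w y as in Liouville's form, du/d\<theta> = -w h / sin \<theta>; so W
    h^2 / D is the square of that derivative.\<close>
  define h where "h = D * y1 - q * y0 / 2"
  define h' where "h' = D * y2 - 2 * x * y1 - b * y0 / 2 - q * y1 / 2"
  have ode': "D * y2 = (q + x) * y1 - (N\<^sup>2 - b\<^sup>2 / 4) * y0"
    using ode unfolding jacobi_ode_def abbr D_def q_def N_def a_def b_def
    by (simp add: power2_eq_square algebra_simps)
  have dW: "(liouville_weight \<alpha> \<beta> has_real_derivative - q * W / D) (at x)"
  proof -
    have "((\<lambda>x. (1 - x) powr (\<alpha> + 1/2) * (1 + x) powr (\<beta> + 1/2)) has_real_derivative
      - ((\<alpha> + 1/2) * (1 - x) powr (\<alpha> + 1/2 - 1)) * (1 + x) powr (\<beta> + 1/2)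
      + ((\<beta> + 1/2) * (1 + x) powr (\<beta> + 1/2 - 1)) * (1 - x) powr (\<alpha> + 1/2)) (at x)"
      using D0 by (auto intro!: derivative_eq_intros)
    moreover have "- ((\<alpha> + 1/2) * (1 - x) powr (\<alpha> + 1/2 - 1)) * (1 + x) powr (\<beta> + 1/2)
      + ((\<beta> + 1/2) * (1 + x) powr (\<beta> + 1/2 - 1)) * (1 - x) powr (\<alpha> + 1/2) = - q * W / D"
    proof -
      have De: "D = (1 - x) * (1 + x)"
        by (simp add: D_def power2_eq_square algebra_simps)
      define u v where "u = (1 - x) powr (\<alpha> + 1/2)" "v = (1 + x) powr (\<beta> + 1/2)"
      have uv: "(1 - x) powr (\<alpha> + 1/2 - 1) = u / (1 - x)" "(1 + x) powr (\<beta> + 1/2 - 1) = v / (1 + x)"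
        unfolding u_v_def powr_diff using D0 by simp_all
      show ?thesis
        using D0 unfolding uv W_def liouville_weight_def q_def a_def b_def De u_v_def[symmetric]
        by (simp add: divide_simps) (simp add: algebra_simps)
    qed
    ultimately show ?thesis
      by (simp add: liouville_weight_def[abs_def])
  qed
  have dy: "(poly y has_real_derivative y1) (at x)" and dy1: "(poly (pderiv y) has_real_derivative y2) (at x)"
    unfolding abbr by (rule poly_DERIV)+
  have dh: "((\<lambda>x. (1 - x\<^sup>2) * poly (pderiv y) x - (\<alpha> - \<beta> + (\<alpha> + \<beta> + 1) * x) * poly y x / 2)
      has_real_derivative h') (at x)"
  proof -
    have "((\<lambda>x. 1 - x\<^sup>2) has_real_derivative - (2 * x)) (at x)"
      and "((\<lambda>x. \<alpha> - \<beta> + (\<alpha> + \<beta> + 1) * x) has_real_derivative b) (at x)"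
      by (auto intro!: derivative_eq_intros simp: b_def)
    from DERIV_diff[OF DERIV_mult[OF this(1) dy1] DERIV_cdivide[OF DERIV_mult[OF this(2) dy]]]
    show ?thesis
      by (rule DERIV_cong) (simp add: h'_def D_def q_def a_def b_def abbr field_simps)
  qed
  have dF: "((\<lambda>x. (poly y x)\<^sup>2 + ((1 - x\<^sup>2) * poly (pderiv y) x - (\<alpha> - \<beta> + (\<alpha> + \<beta> + 1) * x) * poly y x / 2)\<^sup>2
      / ((real n + (\<alpha> + \<beta> + 1) / 2)\<^sup>2 * (1 - x\<^sup>2))) has_real_derivative
      2 * y0 * y1 + (2 * h * h' * (N\<^sup>2 * D) - h\<^sup>2 * (N\<^sup>2 * (- 2 * x))) / (N\<^sup>2 * D)\<^sup>2) (at x)"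
  proof -
    have hx: "(1 - x\<^sup>2) * poly (pderiv y) x - (\<alpha> - \<beta> + (\<alpha> + \<beta> + 1) * x) * poly y x / 2 = h"
      and Nx: "real n + (\<alpha> + \<beta> + 1) / 2 = N"
      by (simp_all add: h_def D_def q_def a_def b_def N_def abbr)
    have dD: "((\<lambda>x. 1 - x\<^sup>2) has_real_derivative - (2 * x)) (at x)"
      by (auto intro!: derivative_eq_intros)
    have nz: "N\<^sup>2 * (1 - x\<^sup>2) \<noteq> 0"
      using D0 N by (simp add: D_def)
    show ?thesis
      unfolding Nx
      by (rule DERIV_cong[OF DERIV_add[OF DERIV_power[OF dy, of 2]
            DERIV_divide[OF DERIV_power[OF dh, of 2] DERIV_cmult[OF dD] nz]]])
         (unfold hx, simp add: D_def abbr power2_eq_square)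
  qed
  have val: "(poly y x)\<^sup>2 + ((1 - x\<^sup>2) * poly (pderiv y) x - (\<alpha> - \<beta> + (\<alpha> + \<beta> + 1) * x) * poly y x / 2)\<^sup>2
      / ((real n + (\<alpha> + \<beta> + 1) / 2)\<^sup>2 * (1 - x\<^sup>2)) = y0\<^sup>2 + h\<^sup>2 / (N\<^sup>2 * D)"
    by (simp add: h_def D_def q_def a_def b_def N_def abbr)
  have "(jacobi_energy \<alpha> \<beta> n y has_real_derivative
      (- q * W / D) * (y0\<^sup>2 + h\<^sup>2 / (N\<^sup>2 * D)) +
      (2 * y0 * y1 + (2 * h * h' * (N\<^sup>2 * D) - h\<^sup>2 * (N\<^sup>2 * (- 2 * x))) / (N\<^sup>2 * D)\<^sup>2) * W) (at x)"
    using DERIV_mult[OF dW dF] unfolding val by (simp add: jacobi_energy_def[abs_def] W_def)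
  moreover have "(- q * W / D) * (y0\<^sup>2 + h\<^sup>2 / (N\<^sup>2 * D)) +
      (2 * y0 * y1 + (2 * h * h' * (N\<^sup>2 * D) - h\<^sup>2 * (N\<^sup>2 * (- 2 * x))) / (N\<^sup>2 * D)\<^sup>2) * W
    = W * (2 * h * y0 * (D * (b\<^sup>2 / 4 - b / 2) + q\<^sup>2 / 4 - x * q / 2)) / (N\<^sup>2 * D\<^sup>2)"
  proof -
    have y1: "D * y1 = h + q * y0 / 2"
      by (simp add: h_def)
    have h': "D * h' = (q / 2 - x) * (h + q * y0 / 2) - D * (N\<^sup>2 - b\<^sup>2 / 4 + b / 2) * y0"
    proof -
      have "D * h' = D * (D * y2) - (2 * x + q / 2) * (D * y1) - D * b * y0 / 2"
        by (simp add: h'_def algebra_simps)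
      also have "D * (D * y2) = (q + x) * (D * y1) - D * (N\<^sup>2 - b\<^sup>2 / 4) * y0"
        unfolding ode' by (simp add: algebra_simps)
      finally have eq: "D * h' = (q + x) * (h + q * y0 / 2) - D * (N\<^sup>2 - b\<^sup>2 / 4) * y0
          - (2 * x + q / 2) * (h + q * y0 / 2) - D * b * y0 / 2"
        unfolding y1 .
      show ?thesis
        unfolding eq by (simp add: field_simps)
    qed
    have "(- q * W / D) * (y0\<^sup>2 + h\<^sup>2 / (N\<^sup>2 * D)) +
      (2 * y0 * y1 + (2 * h * h' * (N\<^sup>2 * D) - h\<^sup>2 * (N\<^sup>2 * (- 2 * x))) / (N\<^sup>2 * D)\<^sup>2) * W
      = W * (- q * (N\<^sup>2 * D * y0\<^sup>2 + h\<^sup>2) + 2 * y0 * N\<^sup>2 * D * (D * y1) + 2 * h * (D * h') + 2 * x * h\<^sup>2) / (N\<^sup>2 * D\<^sup>2)"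
      using D0 N by (simp add: divide_simps) (simp add: power2_eq_square power4_eq_xxxx algebra_simps)
    also have "- q * (N\<^sup>2 * D * y0\<^sup>2 + h\<^sup>2) + 2 * y0 * N\<^sup>2 * D * (D * y1) + 2 * h * (D * h') + 2 * x * h\<^sup>2
      = 2 * h * y0 * (D * (b\<^sup>2 / 4 - b / 2) + q\<^sup>2 / 4 - x * q / 2)"
      unfolding y1 h' by (simp add: power2_eq_square field_simps)
    finally show ?thesis .
  qed
  ultimately show ?thesis
    by (simp add: h_def abbr W_def)
qed

lemma jacobi_energy_nonneg:
  assumes "-1 < x" "x < 1"
  shows "0 \<le> jacobi_energy \<alpha> \<beta> n y x"
  unfolding jacobi_energy_def liouville_weight_def
  using assms by (intro mult_nonneg_nonneg add_nonneg_nonneg divide_nonneg_nonneg) (auto simp: abs_square_le_1)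

text \<open>A bound on [-1, 1] for the factor of the mixed term in the derivative of the
  energy.\<close>

definition energy_const :: "real \<Rightarrow> real \<Rightarrow> real" where
  "energy_const \<alpha> \<beta> = (\<alpha> + \<beta> + 1)\<^sup>2 / 4 + \<bar>\<alpha> + \<beta> + 1\<bar> / 2
    + (\<bar>\<alpha> - \<beta>\<bar> + \<bar>\<alpha> + \<beta> + 1\<bar>)\<^sup>2 / 4 + (\<bar>\<alpha> - \<beta>\<bar> + \<bar>\<alpha> + \<beta> + 1\<bar>) / 2"

lemma energy_const_nonneg: "0 \<le> energy_const \<alpha> \<beta>"
  by (simp add: energy_const_def)

text \<open>The inequality 2 |h y| m \<le> m^2 y^2 + h^2 with m = N sqrt D bounds the mixed term by
  the energy itself.\<close>

lemma jacobi_energy_deriv_bound: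
  fixes \<alpha> \<beta> x :: real and n :: nat
  defines "N \<equiv> real n + (\<alpha> + \<beta> + 1) / 2" and "D \<equiv> 1 - x\<^sup>2"
  assumes ode: "jacobi_ode \<alpha> \<beta> n y" and N: "0 < N" and x: "-1 < x" "x < 1"
  obtains e where "(jacobi_energy \<alpha> \<beta> n y has_real_derivative e) (at x)"
    "\<bar>e\<bar> \<le> energy_const \<alpha> \<beta> / N * (1 / (D * sqrt D)) * jacobi_energy \<alpha> \<beta> n y x"
proof -
  define a b q where "a = \<alpha> - \<beta>" "b = \<alpha> + \<beta> + 1" "q = \<alpha> - \<beta> + (\<alpha> + \<beta> + 1) * x"
  note abq = this
  define W where "W = liouville_weight \<alpha> \<beta> x"
  define y0 where "y0 = poly y x"
  define h where "h = D * poly (pderiv y) x - q * y0 / 2"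
  define \<kappa> where "\<kappa> = D * (b\<^sup>2 / 4 - b / 2) + q\<^sup>2 / 4 - x * q / 2"
  have D: "0 < D" "D \<le> 1"
    using x by (auto simp: D_def abs_square_less_1)
  have W: "0 \<le> W"
    by (simp add: W_def liouville_weight_def)
  have E: "jacobi_energy \<alpha> \<beta> n y x = W * (y0\<^sup>2 + h\<^sup>2 / (N\<^sup>2 * D))"
    by (simp add: jacobi_energy_def W_def y0_def h_def D_def N_def abq)
  have q: "\<bar>q\<bar> \<le> \<bar>a\<bar> + \<bar>b\<bar>"
  proof -
    have "\<bar>b * x\<bar> \<le> \<bar>b\<bar> * 1"
      unfolding abs_mult using x by (intro mult_left_mono) auto
    then show ?thesis
      using abs_triangle_ineq[of a "b * x"] by (simp add: abq)
  qed
  have \<kappa>: "\<bar>\<kappa>\<bar> \<le> energy_const \<alpha> \<beta>"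
  proof -
    have "\<bar>D * (b\<^sup>2 / 4 - b / 2)\<bar> \<le> 1 * (b\<^sup>2 / 4 + \<bar>b\<bar> / 2)"
      unfolding abs_mult using D by (intro mult_mono) (auto intro: order_trans[OF abs_triangle_ineq4])
    moreover have "q\<^sup>2 \<le> (\<bar>a\<bar> + \<bar>b\<bar>)\<^sup>2"
      using power_mono[OF q, of 2] by simp
    moreover have "\<bar>x * q\<bar> \<le> 1 * (\<bar>a\<bar> + \<bar>b\<bar>)"
      unfolding abs_mult using x q by (intro mult_mono) auto
    moreover have "0 \<le> q\<^sup>2"
      by simp
    moreover have "\<bar>A + s / 4 - B / 2\<bar> \<le> A' + s' / 4 + B' / 2"
      if "\<bar>A\<bar> \<le> 1 * A'" "s \<le> s'" "\<bar>B\<bar> \<le> 1 * B'" "0 \<le> s" for A A' s s' B B' :: real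
      using that by linarith
    ultimately have "\<bar>\<kappa>\<bar> \<le> b\<^sup>2 / 4 + \<bar>b\<bar> / 2 + (\<bar>a\<bar> + \<bar>b\<bar>)\<^sup>2 / 4 + (\<bar>a\<bar> + \<bar>b\<bar>) / 2"
      unfolding \<kappa>_def by blast
    then show ?thesis
      unfolding energy_const_def abq(1,2) .
  qed
  have d: "(jacobi_energy \<alpha> \<beta> n y has_real_derivative W * (2 * h * y0 * \<kappa>) / (N\<^sup>2 * D\<^sup>2)) (at x)"
    using jacobi_energy_has_derivative[OF ode _ x] N
    unfolding W_def h_def y0_def \<kappa>_def D_def abq N_def by simp
  have hy: "2 * \<bar>h * y0\<bar> \<le> N * sqrt D * (y0\<^sup>2 + h\<^sup>2 / (N\<^sup>2 * D))"
  proof -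
    define m where "m = N * sqrt D"
    have m: "0 < m" "m\<^sup>2 = N\<^sup>2 * D"
      using N D by (auto simp: m_def power_mult_distrib)
    have "0 \<le> (m * \<bar>y0\<bar> - \<bar>h\<bar>)\<^sup>2"
      by simp
    then have "2 * \<bar>h * y0\<bar> * m \<le> m\<^sup>2 * y0\<^sup>2 + h\<^sup>2"
      by (simp add: power2_diff power_mult_distrib abs_mult algebra_simps)
    also have "\<dots> = m * (y0\<^sup>2 + h\<^sup>2 / m\<^sup>2) * m"
      using m(1) by (simp add: field_simps power2_eq_square)
    finally have "2 * \<bar>h * y0\<bar> \<le> m * (y0\<^sup>2 + h\<^sup>2 / m\<^sup>2)"
      by (rule mult_right_le_imp_le) (rule m(1))
    then show ?thesis
      unfolding m(2) by (simp add: m_def)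
  qed
  have "\<bar>W * (2 * h * y0 * \<kappa>) / (N\<^sup>2 * D\<^sup>2)\<bar> = W * \<bar>\<kappa>\<bar> * (2 * \<bar>h * y0\<bar>) / (N\<^sup>2 * D\<^sup>2)"
    using W by (simp add: abs_mult)
  also have "\<dots> \<le> W * energy_const \<alpha> \<beta> * (N * sqrt D * (y0\<^sup>2 + h\<^sup>2 / (N\<^sup>2 * D))) / (N\<^sup>2 * D\<^sup>2)"
    using W \<kappa> by (intro divide_right_mono mult_mono hy) auto
  also have "\<dots> = energy_const \<alpha> \<beta> * (N * sqrt D / (N\<^sup>2 * D\<^sup>2)) * jacobi_energy \<alpha> \<beta> n y x"
    unfolding E by (simp add: mult_ac)
  also have "N * sqrt D / (N\<^sup>2 * D\<^sup>2) = 1 / N * (1 / (D * sqrt D))"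
  proof -
    have "D = sqrt D * sqrt D" "sqrt D \<noteq> 0"
      using D by auto
    then show ?thesis
      using N D by (simp add: divide_simps power2_eq_square)
  qed
  finally show thesis
    using that[OF d] by (simp add: mult.assoc)
qed

text \<open>The function t / sqrt (1 - t^2) is a primitive of (1 - t^2)^(-3/2); a multiple \<psi> of
  it makes E exp(\<psi>) increasing and E exp(-\<psi>) decreasing. Away from the end points \<psi>
  is bounded by \<open>energy_const \<alpha> \<beta> / \<eta>\<close>, and this enters once for
  \<open>x\<close> and once for \<open>z\<close>.\<close>

lemma jacobi_energy_comparable:
  fixes \<alpha> \<beta> x z \<eta> :: real and n :: nat
  defines "N \<equiv> real n + (\<alpha> + \<beta> + 1) / 2"
  assumes ode: "jacobi_ode \<alpha> \<beta> n y" and N: "0 < N" and \<eta>: "0 < \<eta>"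
    and x: "\<bar>x\<bar> < 1" "\<eta> \<le> N * sqrt (1 - x\<^sup>2)" and z: "\<bar>z\<bar> < 1" "\<eta> \<le> N * sqrt (1 - z\<^sup>2)"
  shows "jacobi_energy \<alpha> \<beta> n y x \<le> exp (2 * energy_const \<alpha> \<beta> / \<eta>) * jacobi_energy \<alpha> \<beta> n y z"
proof -
  define E where "E = jacobi_energy \<alpha> \<beta> n y"
  define k where "k = energy_const \<alpha> \<beta> / N"
  define \<psi> where "\<psi> t = k * (t / sqrt (1 - t\<^sup>2))" for t :: real
  have E0: "0 \<le> E t" if "-1 < t" "t < 1" for t
    unfolding E_def using jacobi_energy_nonneg that .
  have d\<psi>: "(\<psi> has_real_derivative k * (1 / ((1 - t\<^sup>2) * sqrt (1 - t\<^sup>2)))) (at t)" if "-1 < t" "t < 1" for t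
  proof -
    have D: "0 < 1 - t\<^sup>2"
      using that by (simp add: abs_square_less_1)
    define s where "s = sqrt (1 - t\<^sup>2)"
    have s: "0 < s" "s\<^sup>2 = 1 - t\<^sup>2"
      using D by (auto simp: s_def)
    have "((\<lambda>t. t / sqrt (1 - t\<^sup>2)) has_real_derivative (1 * s - t * (- (2 * t) * (inverse s / 2))) / (s * s)) (at t)"
      unfolding s_def using D by (auto intro!: derivative_eq_intros)
    also have "(1 * s - t * (- (2 * t) * (inverse s / 2))) / (s * s) = (s\<^sup>2 + t\<^sup>2) / (s\<^sup>2 * s)"
      using s(1) by (simp add: field_simps power2_eq_square)
    finally show ?thesis
      unfolding \<psi>_def using s by (intro DERIV_cmult) (simp add: s_def)
  qed
  have mono: "E t * exp (\<psi> t) \<le> E t' * exp (\<psi> t')" if "t \<le> t'" "-1 < t" "t' < 1" for t t'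
  proof (rule DERIV_nonneg_imp_nondecreasing[OF that(1)])
    fix w assume w: "t \<le> w" "w \<le> t'"
    then have w': "-1 < w" "w < 1" using that by auto
    obtain e where e: "(E has_real_derivative e) (at w)" "\<bar>e\<bar> \<le> k * (1 / ((1 - w\<^sup>2) * sqrt (1 - w\<^sup>2))) * E w"
      using jacobi_energy_deriv_bound[OF ode N[unfolded N_def] w'] unfolding E_def k_def N_def by blast
    have "((\<lambda>t. E t * exp (\<psi> t)) has_real_derivative
        (e + k * (1 / ((1 - w\<^sup>2) * sqrt (1 - w\<^sup>2))) * E w) * exp (\<psi> w)) (at w)"
      by (rule derivative_eq_intros e(1) d\<psi>[OF w'] refl)+ (simp add: algebra_simps)
    moreover have "0 \<le> (e + k * (1 / ((1 - w\<^sup>2) * sqrt (1 - w\<^sup>2))) * E w) * exp (\<psi> w)"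
      using e(2) by (intro mult_nonneg_nonneg) auto
    ultimately show "\<exists>l. ((\<lambda>t. E t * exp (\<psi> t)) has_real_derivative l) (at w) \<and> 0 \<le> l"
      by blast
  qed
  have anti: "E t' * exp (- \<psi> t') \<le> E t * exp (- \<psi> t)" if "t \<le> t'" "-1 < t" "t' < 1" for t t'
  proof (rule DERIV_nonpos_imp_nonincreasing[OF that(1)])
    fix w assume w: "t \<le> w" "w \<le> t'"
    then have w': "-1 < w" "w < 1" using that by auto
    obtain e where e: "(E has_real_derivative e) (at w)" "\<bar>e\<bar> \<le> k * (1 / ((1 - w\<^sup>2) * sqrt (1 - w\<^sup>2))) * E w"
      using jacobi_energy_deriv_bound[OF ode N[unfolded N_def] w'] unfolding E_def k_def N_def by blast
    have "((\<lambda>t. E t * exp (- \<psi> t)) has_real_derivative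
        (e - k * (1 / ((1 - w\<^sup>2) * sqrt (1 - w\<^sup>2))) * E w) * exp (- \<psi> w)) (at w)"
      by (rule derivative_eq_intros e(1) d\<psi>[OF w'] refl)+ (simp add: algebra_simps)
    moreover have "(e - k * (1 / ((1 - w\<^sup>2) * sqrt (1 - w\<^sup>2))) * E w) * exp (- \<psi> w) \<le> 0"
      using e(2) by (intro mult_nonpos_nonneg) auto
    ultimately show "\<exists>l. ((\<lambda>t. E t * exp (- \<psi> t)) has_real_derivative l) (at w) \<and> l \<le> 0"
      by blast
  qed
  have \<psi>_bound: "\<bar>\<psi> t\<bar> \<le> energy_const \<alpha> \<beta> / \<eta>" if t: "\<bar>t\<bar> < 1" "\<eta> \<le> N * sqrt (1 - t\<^sup>2)" for t
  proof -
    have s: "0 < sqrt (1 - t\<^sup>2)"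
      using t by (simp add: abs_square_less_1)
    have "\<bar>\<psi> t\<bar> = energy_const \<alpha> \<beta> * \<bar>t\<bar> / (N * sqrt (1 - t\<^sup>2))"
      using N s energy_const_nonneg[of \<alpha> \<beta>] by (simp add: \<psi>_def k_def abs_mult)
    also have "\<dots> \<le> energy_const \<alpha> \<beta> * 1 / \<eta>"
      using t \<eta> energy_const_nonneg[of \<alpha> \<beta>] by (intro frac_le mult_left_mono mult_nonneg_nonneg) auto
    finally show ?thesis by simp
  qed
  have b: "\<psi> z - \<psi> x \<le> 2 * energy_const \<alpha> \<beta> / \<eta>" "\<psi> x - \<psi> z \<le> 2 * energy_const \<alpha> \<beta> / \<eta>"
    using \<psi>_bound[OF x] \<psi>_bound[OF z] by (auto simp: abs_le_iff)
  have Ez: "0 \<le> E z"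
    using z by (intro E0) auto
  have "E x \<le> exp (2 * energy_const \<alpha> \<beta> / \<eta>) * E z"
  proof (cases "x \<le> z")
    case True
    have "E x \<le> E z * exp (\<psi> z) / exp (\<psi> x)"
      using mono[OF True] x z by (simp add: le_divide_eq)
    also have "\<dots> = exp (\<psi> z - \<psi> x) * E z"
      by (simp add: exp_diff)
    also have "\<dots> \<le> exp (2 * energy_const \<alpha> \<beta> / \<eta>) * E z"
      using b Ez by (intro mult_right_mono) auto
    finally show ?thesis .
  next
    case False
    have "E x \<le> E z * exp (- \<psi> z) / exp (- \<psi> x)"
      using anti[of z x] False x z by (simp add: le_divide_eq)
    also have "\<dots> = exp (\<psi> x - \<psi> z) * E z"
      by (simp add: exp_diff exp_minus field_simps)
    also have "\<dots> \<le> exp (2 * energy_const \<alpha> \<beta> / \<eta>) * E z"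
      using b Ez by (intro mult_right_mono) auto
    finally show ?thesis .
  qed
  then show ?thesis
    by (simp add: E_def)
qed

text \<open>At a root the energy reduces to the derivative term, so comparing energies bounds y and
  h at \<open>x\<close> by y' at \<open>z\<close>. To return from h to y', the part with y^2 / D is
  absorbed by 1 / D \<le> n^2 / c.\<close>

lemma jacobi_bulk_bound:
  fixes \<alpha> \<beta> c :: real
  assumes ab: "\<alpha> > -1" "\<beta> > -1" and c: "0 < c" "c \<le> 1"
  obtains K where "0 < K"
    "\<And>n y x z. 0 < n \<Longrightarrow> jacobi_ode \<alpha> \<beta> n y \<Longrightarrow> c / (real n)\<^sup>2 \<le> 1 - \<bar>x\<bar> \<Longrightarrow> c / (real n)\<^sup>2 \<le> 1 - \<bar>z\<bar>
      \<Longrightarrow> poly y z = 0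
      \<Longrightarrow> liouville_weight \<alpha> \<beta> x * (poly y x)\<^sup>2
          \<le> K * (liouville_weight \<alpha> \<beta> z * (1 - z\<^sup>2) * (poly (pderiv y) z)\<^sup>2) / (real n)\<^sup>2
        \<and> liouville_weight \<alpha> \<beta> x * (1 - x\<^sup>2) * (poly (pderiv y) x)\<^sup>2
          \<le> K * (liouville_weight \<alpha> \<beta> z * (1 - z\<^sup>2) * (poly (pderiv y) z)\<^sup>2)"
proof -
  define a b where "a = \<alpha> - \<beta>" "b = \<alpha> + \<beta> + 1"
  note abd = this
  define K0 where "K0 = exp (2 * energy_const \<alpha> \<beta> / (sqrt c / 2))"
  define Q where "Q = \<bar>a\<bar> + \<bar>b\<bar>"
  define M where "M = 1 + \<bar>b\<bar> / 2"
  \<comment> \<open>The 4 stems from N \<ge> n / 2; \<open>M\<close> satisfies N \<le> M n, and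
    \<open>Q\<close> bounds |a + b x|. The first summand serves the bound on y, the other one the
    bound on y'.\<close>
  define K where "K = K0 * (4 + (2 * M\<^sup>2 + Q\<^sup>2 / (2 * c)) * 4)"
  have K0: "0 < K0"
    by (simp add: K0_def)
  show thesis
  proof
    show "0 < K"
      unfolding K_def using K0 c by (intro mult_pos_pos add_pos_nonneg) auto
    fix n y and x z :: real
    assume n: "0 < n" and ode: "jacobi_ode \<alpha> \<beta> n y"
      and x: "c / (real n)\<^sup>2 \<le> 1 - \<bar>x\<bar>" and z: "c / (real n)\<^sup>2 \<le> 1 - \<bar>z\<bar>" and yz: "poly y z = 0"
    define N where "N = real n + b / 2"
    have n1: "1 \<le> real n"
      using n by simp
    have N: "real n / 2 \<le> N" "N \<le> M * real n"
    proof -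
      show "real n / 2 \<le> N"
        using ab n1 by (simp add: N_def abd add_divide_distrib)
      have "b / 2 * 1 \<le> \<bar>b\<bar> / 2 * real n"
        using n1 by (intro mult_mono) auto
      then show "N \<le> M * real n"
        by (simp add: N_def M_def algebra_simps)
    qed
    then have N0: "0 < N"
      using n1 by linarith
    have bulk: "\<bar>t\<bar> < 1" "c / (real n)\<^sup>2 \<le> 1 - t\<^sup>2" "sqrt c / 2 \<le> N * sqrt (1 - t\<^sup>2)"
      if t: "c / (real n)\<^sup>2 \<le> 1 - \<bar>t\<bar>" for t
    proof -
      have "0 < c / (real n)\<^sup>2"
        using c n1 by simp
      then show t1: "\<bar>t\<bar> < 1"
        using t by linarith
      have "\<bar>t\<bar> * \<bar>t\<bar> \<le> 1 * \<bar>t\<bar>"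
        using t1 by (intro mult_right_mono) auto
      then have "t\<^sup>2 \<le> \<bar>t\<bar>"
        by (simp add: power2_eq_square)
      then show D: "c / (real n)\<^sup>2 \<le> 1 - t\<^sup>2"
        using t by linarith
      have "sqrt c / real n = sqrt (c / (real n)\<^sup>2)"
        using n1 by (simp add: real_sqrt_divide)
      also have "\<dots> \<le> sqrt (1 - t\<^sup>2)"
        using D by simp
      finally have "real n / 2 * (sqrt c / real n) \<le> N * sqrt (1 - t\<^sup>2)"
        using N N0 c by (intro mult_mono) auto
      then show "sqrt c / 2 \<le> N * sqrt (1 - t\<^sup>2)"
        using n1 by simp
    qed
    define W where "W = liouville_weight \<alpha> \<beta>"
    define D where "D = 1 - x\<^sup>2"
    define Gz where "Gz = W z * (1 - z\<^sup>2) * (poly (pderiv y) z)\<^sup>2"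
    define h where "h = D * poly (pderiv y) x - (a + b * x) * poly y x / 2"
    define E where "E = W x * ((poly y x)\<^sup>2 + h\<^sup>2 / (N\<^sup>2 * D))"
    have Dpos: "0 < D" "c / (real n)\<^sup>2 \<le> D"
      using bulk[OF x] by (auto simp: D_def abs_square_less_1)
    have Wx: "0 \<le> W x" and Gz: "0 \<le> Gz"
      using bulk(1)[OF z] by (auto simp: W_def liouville_weight_def Gz_def abs_square_le_1)
    have "jacobi_energy \<alpha> \<beta> n y x \<le> K0 * jacobi_energy \<alpha> \<beta> n y z"
      unfolding K0_def
      by (rule jacobi_energy_comparable[OF ode])
         (use bulk[OF x] bulk[OF z] N0 c in \<open>auto simp: N_def abd\<close>)
    moreover have "jacobi_energy \<alpha> \<beta> n y x = E"
      by (simp add: jacobi_energy_def E_def W_def h_def D_def N_def abd)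
    moreover have "jacobi_energy \<alpha> \<beta> n y z = Gz / N\<^sup>2"
    proof -
      have "1 - z\<^sup>2 \<noteq> 0"
        using bulk(1)[OF z] by (simp add: abs_square_eq_1)
      then show ?thesis
        by (simp add: jacobi_energy_def yz Gz_def W_def N_def abd power2_eq_square)
    qed
    ultimately have EG: "E \<le> K0 * Gz / N\<^sup>2"
      by simp
    have iN: "1 / N\<^sup>2 \<le> 4 / (real n)\<^sup>2"
    proof -
      have "(real n / 2)\<^sup>2 \<le> N\<^sup>2"
        using N n1 by (intro power_mono) auto
      then show ?thesis
        using n1 N0 by (simp add: power_divide divide_simps)
    qed
    have E4: "E \<le> 4 * K0 * Gz / (real n)\<^sup>2"
    proof -
      have "K0 * Gz * (1 / N\<^sup>2) \<le> K0 * Gz * (4 / (real n)\<^sup>2)"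
        using K0 Gz iN by (intro mult_left_mono) auto
      then show ?thesis
        using EG by (simp add: mult_ac)
    qed
    have E1: "W x * (poly y x)\<^sup>2 \<le> E" and E2: "W x * (h\<^sup>2 / (N\<^sup>2 * D)) \<le> E"
      using Wx Dpos by (auto simp: E_def distrib_left)
    have E0: "0 \<le> E"
      using E1 Wx by (meson mult_nonneg_nonneg order_trans zero_le_power2)
    have K4: "4 * K0 \<le> K"
      using K0 c by (simp add: K_def algebra_simps)
    have r1: "W x * (poly y x)\<^sup>2 \<le> K * Gz / (real n)\<^sup>2"
    proof -
      have "4 * K0 * Gz / (real n)\<^sup>2 \<le> K * Gz / (real n)\<^sup>2"
        using K4 Gz by (intro divide_right_mono mult_right_mono) auto
      then show ?thesis
        using E1 E4 by linarith
    qed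
    have q: "(a + b * x)\<^sup>2 \<le> Q\<^sup>2"
    proof -
      have "\<bar>b * x\<bar> \<le> \<bar>b\<bar> * 1"
        unfolding abs_mult using bulk(1)[OF x] by (intro mult_left_mono) auto
      then have "\<bar>a + b * x\<bar> \<le> Q"
        using abs_triangle_ineq[of a "b * x"] by (simp add: Q_def)
      from power_mono[OF this, of 2] show ?thesis
        by simp
    qed
    have "(D * poly (pderiv y) x)\<^sup>2 = (h + (a + b * x) * poly y x / 2)\<^sup>2"
      by (simp add: h_def)
    also have "\<dots> \<le> 2 * h\<^sup>2 + (a + b * x)\<^sup>2 * (poly y x)\<^sup>2 / 2"
    proof -
      have "0 \<le> (h - (a + b * x) * poly y x / 2)\<^sup>2"
        by simp
      then show ?thesis
        by (simp add: power2_eq_square field_simps)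
    qed
    also have "\<dots> \<le> 2 * h\<^sup>2 + Q\<^sup>2 * (poly y x)\<^sup>2 / 2"
      using q by (simp add: mult_right_mono)
    finally have "W x / D * (D * poly (pderiv y) x)\<^sup>2 \<le> W x / D * (2 * h\<^sup>2 + Q\<^sup>2 * (poly y x)\<^sup>2 / 2)"
      using Wx Dpos by (intro mult_left_mono) auto
    moreover have "W x / D * (D * poly (pderiv y) x)\<^sup>2 = W x * D * (poly (pderiv y) x)\<^sup>2"
      using Dpos by (simp add: power2_eq_square)
    moreover have "W x / D * (2 * h\<^sup>2 + Q\<^sup>2 * (poly y x)\<^sup>2 / 2)
        = 2 * N\<^sup>2 * (W x * (h\<^sup>2 / (N\<^sup>2 * D))) + Q\<^sup>2 / 2 * (1 / D) * (W x * (poly y x)\<^sup>2)"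
      using Dpos N0 by (simp add: field_simps)
    ultimately have "W x * D * (poly (pderiv y) x)\<^sup>2
        \<le> 2 * N\<^sup>2 * (W x * (h\<^sup>2 / (N\<^sup>2 * D))) + Q\<^sup>2 / 2 * (1 / D) * (W x * (poly y x)\<^sup>2)"
      by simp
    also have "\<dots> \<le> 2 * (M * real n)\<^sup>2 * E + Q\<^sup>2 / 2 * ((real n)\<^sup>2 / c) * E"
    proof (intro add_mono mult_mono E1 E2)
      show "1 / D \<le> (real n)\<^sup>2 / c"
        using Dpos c n1 by (simp add: divide_simps mult.commute)
    qed (use N N0 E0 Wx Dpos c in auto)
    also have "\<dots> = (2 * M\<^sup>2 + Q\<^sup>2 / (2 * c)) * (real n)\<^sup>2 * E"
      by (simp add: power_mult_distrib algebra_simps)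
    also have "\<dots> \<le> (2 * M\<^sup>2 + Q\<^sup>2 / (2 * c)) * (real n)\<^sup>2 * (4 * K0 * Gz / (real n)\<^sup>2)"
      using c by (intro mult_left_mono E4) auto
    also have "\<dots> = K0 * ((2 * M\<^sup>2 + Q\<^sup>2 / (2 * c)) * 4) * Gz"
      using n1 by (simp add: mult_ac)
    also have "\<dots> \<le> K * Gz"
      using K0 Gz by (intro mult_right_mono) (auto simp: K_def distrib_left)
    finally have r2: "W x * D * (poly (pderiv y) x)\<^sup>2 \<le> K * Gz" .
    show "liouville_weight \<alpha> \<beta> x * (poly y x)\<^sup>2
          \<le> K * (liouville_weight \<alpha> \<beta> z * (1 - z\<^sup>2) * (poly (pderiv y) z)\<^sup>2) / (real n)\<^sup>2
        \<and> liouville_weight \<alpha> \<beta> x * (1 - x\<^sup>2) * (poly (pderiv y) x)\<^sup>2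
          \<le> K * (liouville_weight \<alpha> \<beta> z * (1 - z\<^sup>2) * (poly (pderiv y) z)\<^sup>2)"
      using r1 r2 by (simp add: W_def D_def Gz_def)
  qed
qed

section \<open>The fundamental Lagrange polynomials at the Jacobi nodes\<close>

text \<open>Where \<open>\<bar>y'\<bar>\<close> is maximal on \<open>[1 - c / n\<^sup>2, 1]\<close>, the term \<open>(1 - x\<^sup>2) y''\<close> of the equation is zero or has the sign
  opposite to \<open>y'\<close> (even if the maximum is at an end point), so that \<open>\<bar>y'\<bar> = O(n\<^sup>2) max \<bar>y\<bar>\<close>.\<close>
lemma jacobi_ode_right_end:
  fixes \<alpha> \<beta> :: real
  assumes ab: "\<alpha> > -1" "\<beta> > -1"
  obtains c0 where "0 < c0"
    "\<And>c n y t t'. c \<le> c0 \<Longrightarrow> 0 < c \<Longrightarrow> 0 < n \<Longrightarrow> jacobi_ode \<alpha> \<beta> n y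
      \<Longrightarrow> t \<in> {1 - c / (real n)\<^sup>2..1} \<Longrightarrow> t' \<in> {1 - c / (real n)\<^sup>2..1}
      \<Longrightarrow> poly y t \<noteq> 0 \<and> \<bar>poly y t\<bar> \<le> 2 * \<bar>poly y t'\<bar>"
proof -
  define b where "b = \<alpha> + \<beta> + 1"
  \<comment> \<open>The three bounds keep the strip in [0, 1], the coefficient of y' at least
    \<alpha> + 1 there (it is 2 \<alpha> + 2 at 1), and the variation of y over the strip below half
    of its maximum.\<close>
  define c0 where "c0 = min 1 (min ((\<alpha> + 1) / (\<bar>b + 1\<bar> + 1)) ((\<alpha> + 1) / (2 * (1 + \<bar>b\<bar>))))"
  have c0: "0 < c0"
    using ab by (simp add: c0_def)
  have c01: "c0 \<le> 1" "\<bar>b + 1\<bar> * c0 \<le> \<alpha> + 1" "c0 * (1 + \<bar>b\<bar>) \<le> (\<alpha> + 1) / 2"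
  proof -
    show "c0 \<le> 1" by (simp add: c0_def)
    have "c0 \<le> (\<alpha> + 1) / (\<bar>b + 1\<bar> + 1)"
      by (simp add: c0_def)
    then have "c0 * (\<bar>b + 1\<bar> + 1) \<le> \<alpha> + 1"
      by (simp add: le_divide_eq)
    then show "\<bar>b + 1\<bar> * c0 \<le> \<alpha> + 1"
      using c0 by (simp add: algebra_simps)
    have "c0 \<le> (\<alpha> + 1) / (2 * (1 + \<bar>b\<bar>))"
      by (simp add: c0_def)
    then have "c0 * (2 * (1 + \<bar>b\<bar>)) \<le> \<alpha> + 1"
      by (subst (asm) le_divide_eq) (auto simp: add_pos_nonneg)
    then show "c0 * (1 + \<bar>b\<bar>) \<le> (\<alpha> + 1) / 2"
      by (simp add: algebra_simps)
  qed
  show thesis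
  proof
    show "0 < c0" by (rule c0)
    fix c n y and t t' :: real
    assume c: "c \<le> c0" "0 < c" and n: "0 < n" and ode: "jacobi_ode \<alpha> \<beta> n y"
      and t: "t \<in> {1 - c / (real n)\<^sup>2..1}" and t': "t' \<in> {1 - c / (real n)\<^sup>2..1}"
    define d where "d = c / (real n)\<^sup>2"
    define x0 where "x0 = 1 - d"
    define \<mu> where "\<mu> = real n * (real n + b)"
    have n1: "1 \<le> real n" "1 \<le> (real n)\<^sup>2"
      using n by auto
    have d: "0 < d" "d \<le> c"
    proof -
      show "0 < d" using c n1 by (simp add: d_def)
      have "c / (real n)\<^sup>2 \<le> c / 1"
        using c n1 by (intro divide_left_mono) auto
      then show "d \<le> c" by (simp add: d_def)
    qed
    have "0 \<le> real n + b"
      using n1 ab by (simp add: b_def)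
    then have \<mu>0: "0 \<le> \<mu>"
      by (simp add: \<mu>_def)
    have "\<mu> \<le> (1 + \<bar>b\<bar>) * (real n)\<^sup>2"
    proof -
      have "real n * b \<le> (real n)\<^sup>2 * \<bar>b\<bar>"
        using mult_left_mono[of b "\<bar>b\<bar>" "real n"] mult_right_mono[of "real n" "(real n)\<^sup>2" "\<bar>b\<bar>"] n1
        by (simp add: power2_eq_square)
      then show ?thesis
        by (simp add: \<mu>_def power2_eq_square algebra_simps)
    qed
    then have "\<mu> * d \<le> (1 + \<bar>b\<bar>) * (real n)\<^sup>2 * d"
      using d by (intro mult_right_mono) auto
    also have "\<dots> = c * (1 + \<bar>b\<bar>)"
      using n1 by (simp add: d_def)
    also have "\<dots> \<le> c0 * (1 + \<bar>b\<bar>)"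
      using c by (intro mult_right_mono) auto
    also have "\<dots> \<le> (\<alpha> + 1) / 2"
      by (rule c01)
    finally have \<mu>d: "\<mu> * d \<le> (\<alpha> + 1) / 2" .
    have x0: "x0 < 1" "0 \<le> x0"
      using d c c01 by (auto simp: x0_def)
    have cont: "continuous_on {x0..1} (\<lambda>x. \<bar>poly p x\<bar>)" for p :: "real poly"
      by (intro continuous_intros)
    obtain w where w: "w \<in> {x0..1}" "\<And>x. x \<in> {x0..1} \<Longrightarrow> \<bar>poly y x\<bar> \<le> \<bar>poly y w\<bar>"
      using continuous_attains_sup[OF compact_Icc _ cont[of y]] x0 by auto
    obtain z where z: "z \<in> {x0..1}" "\<And>x. x \<in> {x0..1} \<Longrightarrow> \<bar>poly (pderiv y) x\<bar> \<le> \<bar>poly (pderiv y) z\<bar>"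
      using continuous_attains_sup[OF compact_Icc _ cont[of "pderiv y"]] x0 by auto
    define M where "M = \<bar>poly y w\<bar>"
    have M: "0 < M"
    proof (rule ccontr)
      assume "\<not> 0 < M"
      then have "{x0..1} \<subseteq> {x. poly y x = 0}"
        using w(2) by (force simp: M_def)
      moreover have "infinite {x0..1}"
        using x0 by (simp add: infinite_Icc)
      ultimately have "infinite {x. poly y x = 0}"
        using finite_subset by blast
      then show False
        using poly_roots_finite ode by (auto simp: jacobi_ode_def)
    qed
    define P1 P2 where "P1 = poly (pderiv y) z" "P2 = poly (pderiv (pderiv y)) z"
    note P_defs = this
    define s where "s = sgn P1"
    have sP: "s * P1 = \<bar>P1\<bar>"
      by (simp add: s_def sgn_mult_abs abs_sgn mult.commute)
    have second: "s * ((1 - z\<^sup>2) * P2) \<le> 0"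
    proof (cases "z = 1")
      case False
      then have z1: "z < 1" "0 \<le> z" using z(1) x0 by auto
      have "s * P2 \<le> 0"
      proof (rule ccontr)
        \<comment> \<open>Only points to the right of \<open>z\<close> are used for the
          contradiction, so a maximum at the left end of the strip is covered.\<close>
        assume "\<not> s * P2 \<le> 0"
        then have pos: "0 < s * P2" by simp
        have "((\<lambda>x. s * poly (pderiv y) x) has_real_derivative s * P2) (at z)"
          unfolding P_defs by (intro DERIV_cmult poly_DERIV)
        then obtain e where e: "0 < e" "\<And>h. 0 < h \<Longrightarrow> h < e \<Longrightarrow> s * P1 < s * poly (pderiv y) (z + h)"
          using DERIV_pos_inc_right[OF _ pos] unfolding P_defs by blast
        define h where "h = min (e / 2) (1 - z)"
        have h: "0 < h" "h < e" "z + h \<le> 1"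
          using e(1) z1 by (auto simp: h_def)
        have "\<bar>P1\<bar> < s * poly (pderiv y) (z + h)"
          using e(2)[OF h(1,2)] by (simp add: sP)
        also have "\<dots> \<le> \<bar>s\<bar> * \<bar>poly (pderiv y) (z + h)\<bar>"
          by (metis abs_ge_self abs_mult)
        also have "\<dots> \<le> 1 * \<bar>P1\<bar>"
          unfolding P_defs by (intro mult_mono z(2)) (use h z(1) in \<open>auto simp: s_def abs_sgn_eq\<close>)
        finally show False by simp
      qed
      moreover have "0 \<le> 1 - z\<^sup>2"
        using z1 by (simp add: abs_square_le_1)
      ultimately show ?thesis
        by (metis mult.left_commute mult_nonneg_nonpos)
    qed simp
    have eq: "(1 - z\<^sup>2) * P2 = (\<alpha> - \<beta> + (b + 1) * z) * P1 - \<mu> * poly y z"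
      using ode unfolding jacobi_ode_def P_defs \<mu>_def b_def by (simp add: algebra_simps)
    have "(\<alpha> - \<beta> + (b + 1) * z) * \<bar>P1\<bar> = s * ((1 - z\<^sup>2) * P2) + \<mu> * (s * poly y z)"
      unfolding eq sP[symmetric] by (simp add: algebra_simps)
    also have "\<dots> \<le> 0 + \<mu> * M"
    proof (intro add_mono second mult_left_mono \<mu>0)
      have "s * poly y z \<le> \<bar>s\<bar> * \<bar>poly y z\<bar>"
        by (metis abs_ge_self abs_mult)
      also have "\<dots> \<le> 1 * M"
        unfolding M_def by (intro mult_mono w(2) z(1)) (auto simp: s_def abs_sgn_eq)
      finally show "s * poly y z \<le> M" by simp
    qed
    finally have le1: "(\<alpha> - \<beta> + (b + 1) * z) * \<bar>P1\<bar> \<le> \<mu> * M" by simp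
    have "\<alpha> + 1 \<le> \<alpha> - \<beta> + (b + 1) * z"
    proof -
      have "(b + 1) * (1 - z) \<le> \<bar>b + 1\<bar> * c0"
        using z(1) d c by (intro mult_mono) (auto simp: x0_def)
      then have "(b + 1) * (1 - z) \<le> \<alpha> + 1"
        using c01(2) by linarith
      then show ?thesis
        by (simp add: b_def algebra_simps)
    qed
    then have "(\<alpha> + 1) * \<bar>P1\<bar> \<le> (\<alpha> - \<beta> + (b + 1) * z) * \<bar>P1\<bar>"
      by (intro mult_right_mono) auto
    then have P1: "(\<alpha> + 1) * \<bar>P1\<bar> \<le> \<mu> * M"
      using le1 by linarith
    have near: "\<bar>poly y x - poly y w\<bar> \<le> M / 2" if x: "x \<in> {x0..1}" for x
    proof -
      have "norm (poly y x - poly y w) \<le> \<bar>P1\<bar> * norm (x - w)"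
      proof (rule field_differentiable_bound[of "{x0..1}" "poly y" "poly (pderiv y)"])
        show "(poly y has_real_derivative poly (pderiv y) v) (at v within {x0..1})" for v
          by (rule has_field_derivative_at_within[OF poly_DERIV])
        show "norm (poly (pderiv y) v) \<le> \<bar>P1\<bar>" if "v \<in> {x0..1}" for v
          using z(2)[OF that] by (simp add: P_defs)
      qed (use x w in auto)
      also have "\<dots> \<le> \<bar>P1\<bar> * d"
        using x w(1) by (intro mult_left_mono) (auto simp: x0_def)
      finally have "(\<alpha> + 1) * \<bar>poly y x - poly y w\<bar> \<le> (\<alpha> + 1) * (\<bar>P1\<bar> * d)"
        using ab by (intro mult_left_mono) auto
      also have "\<dots> = (\<alpha> + 1) * \<bar>P1\<bar> * d"
        by simp
      also have "\<dots> \<le> \<mu> * M * d"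
        using P1 d by (intro mult_right_mono) auto
      also have "\<dots> = \<mu> * d * M"
        by simp
      also have "\<dots> \<le> (\<alpha> + 1) / 2 * M"
        using \<mu>d M by (intro mult_right_mono) auto
      also have "\<dots> = (\<alpha> + 1) * (M / 2)"
        by simp
      finally show ?thesis
        using ab by (simp only: mult_le_cancel_left_pos)
    qed
    have tx: "t \<in> {x0..1}" "t' \<in> {x0..1}"
      using t t' by (auto simp: x0_def d_def)
    have "M / 2 \<le> \<bar>poly y t\<bar>" "M / 2 \<le> \<bar>poly y t'\<bar>" "\<bar>poly y t\<bar> \<le> M"
      using near[OF tx(1)] near[OF tx(2)] w(2)[OF tx(1)] unfolding M_def by linarith+
    then show "poly y t \<noteq> 0 \<and> \<bar>poly y t\<bar> \<le> 2 * \<bar>poly y t'\<bar>"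
      using M by auto
  qed
qed

text \<open>In the application A = 1 - z and B = 1 - x: the quotient of the Liouville weights at the
  root and at the point, divided by n^2, must be controlled by (x - z)^2. The separation condition
  makes |A - B| comparable to the larger of both. The power of n comes from B^(-\<alpha> - 1/2) /
  n^2 at B = c / n^2, that is n^(2 \<alpha> - 1).\<close>

lemma jacobi_ratio_bound:
  fixes \<alpha> c :: real
  assumes a: "\<alpha> > -1" and c: "0 < c" "c \<le> 1"
  obtains C where "0 < C"
    "\<And>n A B. 0 < n \<Longrightarrow> c / (real n)\<^sup>2 \<le> A \<Longrightarrow> A \<le> 2 \<Longrightarrow> c / (real n)\<^sup>2 \<le> B \<Longrightarrow> B \<le> 1
      \<Longrightarrow> 3 / 2 \<le> A \<or> 2 * A \<le> B \<or> 2 * B \<le> A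
      \<Longrightarrow> A powr (\<alpha> + 3/2) * B powr (- \<alpha> - 1/2) / (real n)\<^sup>2
        \<le> C * (real n powr max 0 (\<alpha> - 1/2))\<^sup>2 * (A - B)\<^sup>2"
proof -
  define C0 where "C0 = c powr (- \<alpha> - 1/2) + 1"
  define P where "P = 2 powr (\<alpha> + 3/2)"
  define C where "C = 4 * P * C0 + 4 / c"
  have pos: "0 < C0" "0 < P" "0 < C"
    using c by (auto simp: C0_def P_def C_def add_pos_pos)
  show thesis
  proof
    show "0 < C" by (rule pos)
    fix n and A B :: real
    assume n: "0 < n" and A: "c / (real n)\<^sup>2 \<le> A" "A \<le> 2" and B: "c / (real n)\<^sup>2 \<le> B" "B \<le> 1"
      and sep: "3 / 2 \<le> A \<or> 2 * A \<le> B \<or> 2 * B \<le> A"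
    define m where "m = (real n powr max 0 (\<alpha> - 1/2))\<^sup>2"
    have n1: "1 \<le> real n" using n by simp
    have cn: "0 < c / (real n)\<^sup>2" using c n1 by simp
    then have A0: "0 < A" and B0: "0 < B" using A B by linarith+
    have "1 \<le> real n powr max 0 (\<alpha> - 1/2)"
      using n1 by (intro ge_one_powr_ge_zero) auto
    then have m1: "1 \<le> m"
      unfolding m_def by simp
    have G: "B powr (- \<alpha> - 1/2) / (real n)\<^sup>2 \<le> C0 * m"
    proof (cases "\<alpha> \<ge> -1/2")
      case True
      have "B powr (- \<alpha> - 1/2) \<le> (c / (real n)\<^sup>2) powr (- \<alpha> - 1/2)"
        using True B cn by (intro powr_mono2') auto
      also have "\<dots> = c powr (- \<alpha> - 1/2) * real n powr (2 * \<alpha> + 1)"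
      proof -
        have "(real n)\<^sup>2 = real n powr 2"
          using n1 by simp
        then have "((real n)\<^sup>2) powr (- \<alpha> - 1/2) = real n powr (2 * (- \<alpha> - 1/2))"
          by (simp only: powr_powr)
        also have "\<dots> = 1 / real n powr (2 * \<alpha> + 1)"
        proof -
          have "2 * (- \<alpha> - 1/2) = - (2 * \<alpha> + 1)"
            by simp
          then show ?thesis
            by (simp only: powr_minus_divide)
        qed
        finally show ?thesis
          using c by (simp add: powr_divide)
      qed
      finally have "B powr (- \<alpha> - 1/2) / (real n)\<^sup>2 \<le> c powr (- \<alpha> - 1/2) * real n powr (2 * \<alpha> + 1) / (real n)\<^sup>2"
        by (rule divide_right_mono) simp
      also have "\<dots> = c powr (- \<alpha> - 1/2) * real n powr (2 * (\<alpha> - 1/2))"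
      proof -
        have "real n powr (2 * \<alpha> + 1) = real n powr (2 * (\<alpha> - 1/2)) * (real n)\<^sup>2"
        proof -
          have "2 * \<alpha> + 1 = 2 * (\<alpha> - 1/2) + 2"
            by simp
          then show ?thesis
            using n1 by (simp only: powr_add powr_numeral)
        qed
        then show ?thesis
          using n1 by simp
      qed
      also have "\<dots> \<le> C0 * m"
      proof (intro mult_mono)
        have "real n powr (2 * (\<alpha> - 1/2)) \<le> real n powr (2 * max 0 (\<alpha> - 1/2))"
          using n1 by (intro powr_mono) (auto simp: max_def)
        also have "\<dots> = m"
          unfolding m_def by (simp add: power2_eq_square powr_add[symmetric])
        finally show "real n powr (2 * (\<alpha> - 1/2)) \<le> m" .
      qed (use m1 pos in \<open>auto simp: C0_def\<close>)
      finally show ?thesis .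
    next
      case False
      have "B powr (- \<alpha> - 1/2) \<le> 1 powr (- \<alpha> - 1/2)"
        using False B B0 by (intro powr_mono2) auto
      then have "B powr (- \<alpha> - 1/2) / (real n)\<^sup>2 \<le> 1 / 1"
        using n1 by (intro frac_le) auto
      also have "\<dots> \<le> C0 * m"
        using mult_mono[of 1 C0 1 m] m1 by (simp add: C0_def)
      finally show ?thesis .
    qed
    have Ap: "A powr (\<alpha> + 3/2) = A powr (\<alpha> - 1/2) * A\<^sup>2"
    proof -
      have "\<alpha> + 3/2 = (\<alpha> - 1/2) + 2"
        by simp
      then show ?thesis
        using A0 by (simp only: powr_add powr_numeral)
    qed
    have ic: "1 / (real n)\<^sup>2 \<le> B / c"
      using B c n1 by (simp add: field_simps)
    have C1: "4 * P * C0 \<le> C" and C2: "4 / c \<le> C"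
      using c pos by (auto simp: C_def)
    have fin1: "4 * P * C0 * m * (A - B)\<^sup>2 \<le> C * m * (A - B)\<^sup>2"
      using C1 m1 by (intro mult_right_mono) auto
    have fin2: "4 / c * (A - B)\<^sup>2 \<le> C * m * (A - B)\<^sup>2"
      using C2 m1 c pos mult_mono[of "4 / c" C 1 m] by (intro mult_right_mono) auto
    consider "3 / 2 \<le> A" | "2 * A \<le> B" | "A < 3 / 2" "2 * B \<le> A" "1 / 2 \<le> \<alpha>" | "2 * B \<le> A" "\<alpha> < 1 / 2"
      using sep by linarith
    then have "A powr (\<alpha> + 3/2) * B powr (- \<alpha> - 1/2) / (real n)\<^sup>2 \<le> C * m * (A - B)\<^sup>2"
    proof cases
      case 1
      have "A powr (\<alpha> + 3/2) \<le> P"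
        unfolding P_def using A A0 a by (intro powr_mono2) auto
      then have "A powr (\<alpha> + 3/2) * (B powr (- \<alpha> - 1/2) / (real n)\<^sup>2) \<le> P * (C0 * m)"
        using pos by (intro mult_mono G) auto
      also have "\<dots> \<le> P * (C0 * m) * (4 * (A - B)\<^sup>2)"
      proof -
        have "(1 / 2)\<^sup>2 \<le> (A - B)\<^sup>2"
          using 1 B by (intro power_mono) auto
        then have "1 \<le> 4 * (A - B)\<^sup>2"
          by (simp add: power2_eq_square)
        then show ?thesis
          using pos m1 mult_left_mono[of 1 "4 * (A - B)\<^sup>2" "P * (C0 * m)"] by simp
      qed
      finally show ?thesis
        using fin1 by (simp add: mult_ac)
    next
      case 2
      have "(B / 2)\<^sup>2 \<le> (B - A)\<^sup>2"
        using 2 B0 by (intro power_mono) auto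
      then have B2: "B\<^sup>2 \<le> 4 * (A - B)\<^sup>2"
        by (simp add: power_divide power2_commute)
      have "A powr (\<alpha> + 3/2) * B powr (- \<alpha> - 1/2) \<le> B powr (\<alpha> + 3/2) * B powr (- \<alpha> - 1/2)"
        using 2 A0 a by (intro mult_right_mono powr_mono2) auto
      also have "\<dots> = B"
        using B0 by (simp add: powr_add[symmetric])
      finally have "A powr (\<alpha> + 3/2) * B powr (- \<alpha> - 1/2) * (1 / (real n)\<^sup>2) \<le> B * (B / c)"
        using ic B0 by (intro mult_mono) auto
      also have "\<dots> = B\<^sup>2 / c"
        by (simp add: power2_eq_square)
      also have "\<dots> \<le> 4 * (A - B)\<^sup>2 / c"
        using B2 c by (intro divide_right_mono) auto
      finally show ?thesis
        using fin2 by simp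
    next
      case 3
      have "(A / 2)\<^sup>2 \<le> (A - B)\<^sup>2"
        using 3 A0 by (intro power_mono) auto
      then have A2: "A\<^sup>2 \<le> 4 * (A - B)\<^sup>2"
        by (simp add: power_divide)
      have "A powr (\<alpha> + 3/2) \<le> P * (4 * (A - B)\<^sup>2)"
        unfolding Ap
      proof (intro mult_mono A2)
        have "A powr (\<alpha> - 1/2) \<le> 2 powr (\<alpha> - 1/2)"
          using A A0 3 by (intro powr_mono2) auto
        also have "\<dots> \<le> P"
          unfolding P_def by (intro powr_mono) auto
        finally show "A powr (\<alpha> - 1/2) \<le> P" .
      qed (use pos in auto)
      then have "A powr (\<alpha> + 3/2) * (B powr (- \<alpha> - 1/2) / (real n)\<^sup>2) \<le> P * (4 * (A - B)\<^sup>2) * (C0 * m)"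
        using pos by (intro mult_mono G) auto
      then show ?thesis
        using fin1 by (simp add: mult_ac)
    next
      \<comment> \<open>For \<alpha> < 1/2 the power of \<open>A\<close> with exponent \<alpha> -
        1/2 only grows when \<open>A\<close> is replaced by the smaller \<open>B\<close>; no power
        of n is lost.\<close>
      case 4
      have "(A / 2)\<^sup>2 \<le> (A - B)\<^sup>2"
        using 4 A0 B0 by (intro power_mono) auto
      then have A2: "A\<^sup>2 \<le> 4 * (A - B)\<^sup>2"
        by (simp add: power_divide)
      have "A powr (\<alpha> + 3/2) * B powr (- \<alpha> - 1/2) = A\<^sup>2 * A powr (\<alpha> - 1/2) * B powr (- \<alpha> - 1/2)"
        by (simp add: Ap)
      also have "\<dots> \<le> A\<^sup>2 * B powr (\<alpha> - 1/2) * B powr (- \<alpha> - 1/2)"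
        using 4 A0 B0 by (intro mult_right_mono mult_left_mono powr_mono2') auto
      also have "\<dots> = A\<^sup>2 / B"
        using B0 by (simp add: powr_add[symmetric] powr_minus_divide mult.assoc)
      finally have "A powr (\<alpha> + 3/2) * B powr (- \<alpha> - 1/2) * (1 / (real n)\<^sup>2) \<le> A\<^sup>2 / B * (B / c)"
        using ic A0 B0 by (intro mult_mono) auto
      also have "\<dots> = A\<^sup>2 / c"
        using B0 by simp
      also have "\<dots> \<le> 4 * (A - B)\<^sup>2 / c"
        using A2 c by (intro divide_right_mono) auto
      finally show ?thesis
        using fin2 by simp
    qed
    then show "A powr (\<alpha> + 3/2) * B powr (- \<alpha> - 1/2) / (real n)\<^sup>2
        \<le> C * (real n powr max 0 (\<alpha> - 1/2))\<^sup>2 * (A - B)\<^sup>2"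
      by (simp add: m_def)
  qed
qed

text \<open>One constant for both ends: the estimate at the right end is applied to y and to its
  reflection. The last claim transfers bounds from the inner border of the right strip into the
  strip.\<close>

lemma jacobi_root_location:
  fixes \<alpha> \<beta> :: real
  assumes ab: "\<alpha> > -1" "\<beta> > -1"
  obtains c where "0 < c" "c \<le> 1"
    "\<And>n y z. 0 < n \<Longrightarrow> jacobi_ode \<alpha> \<beta> n y \<Longrightarrow> \<bar>z\<bar> < 1 \<Longrightarrow> poly y z = 0 \<Longrightarrow> c / (real n)\<^sup>2 \<le> 1 - \<bar>z\<bar>"
    "\<And>n y x. 0 < n \<Longrightarrow> jacobi_ode \<alpha> \<beta> n y \<Longrightarrow> 1 - c / (real n)\<^sup>2 \<le> x \<Longrightarrow> x \<le> 1
      \<Longrightarrow> \<bar>poly y x\<bar> \<le> 2 * \<bar>poly y (1 - c / (real n)\<^sup>2)\<bar>"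
proof -
  obtain c1 where c1: "0 < c1"
    "\<And>c n y t t'. c \<le> c1 \<Longrightarrow> 0 < c \<Longrightarrow> 0 < n \<Longrightarrow> jacobi_ode \<alpha> \<beta> n y
      \<Longrightarrow> t \<in> {1 - c / (real n)\<^sup>2..1} \<Longrightarrow> t' \<in> {1 - c / (real n)\<^sup>2..1}
      \<Longrightarrow> poly y t \<noteq> 0 \<and> \<bar>poly y t\<bar> \<le> 2 * \<bar>poly y t'\<bar>"
    using jacobi_ode_right_end[OF ab] by metis
  obtain c2 where c2: "0 < c2"
    "\<And>c n y t t'. c \<le> c2 \<Longrightarrow> 0 < c \<Longrightarrow> 0 < n \<Longrightarrow> jacobi_ode \<beta> \<alpha> n y
      \<Longrightarrow> t \<in> {1 - c / (real n)\<^sup>2..1} \<Longrightarrow> t' \<in> {1 - c / (real n)\<^sup>2..1}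
      \<Longrightarrow> poly y t \<noteq> 0 \<and> \<bar>poly y t\<bar> \<le> 2 * \<bar>poly y t'\<bar>"
    using jacobi_ode_right_end[OF ab(2,1)] by metis
  define c where "c = min 1 (min c1 c2)"
  have c: "0 < c" "c \<le> 1" "c \<le> c1" "c \<le> c2"
    using c1(1) c2(1) by (auto simp: c_def)
  show thesis
  proof
    fix n y and z :: real
    assume n: "0 < n" and ode: "jacobi_ode \<alpha> \<beta> n y" and z: "\<bar>z\<bar> < 1" "poly y z = 0"
    have d: "0 < c / (real n)\<^sup>2"
      using c n by simp
    have "z \<notin> {1 - c / (real n)\<^sup>2..1}"
      using c1(2)[OF c(3,1) n ode, of z z] z(2) by blast
    moreover have "- z \<notin> {1 - c / (real n)\<^sup>2..1}"
      using c2(2)[OF c(4,1) n jacobi_ode_reflect[OF ode], of "- z" "- z"] z(2) by (auto simp: poly_pcompose)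
    ultimately show "c / (real n)\<^sup>2 \<le> 1 - \<bar>z\<bar>"
      using z(1) by (auto simp: abs_if split: if_splits)
  next
    fix n y and x :: real
    assume n: "0 < n" and ode: "jacobi_ode \<alpha> \<beta> n y" and x: "1 - c / (real n)\<^sup>2 \<le> x" "x \<le> 1"
    have "0 < c / (real n)\<^sup>2"
      using c n by simp
    then show "\<bar>poly y x\<bar> \<le> 2 * \<bar>poly y (1 - c / (real n)\<^sup>2)\<bar>"
      using c1(2)[OF c(3,1) n ode, of x "1 - c / (real n)\<^sup>2"] x by auto
  qed (use c in auto)
qed

lemma liouville_weight_mult:
  assumes "\<bar>t\<bar> < 1"
  shows "liouville_weight \<alpha> \<beta> t * (1 - t\<^sup>2) = (1 - t) powr (\<alpha> + 3/2) * (1 + t) powr (\<beta> + 3/2)"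
proof -
  have t: "0 < 1 - t" "0 < 1 + t"
    using assms by auto
  have "1 - t\<^sup>2 = (1 - t) * (1 + t)"
    by (simp add: power2_eq_square algebra_simps)
  moreover have "\<alpha> + 3/2 = (\<alpha> + 1/2) + 1" "\<beta> + 3/2 = (\<beta> + 1/2) + 1"
    by simp_all
  ultimately show ?thesis
    using t by (simp only: liouville_weight_def powr_add powr_one mult_ac)
qed

text \<open>For x \<ge> 0 the factor 1 + x of the weight is harmless, so only \<alpha> enters. Far
  from the root, y(x) is compared with y'(z) by energies; near it, the mean value theorem reduces to
  y' at an intermediate point; in the strip at 1, the value at its border is used.\<close>

lemma jacobi_pointwise_bound_right:
  fixes \<alpha> \<beta> :: real
  assumes ab: "\<alpha> > -1" "\<beta> > -1"
  obtains C where "0 \<le> C"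
    "\<And>n y x z. 0 < n \<Longrightarrow> jacobi_ode \<alpha> \<beta> n y \<Longrightarrow> \<bar>z\<bar> < 1 \<Longrightarrow> poly y z = 0 \<Longrightarrow> 0 \<le> x \<Longrightarrow> x \<le> 1
      \<Longrightarrow> \<bar>poly y x\<bar> \<le> C * real n powr max 0 (\<alpha> - 1/2) * \<bar>x - z\<bar> * \<bar>poly (pderiv y) z\<bar>"
proof -
  obtain c where c: "0 < c" "c \<le> 1"
    and loc: "\<And>n y z. 0 < n \<Longrightarrow> jacobi_ode \<alpha> \<beta> n y \<Longrightarrow> \<bar>z\<bar> < 1 \<Longrightarrow> poly y z = 0 \<Longrightarrow> c / (real n)\<^sup>2 \<le> 1 - \<bar>z\<bar>"
    and right: "\<And>n y x. 0 < n \<Longrightarrow> jacobi_ode \<alpha> \<beta> n y \<Longrightarrow> 1 - c / (real n)\<^sup>2 \<le> x \<Longrightarrow> x \<le> 1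
      \<Longrightarrow> \<bar>poly y x\<bar> \<le> 2 * \<bar>poly y (1 - c / (real n)\<^sup>2)\<bar>"
    by (rule jacobi_root_location[OF ab]) blast
  obtain K where K: "0 < K"
    and bulk: "\<And>n y x z. 0 < n \<Longrightarrow> jacobi_ode \<alpha> \<beta> n y \<Longrightarrow> c / (real n)\<^sup>2 \<le> 1 - \<bar>x\<bar>
      \<Longrightarrow> c / (real n)\<^sup>2 \<le> 1 - \<bar>z\<bar> \<Longrightarrow> poly y z = 0
      \<Longrightarrow> liouville_weight \<alpha> \<beta> x * (poly y x)\<^sup>2
          \<le> K * (liouville_weight \<alpha> \<beta> z * (1 - z\<^sup>2) * (poly (pderiv y) z)\<^sup>2) / (real n)\<^sup>2
        \<and> liouville_weight \<alpha> \<beta> x * (1 - x\<^sup>2) * (poly (pderiv y) x)\<^sup>2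
          \<le> K * (liouville_weight \<alpha> \<beta> z * (1 - z\<^sup>2) * (poly (pderiv y) z)\<^sup>2)"
    by (rule jacobi_bulk_bound[OF ab c]) blast
  obtain C1 where C1: "0 < C1"
    and ratio: "\<And>n A B. 0 < n \<Longrightarrow> c / (real n)\<^sup>2 \<le> A \<Longrightarrow> A \<le> 2 \<Longrightarrow> c / (real n)\<^sup>2 \<le> B \<Longrightarrow> B \<le> 1
      \<Longrightarrow> 3 / 2 \<le> A \<or> 2 * A \<le> B \<or> 2 * B \<le> A
      \<Longrightarrow> A powr (\<alpha> + 3/2) * B powr (- \<alpha> - 1/2) / (real n)\<^sup>2
        \<le> C1 * (real n powr max 0 (\<alpha> - 1/2))\<^sup>2 * (A - B)\<^sup>2"
    by (rule jacobi_ratio_bound[OF ab(1) c]) blast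
  define P where "P = 2 powr (\<beta> + 3/2)"
  define w where "w = min 1 (2 powr (\<beta> + 1/2))"
  define C3 where "C3 = 2 powr (\<alpha> + 3/2) * 4 powr (\<beta> + 3/2)"
  define C2 where "C2 = K * P / w * C1 + K * C3"
  have pos: "0 < P" "0 < w" "0 < C3" "0 \<le> K * P / w * C1" "0 \<le> K * C3"
    using K C1 by (auto simp: P_def w_def C3_def)
  then have C2: "0 \<le> C2"
    by (simp add: C2_def)
  have core: "\<bar>poly y x\<bar> \<le> sqrt C2 * real n powr max 0 (\<alpha> - 1/2) * \<bar>x - z\<bar> * \<bar>poly (pderiv y) z\<bar>"
    if n: "0 < n" and ode: "jacobi_ode \<alpha> \<beta> n y" and z: "\<bar>z\<bar> < 1" "poly y z = 0"
      and x: "0 \<le> x" "x \<le> 1 - c / (real n)\<^sup>2" for n y x z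
  proof -
    define m where "m = (real n powr max 0 (\<alpha> - 1/2))\<^sup>2"
    define A B where "A = 1 - z" "B = 1 - x"
    note AB = this
    define y1 where "y1 = poly (pderiv y) z"
    define Vz where "Vz = A powr (\<alpha> + 3/2) * (1 + z) powr (\<beta> + 3/2)"
    have n1: "1 \<le> real n" using n by simp
    have cn: "0 < c / (real n)\<^sup>2" using c n1 by simp
    have zb: "c / (real n)\<^sup>2 \<le> 1 - \<bar>z\<bar>"
      by (rule loc[OF n ode z])
    have xb: "c / (real n)\<^sup>2 \<le> 1 - \<bar>x\<bar>"
      using x by simp
    have "1 \<le> real n powr max 0 (\<alpha> - 1/2)"
      using n1 by (intro ge_one_powr_ge_zero) auto
    then have m1: "1 \<le> m"
      unfolding m_def by simp
    have AB0: "0 < A" "A \<le> 2" "c / (real n)\<^sup>2 \<le> A" "0 < B" "B \<le> 1" "c / (real n)\<^sup>2 \<le> B"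
      using z zb x cn by (auto simp: AB)
    have Vz: "liouville_weight \<alpha> \<beta> z * (1 - z\<^sup>2) = Vz"
      using liouville_weight_mult[OF z(1)] by (simp add: Vz_def AB)
    have "(poly y x)\<^sup>2 \<le> C2 * m * (x - z)\<^sup>2 * y1\<^sup>2"
    \<comment> \<open>In the first case |x - z| is at least a fixed multiple of both
      \<open>A\<close> and \<open>B\<close>: note that \<open>B\<close> is at most 1 and
      \<open>A\<close> at most 2.\<close>
    proof (cases "3 / 2 \<le> A \<or> 2 * A \<le> B \<or> 2 * B \<le> A")
      case True
      have "w \<le> (1 + x) powr (\<beta> + 1/2)"
      proof (cases "\<beta> \<ge> -1/2")
        case True
        then have "1 \<le> (1 + x) powr (\<beta> + 1/2)"
          using x by (intro ge_one_powr_ge_zero) auto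
        then show ?thesis by (simp add: w_def)
      next
        case False
        then have "2 powr (\<beta> + 1/2) \<le> (1 + x) powr (\<beta> + 1/2)"
          using x cn by (intro powr_mono2') auto
        then show ?thesis by (simp add: w_def)
      qed
      then have "B powr (\<alpha> + 1/2) * w * (poly y x)\<^sup>2 \<le> liouville_weight \<alpha> \<beta> x * (poly y x)\<^sup>2"
        unfolding liouville_weight_def AB by (intro mult_right_mono mult_left_mono) auto
      also have "\<dots> \<le> K * (Vz * y1\<^sup>2) / (real n)\<^sup>2"
        using bulk[OF n ode xb zb z(2)] unfolding Vz y1_def by blast
      also have "\<dots> \<le> K * (A powr (\<alpha> + 3/2) * P * y1\<^sup>2) / (real n)\<^sup>2"
      proof -
        have "(1 + z) powr (\<beta> + 3/2) \<le> P"
          unfolding P_def using z ab by (intro powr_mono2) auto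
        then have "Vz \<le> A powr (\<alpha> + 3/2) * P"
          unfolding Vz_def by (intro mult_left_mono) auto
        then show ?thesis
          using K by (intro divide_right_mono mult_left_mono mult_right_mono) auto
      qed
      finally have "B powr (- \<alpha> - 1/2) / w * (B powr (\<alpha> + 1/2) * w * (poly y x)\<^sup>2)
          \<le> B powr (- \<alpha> - 1/2) / w * (K * (A powr (\<alpha> + 3/2) * P * y1\<^sup>2) / (real n)\<^sup>2)"
        using pos by (intro mult_left_mono) auto
      moreover have "B powr (- \<alpha> - 1/2) * B powr (\<alpha> + 1/2) = 1"
        using AB0 by (simp add: powr_add[symmetric])
      then have "B powr (- \<alpha> - 1/2) / w * (B powr (\<alpha> + 1/2) * w * (poly y x)\<^sup>2) = (poly y x)\<^sup>2"
        using pos by simp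
      ultimately have "(poly y x)\<^sup>2 \<le>
          K * P / w * y1\<^sup>2 * (A powr (\<alpha> + 3/2) * B powr (- \<alpha> - 1/2) / (real n)\<^sup>2)"
        by (simp add: mult_ac)
      also have "\<dots> \<le> K * P / w * y1\<^sup>2 * (C1 * m * (A - B)\<^sup>2)"
        unfolding m_def using K pos
        by (intro mult_left_mono ratio n AB0 True) auto
      also have "\<dots> = K * P / w * C1 * (m * (x - z)\<^sup>2 * y1\<^sup>2)"
        by (simp add: AB mult_ac)
      also have "\<dots> \<le> C2 * (m * (x - z)\<^sup>2 * y1\<^sup>2)"
        using pos m1 by (intro mult_right_mono) (auto simp: C2_def)
      finally show ?thesis
        by (simp add: mult_ac)
    next
      case False
      then have near: "A < 3 / 2" "B < 2 * A" "A < 2 * B" by auto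
      have "\<exists>\<xi>. min x z \<le> \<xi> \<and> \<xi> \<le> max x z \<and> poly y x = (x - z) * poly (pderiv y) \<xi>"
      proof (cases x z rule: linorder_cases)
        case less
        then obtain \<xi> where "x < \<xi>" "\<xi> < z" "poly y z - poly y x = (z - x) * poly (pderiv y) \<xi>"
          using poly_MVT by blast
        then show ?thesis
          using z(2) less by (intro exI[of _ \<xi>]) (auto simp: algebra_simps)
      next
        case greater
        then obtain \<xi> where "z < \<xi>" "\<xi> < x" "poly y x - poly y z = (x - z) * poly (pderiv y) \<xi>"
          using poly_MVT by blast
        then show ?thesis
          using z(2) greater by (intro exI[of _ \<xi>]) auto
      qed (use z(2) in auto)
      then obtain \<xi> where \<xi>: "min x z \<le> \<xi>" "\<xi> \<le> max x z" "poly y x = (x - z) * poly (pderiv y) \<xi>"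
        by blast
      have \<xi>b: "c / (real n)\<^sup>2 \<le> 1 - \<bar>\<xi>\<bar>"
        using xb zb \<xi>(1,2) by (auto simp: min_def max_def abs_if split: if_splits)
      then have \<xi>1: "\<bar>\<xi>\<bar> < 1"
        using cn by linarith
      define V where "V = (1 - \<xi>) powr (\<alpha> + 3/2) * (1 + \<xi>) powr (\<beta> + 3/2)"
      have V: "0 < V"
        unfolding V_def using \<xi>1 by (intro mult_pos_pos) auto
      \<comment> \<open>As \<xi> lies between \<open>x\<close> and \<open>z\<close> and A < 2 B, the
        weight at \<open>z\<close> exceeds that at \<xi> by at most a constant factor.\<close>
      have "Vz \<le> (2 * (1 - \<xi>)) powr (\<alpha> + 3/2) * (4 * (1 + \<xi>)) powr (\<beta> + 3/2)"
        unfolding Vz_def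
      proof (intro mult_mono powr_mono2)
        show "A \<le> 2 * (1 - \<xi>)" "1 + z \<le> 4 * (1 + \<xi>)"
          using near \<xi>(1,2) x z(1) by (auto simp: AB min_def max_def split: if_splits)
      qed (use ab z AB0 in auto)
      also have "\<dots> = C3 * V"
        unfolding C3_def V_def using \<xi>1 by (simp only: powr_mult mult_ac)
      finally have VV: "Vz \<le> C3 * V" .
      have "V * (poly (pderiv y) \<xi>)\<^sup>2 \<le> K * (Vz * y1\<^sup>2)"
        using bulk[OF n ode \<xi>b zb z(2)] unfolding Vz y1_def V_def liouville_weight_mult[OF \<xi>1] by blast
      also have "\<dots> \<le> K * (C3 * V * y1\<^sup>2)"
        using K VV by (intro mult_left_mono mult_right_mono) auto
      also have "\<dots> = V * (K * C3 * y1\<^sup>2)"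
        by simp
      finally have d: "(poly (pderiv y) \<xi>)\<^sup>2 \<le> K * C3 * y1\<^sup>2"
        using V by simp
      have "(poly y x)\<^sup>2 = (x - z)\<^sup>2 * (poly (pderiv y) \<xi>)\<^sup>2"
        by (simp add: \<xi>(3) power_mult_distrib)
      also have "\<dots> \<le> (x - z)\<^sup>2 * (K * C3 * y1\<^sup>2)"
        by (intro mult_left_mono d) auto
      also have "\<dots> = K * C3 * 1 * ((x - z)\<^sup>2 * y1\<^sup>2)"
        by simp
      also have "\<dots> \<le> C2 * m * ((x - z)\<^sup>2 * y1\<^sup>2)"
        using pos m1 C2 by (intro mult_right_mono mult_mono) (auto simp: C2_def)
      finally show ?thesis
        by (simp add: mult_ac)
    qed
    also have "\<dots> = (sqrt C2 * real n powr max 0 (\<alpha> - 1/2) * \<bar>x - z\<bar> * \<bar>y1\<bar>)\<^sup>2"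
      using C2 by (simp add: power_mult_distrib m_def)
    finally have "\<bar>poly y x\<bar>\<^sup>2 \<le> (sqrt C2 * real n powr max 0 (\<alpha> - 1/2) * \<bar>x - z\<bar> * \<bar>y1\<bar>)\<^sup>2"
      by simp
    then show ?thesis
      unfolding y1_def by (rule power2_le_imp_le) (use C2 in auto)
  qed
  show thesis
  proof
    show "0 \<le> 2 * sqrt C2"
      using C2 by simp
    fix n y and x z :: real
    assume n: "0 < n" and ode: "jacobi_ode \<alpha> \<beta> n y" and z: "\<bar>z\<bar> < 1" "poly y z = 0" and x: "0 \<le> x" "x \<le> 1"
    define x0 where "x0 = 1 - c / (real n)\<^sup>2"
    define T where "T t = sqrt C2 * real n powr max 0 (\<alpha> - 1/2) * \<bar>t - z\<bar> * \<bar>poly (pderiv y) z\<bar>" for t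
    have T0: "0 \<le> T t" for t
      using C2 by (simp add: T_def)
    have "\<bar>poly y x\<bar> \<le> 2 * T x"
    proof (cases "x \<le> x0")
      case True
      then show ?thesis
        using core[OF n ode z x(1)] T0[of x] by (simp add: T_def x0_def)
    next
      case False
      have "1 \<le> (real n)\<^sup>2"
        using n by simp
      then have "c / (real n)\<^sup>2 \<le> 1"
        using c by (simp add: divide_le_eq)
      then have x00: "0 \<le> x0"
        by (simp add: x0_def)
      have "\<bar>poly y x\<bar> \<le> 2 * \<bar>poly y x0\<bar>"
        using right[OF n ode, of x] False x by (simp add: x0_def)
      also have "\<dots> \<le> 2 * T x0"
        using core[OF n ode z x00] by (simp add: T_def x0_def)
      \<comment> \<open>All roots lie to the left of \<open>x0\<close>, so moving from
        \<open>x0\<close> to \<open>x\<close> only increases the distance to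
        \<open>z\<close>.\<close>
      also have "\<dots> \<le> 2 * T x"
      proof -
        have "\<bar>x0 - z\<bar> \<le> \<bar>x - z\<bar>"
          using loc[OF n ode z] False by (auto simp: x0_def)
        then show ?thesis
          unfolding T_def using C2 by (intro mult_left_mono mult_right_mono) auto
      qed
      finally show ?thesis .
    qed
    then show "\<bar>poly y x\<bar> \<le> 2 * sqrt C2 * real n powr max 0 (\<alpha> - 1/2) * \<bar>x - z\<bar> * \<bar>poly (pderiv y) z\<bar>"
      by (simp add: T_def)
  qed
qed

lemma jacobi_pointwise_bound:
  fixes \<alpha> \<beta> :: real
  assumes ab: "\<alpha> > -1" "\<beta> > -1"
  obtains C where "0 \<le> C"
    "\<And>n y x z. 0 < n \<Longrightarrow> jacobi_ode \<alpha> \<beta> n y \<Longrightarrow> \<bar>z\<bar> < 1 \<Longrightarrow> poly y z = 0 \<Longrightarrow> \<bar>x\<bar> \<le> 1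
      \<Longrightarrow> \<bar>poly y x\<bar> \<le> C * real n powr max 0 (max \<alpha> \<beta> - 1/2) * \<bar>x - z\<bar> * \<bar>poly (pderiv y) z\<bar>"
proof -
  obtain C1 where C1: "0 \<le> C1"
    "\<And>n y x z. 0 < n \<Longrightarrow> jacobi_ode \<alpha> \<beta> n y \<Longrightarrow> \<bar>z\<bar> < 1 \<Longrightarrow> poly y z = 0 \<Longrightarrow> 0 \<le> x \<Longrightarrow> x \<le> 1
      \<Longrightarrow> \<bar>poly y x\<bar> \<le> C1 * real n powr max 0 (\<alpha> - 1/2) * \<bar>x - z\<bar> * \<bar>poly (pderiv y) z\<bar>"
    by (rule jacobi_pointwise_bound_right[OF ab]) blast
  obtain C2 where C2: "0 \<le> C2"
    "\<And>n y x z. 0 < n \<Longrightarrow> jacobi_ode \<beta> \<alpha> n y \<Longrightarrow> \<bar>z\<bar> < 1 \<Longrightarrow> poly y z = 0 \<Longrightarrow> 0 \<le> x \<Longrightarrow> x \<le> 1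
      \<Longrightarrow> \<bar>poly y x\<bar> \<le> C2 * real n powr max 0 (\<beta> - 1/2) * \<bar>x - z\<bar> * \<bar>poly (pderiv y) z\<bar>"
    by (rule jacobi_pointwise_bound_right[OF ab(2,1)]) blast
  define C where "C = max C1 C2"
  show thesis
  proof
    show "0 \<le> C" using C1 by (simp add: C_def)
    fix n y and x z :: real
    assume n: "0 < n" and ode: "jacobi_ode \<alpha> \<beta> n y" and z: "\<bar>z\<bar> < 1" "poly y z = 0" and x: "\<bar>x\<bar> \<le> 1"
    have le: "C' * real n powr max 0 (\<delta> - 1/2) * \<bar>x - z\<bar> * \<bar>poly (pderiv y) z\<bar>
        \<le> C * real n powr max 0 (max \<alpha> \<beta> - 1/2) * \<bar>x - z\<bar> * \<bar>poly (pderiv y) z\<bar>"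
      if "0 \<le> C'" "C' \<le> C" "\<delta> \<le> max \<alpha> \<beta>" for C' \<delta>
      using that n by (intro mult_right_mono mult_mono powr_mono) auto
    show "\<bar>poly y x\<bar> \<le> C * real n powr max 0 (max \<alpha> \<beta> - 1/2) * \<bar>x - z\<bar> * \<bar>poly (pderiv y) z\<bar>"
    proof (cases "0 \<le> x")
      case True
      then show ?thesis
        using C1(2)[OF n ode z True] le[of C1 \<alpha>] C1(1) x by (simp add: C_def)
    next
      case False
      have "\<bar>poly (pcompose y [:0, -1:]) (- x)\<bar>
        \<le> C2 * real n powr max 0 (\<beta> - 1/2) * \<bar>- x - - z\<bar> * \<bar>poly (pderiv (pcompose y [:0, -1:])) (- z)\<bar>"
        by (rule C2(2)[OF n jacobi_ode_reflect[OF ode]]) (use z False x in \<open>auto simp: poly_pcompose\<close>)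
      then have "\<bar>poly y x\<bar> \<le> C2 * real n powr max 0 (\<beta> - 1/2) * \<bar>x - z\<bar> * \<bar>poly (pderiv y) z\<bar>"
        by (simp add: poly_pcompose pderiv_pcompose pderiv_pCons abs_minus_commute)
      then show ?thesis
        using le[of C2 \<beta>] C2(1) by (simp add: C_def)
    qed
  qed
qed

lemma jacobi_lagrange_bound:
  fixes \<alpha> \<beta> :: real
  assumes ab: "\<alpha> > -1" "\<beta> > -1"
  obtains C where "0 \<le> C"
    "\<And>n x z. 0 < n \<Longrightarrow> poly (jacobi_poly \<alpha> \<beta> n) z = 0 \<Longrightarrow> x \<in> {-1..1}
      \<Longrightarrow> \<bar>poly (lagrange_basis {z. poly (jacobi_poly \<alpha> \<beta> n) z = 0} z) x\<bar>
        \<le> C * real n powr max 0 (max \<alpha> \<beta> - 1/2)"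
proof -
  obtain C where C: "0 \<le> C"
    "\<And>n y x z. 0 < n \<Longrightarrow> jacobi_ode \<alpha> \<beta> n y \<Longrightarrow> \<bar>z\<bar> < 1 \<Longrightarrow> poly y z = 0 \<Longrightarrow> \<bar>x\<bar> \<le> 1
      \<Longrightarrow> \<bar>poly y x\<bar> \<le> C * real n powr max 0 (max \<alpha> \<beta> - 1/2) * \<bar>x - z\<bar> * \<bar>poly (pderiv y) z\<bar>"
    by (rule jacobi_pointwise_bound[OF ab]) blast
  show thesis
  proof
    show "0 \<le> max 1 C" by simp
    fix n :: nat and x z :: real
    assume n: "0 < n" and z: "poly (jacobi_poly \<alpha> \<beta> n) z = 0" and x: "x \<in> {-1..1}"
    define P where "P = jacobi_poly \<alpha> \<beta> n"
    define Z where "Z = {z. poly P z = 0}"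
    define m where "m = real n powr max 0 (max \<alpha> \<beta> - 1/2)"
    note props = jacobi_poly_props[OF ab n, folded P_def]
    note roots = jacobi_orthogonal_roots[OF n props(1,2), folded Z_def]
    have P0: "P \<noteq> 0"
      using props(1) n by auto
    have zZ: "z \<in> Z"
      using z by (simp add: Z_def P_def)
    have m1: "1 \<le> m"
      unfolding m_def using n by (intro ge_one_powr_ge_zero) auto
    have "\<bar>poly (lagrange_basis Z z) x\<bar> \<le> max 1 C * m"
    proof (cases "x = z")
      case True
      then have "\<bar>poly (lagrange_basis Z z) x\<bar> = 1 * 1"
        using poly_lagrange_basis[OF roots(1) zZ zZ] by simp
      also have "\<dots> \<le> max 1 C * m"
        using m1 by (intro mult_mono) auto
      finally show ?thesis .
    next
      case False
      have lc: "lead_coeff P \<noteq> 0"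
        using P0 by simp
      note nonroot = lagrange_basis_nonroot[OF roots(4) lc roots(1) zZ]
      have ode: "jacobi_ode \<alpha> \<beta> n P"
        by (rule jacobi_ode_if_op_eq_0[OF props(3) P0])
      have "\<bar>z\<bar> < 1"
        using roots(2) zZ by (auto simp: abs_less_iff)
      then have "\<bar>poly P x\<bar> \<le> C * m * \<bar>x - z\<bar> * \<bar>poly (pderiv P) z\<bar>"
        unfolding m_def by (intro C(2) n ode) (use z x in \<open>auto simp: P_def\<close>)
      moreover have "\<bar>poly P x\<bar> = \<bar>poly (lagrange_basis Z z) x\<bar> * (\<bar>x - z\<bar> * \<bar>poly (pderiv P) z\<bar>)"
        by (simp add: nonroot(2)[of x, symmetric] abs_mult)
      ultimately have "\<bar>poly (lagrange_basis Z z) x\<bar> * (\<bar>x - z\<bar> * \<bar>poly (pderiv P) z\<bar>)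
          \<le> C * m * (\<bar>x - z\<bar> * \<bar>poly (pderiv P) z\<bar>)"
        by (simp add: mult.assoc)
      then have "\<bar>poly (lagrange_basis Z z) x\<bar> \<le> C * m"
        by (rule mult_right_le_imp_le) (use False nonroot(1) in simp)
      also have "\<dots> \<le> max 1 C * m"
        using m1 by (intro mult_right_mono) auto
      finally show ?thesis .
    qed
    then show "\<bar>poly (lagrange_basis {z. poly (jacobi_poly \<alpha> \<beta> n) z = 0} z) x\<bar>
        \<le> max 1 C * real n powr max 0 (max \<alpha> \<beta> - 1/2)"
      by (simp add: Z_def P_def m_def)
  qed
qed

section \<open>The rate of convergence at the Jacobi nodes\<close>

lemma jacobi_interp_eq_interpolant:
  assumes "\<alpha> > -1" "\<beta> > -1" "0 < n"
  shows "jacobi_interp \<alpha> \<beta> n f = interpolant {z. poly (jacobi_poly \<alpha> \<beta> n) z = 0} f"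
proof -
  define Z where "Z = {z. poly (jacobi_poly \<alpha> \<beta> n) z = 0}"
  note props = jacobi_poly_props[OF assms]
  have Z: "finite Z" "card Z = n"
    using jacobi_orthogonal_roots[OF assms(3) props(1,2)] by (auto simp: Z_def)
  then have ne: "Z \<noteq> {}"
    using assms(3) by auto
  have "jacobi_interp \<alpha> \<beta> n f = interpolant Z f"
    unfolding jacobi_interp_def
  proof (rule the_equality)
    show "degree (interpolant Z f) < n \<and>
        (\<forall>x. poly (jacobi_poly \<alpha> \<beta> n) x = 0 \<longrightarrow> poly (interpolant Z f) x = f x)"
      using degree_interpolant[OF Z(1) ne, of f] poly_interpolant[OF Z(1)] Z(2) by (auto simp: Z_def)
    fix p assume p: "degree p < n \<and> (\<forall>x. poly (jacobi_poly \<alpha> \<beta> n) x = 0 \<longrightarrow> poly p x = f x)"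
    show "p = interpolant Z f"
    proof (rule interpolant_unique[OF Z(1)])
      show "degree p < card Z"
        using p Z(2) by simp
      show "poly p z = f z" if "z \<in> Z" for z
        using p that by (simp add: Z_def)
    qed
  qed
  then show ?thesis
    by (simp add: Z_def)
qed

theorem theorem4p4:
  fixes \<alpha> \<beta> \<gamma> :: real and r :: nat and f g :: "real \<Rightarrow> real"
  assumes "\<alpha> > -1" and "\<beta> > -1" and "\<gamma> = max \<alpha> \<beta>"
    and "r \<ge> 1"
    and "times_differentiable_on (r - 1) f {-1..1}"
    and "abs_continuous_on {-1..1} (nth_deriv_on {-1..1} (r - 1) f)"
    and "g absolutely_integrable_on {-1..1}"
    and "bounded_variation_on {-1..1} g"
    and "\<forall>t\<in>{-1..1}. nth_deriv_on {-1..1} (r - 1) f t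
           = nth_deriv_on {-1..1} (r - 1) f (-1) + integral {-1..t} g"
  shows "\<exists>C. \<forall>n\<ge>r + 1. sup_norm (interp_error \<alpha> \<beta> n f)
           \<le> C * real n powr (- real r + max 0 (\<gamma> - 1 / 2))"
proof -
  define D where "D k = nth_deriv_on {-1..1} k f" for k
  define s where "s = r - 1"
  have r: "r = Suc s"
    using assms(4) by (simp add: s_def)
  have D: "(D k has_real_derivative D (Suc k) t) (at t within {-1..1})" if "k < s" "t \<in> {-1..1}" for k t
  proof -
    have "D k differentiable (at t within {-1..1})"
      using assms(5) that by (auto simp: times_differentiable_on_def D_def s_def differentiable_on_def)
    then show ?thesis
      by (simp add: vector_derivative_works D_def has_real_derivative_iff_has_vector_derivative)
  qed
  have h: "D s t = D s (-1) + integral {-1..t} g" if "t \<in> {-1..1}" for t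
    using assms(9) that unfolding D_def s_def by blast
  obtain C1 where C1: "0 \<le> C1"
    "\<And>Z x \<Lambda>. finite Z \<Longrightarrow> Z \<subseteq> {-1..1} \<Longrightarrow> Suc s < card Z \<Longrightarrow> x \<in> {-1..1} \<Longrightarrow> 0 \<le> \<Lambda>
      \<Longrightarrow> (\<And>z. z \<in> Z \<Longrightarrow> \<bar>poly (lagrange_basis Z z) x\<bar> \<le> \<Lambda>)
      \<Longrightarrow> \<bar>D 0 x - poly (interpolant Z (D 0)) x\<bar> \<le> C1 * \<Lambda> / card Z ^ Suc s"
    by (rule interpolation_error_bounded_variation[OF D assms(7,8) h]) blast+
  obtain C2 where C2: "0 \<le> C2"
    "\<And>n x z. 0 < n \<Longrightarrow> poly (jacobi_poly \<alpha> \<beta> n) z = 0 \<Longrightarrow> x \<in> {-1..1}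
      \<Longrightarrow> \<bar>poly (lagrange_basis {z. poly (jacobi_poly \<alpha> \<beta> n) z = 0} z) x\<bar>
        \<le> C2 * real n powr max 0 (max \<alpha> \<beta> - 1/2)"
    by (rule jacobi_lagrange_bound[OF assms(1,2)]) blast
  show ?thesis
  proof (intro exI allI impI)
    \<comment> \<open>As there are n nodes, this is the condition \<open>Suc s < card Z\<close>,
      under which the kernel of order r - 1 is orthogonal to constants.\<close>
    fix n assume n: "r + 1 \<le> n"
    then have n0: "0 < n" by simp
    define Z where "Z = {z. poly (jacobi_poly \<alpha> \<beta> n) z = 0}"
    define \<Lambda> where "\<Lambda> = C2 * real n powr max 0 (\<gamma> - 1/2)"
    note props = jacobi_poly_props[OF assms(1,2) n0]
    note roots = jacobi_orthogonal_roots[OF n0 props(1,2), folded Z_def]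
    have "\<bar>interp_error \<alpha> \<beta> n f x\<bar> \<le> C1 * C2 * real n powr (- real r + max 0 (\<gamma> - 1 / 2))"
      if x: "x \<in> {-1..1}" for x
    proof -
      have "\<bar>D 0 x - poly (interpolant Z (D 0)) x\<bar> \<le> C1 * \<Lambda> / card Z ^ Suc s"
      proof (rule C1(2))
        show "\<bar>poly (lagrange_basis Z z) x\<bar> \<le> \<Lambda>" if "z \<in> Z" for z
          using C2(2)[OF n0 _ x, of z] that by (simp add: Z_def \<Lambda>_def assms(3))
        show "Z \<subseteq> {-1..1}"
          using roots(2) by auto
      qed (use roots n r x C2(1) in \<open>auto simp: \<Lambda>_def\<close>)
      also have "\<dots> = C1 * C2 * real n powr (- real r + max 0 (\<gamma> - 1 / 2))"
      proof -
        have "real n powr (- real r + max 0 (\<gamma> - 1 / 2)) = real n powr max 0 (\<gamma> - 1 / 2) / real n ^ Suc s"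
          using n0 by (simp add: powr_diff powr_realpow flip: r)
        then show ?thesis
          unfolding \<Lambda>_def roots(3) by simp
      qed
      finally show ?thesis
        by (simp add: interp_error_def jacobi_interp_eq_interpolant[OF assms(1,2) n0] D_def Z_def)
    qed
    then show "sup_norm (interp_error \<alpha> \<beta> n f) \<le> C1 * C2 * real n powr (- real r + max 0 (\<gamma> - 1 / 2))"
      unfolding sup_norm_def by (intro cSUP_least) auto
  qed
qed

end
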